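(* Let $n\ge 3$, let $V\ge 0$ be a potential on $\mathbb{R}^n$, not identically zero, with $V\in RH_q$ for some $q\ge n/2$, and let $\mathcal{L}=-\Delta+V$. Let $M$ be the uncentered Hardy--Littlewood maximal operator. Then there is a constant $C>0$ such that for each $f\in \mathrm{BMO}_{\mathcal{L}}(\mathbb{R}^n)$ the function $Mf$ belongs to $\mathrm{BMO}_{\mathcal{L}}(\mathbb{R}^n)$, with $$\|Mf\|_{\mathrm{BMO}_{\mathcal{L}}(\mathbb{R}^n)}\le C\,\|f\|_{\mathrm{BMO}_{\mathcal{L}}(\mathbb{R}^n)},$$ where $C$ is independent of $f$. Moreover, if $f\in \mathrm{CMO}_{\mathcal{L}}(\mathbb{R}^n)$, then $Mf\in \mathrm{CMO}_{\mathcal{L}}(\mathbb{R}^n)$.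
   Context: Reverse Hölder class: $V\in RH_q$ means $V\in L^q_{\mathrm{loc}}(\mathbb{R}^n)$, $V\ge 0$, and there is a constant $C>0$ with $\left(\frac1{|B|}\int_B V^q\,dy\right)^{1/q}\le \frac{C}{|B|}\int_B V\,dy$ for all balls $B\subset\mathbb{R}^n$. Critical radius function: $\rho(x)=\sup\{r>0:\ r^{2-n}\int_{B(x,r)}V(y)\,dy\le 1\}$. $\mathrm{BMO}_{\mathcal{L}}(\mathbb{R}^n)$ is the space of locally integrable functions $f$ with $$\|f\|_{\mathrm{BMO}_{\mathcal{L}}}=\sup_{B=B(x_B,r_B):\,r_B<\rho(x_B)}\frac1{|B|}\int_B|f-f_B|\,dy+\sup_{B=B(x_B,r_B):\,r_B\ge\rho(x_B)}\frac1{|B|}\int_B|f|\,dy<\infty,$$ where $f_B=\frac1{|B|}\int_B f$. $\mathrm{CMO}_{\mathcal{L}}(\mathbb{R}^n)$ is the closure of $C_c^\infty(\mathbb{R}^n)$ in $\mathrm{BMO}_{\mathcal{L}}(\mathbb{R}^n)$ with respect to the $\mathrm{BMO}_{\mathcal{L}}$ norm. Maximal operator: $Mf(x)=\sup_{B\ni x}\frac1{|B|}\int_B|f(y)|\,dy$, the supremum being over all balls $B$ containing $x$. *)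

theory Defs
  imports "HOL-Analysis.Analysis"
begin

section \<open>Local integrability and averages\<close>

definition locally_integrable :: "('a::euclidean_space \<Rightarrow> 'b::{banach, second_countable_topology}) \<Rightarrow> bool"
  where "locally_integrable f \<longleftrightarrow>
    f \<in> borel_measurable lebesgue \<and> (\<forall>K. compact K \<longrightarrow> set_integrable lebesgue K f)"

definition Lq_loc :: "real \<Rightarrow> ('a::euclidean_space \<Rightarrow> real) set"
  where "Lq_loc q = {V. V \<in> borel_measurable lebesgue \<and>
    (\<forall>K. compact K \<longrightarrow> set_integrable lebesgue K (\<lambda>y. \<bar>V y\<bar> powr q))}"

definition ball_avg :: "'a::euclidean_space \<Rightarrow> real \<Rightarrow> ('a \<Rightarrow> 'b::{banach, second_countable_topology}) \<Rightarrow> 'b"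
  where "ball_avg c r f = (LINT y:ball c r|lebesgue. f y) /\<^sub>R measure lebesgue (ball c r)"

text \<open>The average of \<open>\<bar>f\<bar>\<close> over a ball, as an extended number: it is \<open>\<infinity>\<close> if \<open>f\<close> is not
  integrable there.\<close>

definition abs_avg :: "'a::euclidean_space \<Rightarrow> real \<Rightarrow> ('a \<Rightarrow> 'b::real_normed_vector) \<Rightarrow> ennreal"
  where "abs_avg c r f =
    (\<integral>\<^sup>+y\<in>ball c r. ennreal (norm (f y)) \<partial>lebesgue) / emeasure lebesgue (ball c r)"

section \<open>Reverse Hoelder potentials and the critical radius\<close>

definition reverse_Holder :: "real \<Rightarrow> ('a::euclidean_space \<Rightarrow> real) set"
  where "reverse_Holder q = {V. V \<in> Lq_loc q \<and> (AE y in lebesgue. 0 \<le> V y) \<and>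
    (\<exists>C>0. \<forall>c. \<forall>r>0.
      ball_avg c r (\<lambda>y. V y powr q) powr (1 / q) \<le> C * ball_avg c r V)}"

text \<open>The supremum is taken in \<open>[0, \<infinity>]\<close>, so that it has its usual meaning without
  knowing beforehand that the set of radii is bounded.\<close>

definition critical_radius :: "('a::euclidean_space \<Rightarrow> real) \<Rightarrow> 'a \<Rightarrow> ennreal"
  where "critical_radius V x =
    (SUP r\<in>{r. 0 < r \<and>
        r powr (2 - real DIM('a)) * (LINT y:ball x r|lebesgue. V y) \<le> 1}. ennreal r)"

section \<open>The spaces BMO and CMO of the operator \<open>-\<Delta> + V\<close>\<close>

text \<open>The operator enters only through the critical radius of \<open>V\<close>. As usual, functions
  that agree almost everywhere are not distinguished by the seminorm below.\<close>

definition BMO_L_norm :: "('a::euclidean_space \<Rightarrow> real)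
    \<Rightarrow> ('a \<Rightarrow> 'b::{banach, second_countable_topology}) \<Rightarrow> ennreal"
  where "BMO_L_norm V f =
    (SUP (c, r)\<in>{(c, r). 0 < r \<and> ennreal r < critical_radius V c}.
        abs_avg c r (\<lambda>y. f y - ball_avg c r f)) +
    (SUP (c, r)\<in>{(c, r). 0 < r \<and> critical_radius V c \<le> ennreal r}.
        abs_avg c r f)"

definition BMO_L :: "('a::euclidean_space \<Rightarrow> real)
    \<Rightarrow> ('a \<Rightarrow> 'b::{banach, second_countable_topology}) set"
  where "BMO_L V = {f. locally_integrable f \<and> BMO_L_norm V f < \<infinity>}"

primrec C_k :: "nat \<Rightarrow> ('a::euclidean_space \<Rightarrow> 'b::real_normed_vector) \<Rightarrow> bool"
  where
    "C_k 0 f \<longleftrightarrow> continuous_on UNIV f"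
  | "C_k (Suc k) f \<longleftrightarrow>
      f differentiable_on UNIV \<and> (\<forall>v. C_k k (\<lambda>x. frechet_derivative f (at x) v))"

definition Cc_infinity :: "('a::euclidean_space \<Rightarrow> 'b::real_normed_vector) set"
  where "Cc_infinity = {g. (\<forall>k. C_k k g) \<and> compact (closure {x. g x \<noteq> 0})}"

definition CMO_L :: "('a::euclidean_space \<Rightarrow> real)
    \<Rightarrow> ('a \<Rightarrow> 'b::{banach, second_countable_topology}) set"
  where "CMO_L V = {f \<in> BMO_L V. \<forall>\<epsilon>>0. \<exists>g\<in>Cc_infinity.
    BMO_L_norm V (\<lambda>x. f x - g x) < ennreal \<epsilon>}"

section \<open>The uncentered maximal operator\<close>

text \<open>Extended-valued, since \<open>Mf\<close> may be infinite at some points.\<close>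

definition maximal_op :: "('a::euclidean_space \<Rightarrow> 'b::real_normed_vector) \<Rightarrow> 'a \<Rightarrow> ennreal"
  where "maximal_op f x = (SUP (c, r)\<in>{(c, r). x \<in> ball c r}. abs_avg c r f)"

text \<open>\<open>Mf\<close> as a scalar function. The value 0 at points where \<open>Mf\<close> is infinite is
  meaningful only if these form a null set, which has to be asserted separately.\<close>

definition maximal_fun :: "('a::euclidean_space \<Rightarrow> 'b::{real_normed_algebra_1}) \<Rightarrow> 'a \<Rightarrow> 'b"
  where "maximal_fun f x = of_real (enn2real (maximal_op f x))"

end

theory Submission
  imports Defs
begin

text \<open>
  For a ball \<open>B\<close> let \<open>A\<^sub>B\<close> be the supremum of the averages of \<open>\<bar>f\<bar>\<close> over the balls containing
  \<open>B\<close>. Then \<open>Mf \<ge> A\<^sub>B\<close> on \<open>B\<close>, and a stopping time argument in the spirit of John and Nirenberg,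
  applied directly to the maximal function, gives \<open>\<integral>\<^sub>B (Mf - A\<^sub>B) \<le> C \<parallel>f\<parallel> \<bar>B\<bar>\<close>. This bounds the
  oscillation of \<open>Mf\<close> on \<open>B\<close>, and also its average when \<open>r\<^sub>B \<ge> \<rho>(x\<^sub>B)\<close>, since then \<open>A\<^sub>B \<le> C \<parallel>f\<parallel>\<close>.
  Of the critical radius only its finiteness is needed here.

  \<open>M\<close> is not continuous on BMO, so CMO is handled by a vanishing condition: oscillations
  (and averages, if \<open>r\<^sub>B \<ge> \<rho>(x\<^sub>B)\<close>) tend to zero over balls that are small, large or far away.
  If \<open>f = g + w\<close> with \<open>g\<close> in \<open>C\<^sub>c\<close> and \<open>w\<close> small in norm, then
  \<open>Mf - A\<^sub>B(f) \<le> Mg + A\<^sub>B(g) + (Mw - A\<^sub>B(w))\<close>, and \<open>A\<^sub>B(g) \<le> Mg\<close> is small on average over large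
  or far balls, while for small balls the stopping time argument is run at small scales.
  Conversely a function with the vanishing condition is approximated by its averages over balls
  of a fixed small radius, minus their minimum with a small multiple of \<open>ln \<bar>x\<bar>\<close>.
  This uses that \<open>\<rho>\<close> grows at most linearly and is locally bounded away from zero; both follow
  from the reverse Hoelder inequality by elementary means even for \<open>q = n / 2\<close>.
\<close>

section \<open>Averages over balls\<close>

text \<open>Oscillation is measured against an arbitrary constant, so one-sided control suffices:
  \<open>A\<^sub>B\<close> is a single number below \<open>Mf\<close> on \<open>B\<close>, and the
  mean of \<open>Mf - A\<^sub>B\<close> bounds the oscillation at once. The obstacle for CMO is that
  \<open>\<bar>Mf - Mg\<bar> \<le> M(f - g)\<close> does not help: below the critical radius a
  function of small norm may have large averages, so the right-hand side bounds no oscillation. The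
  vanishing condition concerns \<open>Mf\<close> alone and avoids differences of maximal functions.
  The logarithm has the same origin. Averages are known to be small only from the critical radius
  on, which may be as large as a multiple of \<bar>x\<bar>; each halving of the radius on the way
  down to a fixed one costs one oscillation, so at x the fixed-scale averages are merely bounded by
  a small multiple of ln \<bar>x\<bar> and need not tend to zero. Cutting them off at a large sphere
  could leave a large error, whereas their minimum with a small multiple of the logarithm is small
  in norm, and subtracting it leaves compact support.\<close>

lemma radius_pos: "x \<in> ball c r \<Longrightarrow> 0 < r"
  by (metis mem_ball zero_le_dist le_less_trans)

lemma emeasure_lebesgue_ball:
  fixes c :: "'a::euclidean_space"
  assumes "0 < r"
  shows "emeasure lebesgue (ball c r) = ennreal (unit_ball_vol DIM('a) * r ^ DIM('a))"
  using assms emeasure_ball[of r c] by simp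

lemma emeasure_lebesgue_ball_pos:
  fixes c :: "'a::euclidean_space"
  assumes "0 < r"
  shows "0 < emeasure lebesgue (ball c r)" "emeasure lebesgue (ball c r) \<noteq> 0"
    "emeasure lebesgue (ball c r) \<noteq> top" "emeasure lebesgue (ball c r) < top"
  using assms unit_ball_vol_pos[of "real DIM('a)"]
  unfolding emeasure_lebesgue_ball[OF assms] by (simp_all add: less_le)

lemma ball_in_sets_lebesgue [measurable]: "ball c r \<in> sets lebesgue"
  by simp

lemma emeasure_lebesgue_ball_scale:
  fixes x y :: "'a::euclidean_space"
  assumes "0 < k" "0 < s"
  shows "emeasure lebesgue (ball x (k * s)) = ennreal (k ^ DIM('a)) * emeasure lebesgue (ball y s)"
  using assms emeasure_lebesgue_ball[of "k * s" x] emeasure_lebesgue_ball[of s y]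
  by (simp add: ennreal_mult[symmetric] power_mult_distrib mult_ac)

lemma measure_lebesgue_ball:
  fixes c :: "'a::euclidean_space"
  assumes "0 < r"
  shows "measure lebesgue (ball c r) = unit_ball_vol DIM('a) * r ^ DIM('a)"
  unfolding measure_def emeasure_lebesgue_ball[OF assms] using assms by simp

lemma nn_integral_ball_eq:
  fixes c :: "'a::euclidean_space"
  assumes "0 < r"
  shows "(\<integral>\<^sup>+y\<in>ball c r. ennreal (norm (f y)) \<partial>lebesgue) = abs_avg c r f * emeasure lebesgue (ball c r)"
  unfolding abs_avg_def ennreal_divide_times ennreal_divide_self[OF emeasure_lebesgue_ball_pos(2,4)[OF assms]]
  by simp

lemma abs_avg_le_iff:
  fixes c :: "'a::euclidean_space"
  assumes "0 < r"
  shows "abs_avg c r f \<le> K \<longleftrightarrow>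
    (\<integral>\<^sup>+y\<in>ball c r. ennreal (norm (f y)) \<partial>lebesgue) \<le> K * emeasure lebesgue (ball c r)"
  unfolding nn_integral_ball_eq[OF assms] using emeasure_lebesgue_ball_pos[OF assms, of c]
  by (simp only: ennreal_mult_le_mult_iff mult.commute[of _ "emeasure lebesgue (ball c r)"] not_False_eq_True)

lemma abs_avg_mono:
  assumes "\<And>x. x \<in> ball c r \<Longrightarrow> norm (f x) \<le> norm (g x)"
  shows "abs_avg c r f \<le> abs_avg c r g"
  unfolding abs_avg_def
  by (intro divide_right_mono_ennreal nn_integral_mono) (auto simp: indicator_def ennreal_leI assms)

lemma abs_avg_cong:
  assumes "\<And>x. x \<in> ball c r \<Longrightarrow> norm (f x) = norm (g x)"
  shows "abs_avg c r f = abs_avg c r g"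
  by (intro antisym abs_avg_mono) (simp_all add: assms)

lemma abs_avg_add_le:
  assumes "g \<in> borel_measurable lebesgue" "h \<in> borel_measurable lebesgue"
    and "\<And>x. x \<in> ball c r \<Longrightarrow> norm (f x) \<le> norm (g x) + norm (h x)"
  shows "abs_avg c r f \<le> abs_avg c r g + abs_avg c r h"
proof -
  have "(\<integral>\<^sup>+y\<in>ball c r. ennreal (norm (f y)) \<partial>lebesgue)
      \<le> (\<integral>\<^sup>+y. ennreal (norm (g y)) * indicator (ball c r) y + ennreal (norm (h y)) * indicator (ball c r) y \<partial>lebesgue)"
    by (intro nn_integral_mono) (auto simp: indicator_def assms ennreal_leI simp flip: ennreal_plus)
  also have "\<dots> = (\<integral>\<^sup>+y\<in>ball c r. ennreal (norm (g y)) \<partial>lebesgue) + (\<integral>\<^sup>+y\<in>ball c r. ennreal (norm (h y)) \<partial>lebesgue)"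
    using assms(1,2) by (intro nn_integral_add) (auto intro!: borel_measurable_times_ennreal borel_measurable_indicator)
  finally show ?thesis
    unfolding abs_avg_def add_divide_distrib_ennreal[symmetric] by (rule divide_right_mono_ennreal)
qed

lemma abs_avg_const:
  fixes c :: "'a::euclidean_space"
  assumes "0 < r"
  shows "abs_avg c r (\<lambda>_. a) = ennreal (norm a)"
  unfolding abs_avg_def using emeasure_lebesgue_ball_pos[OF assms, of c]
  by (simp only: nn_integral_cmult_indicator[OF ball_in_sets_lebesgue] mult_divide_eq_ennreal not_False_eq_True)

lemma abs_avg_le_sup:
  fixes c :: "'a::euclidean_space"
  assumes "0 < r" "\<And>x. x \<in> ball c r \<Longrightarrow> norm (f x) \<le> K"
  shows "abs_avg c r f \<le> ennreal K"
proof -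
  have "0 \<le> norm (f c)" by simp
  also have "norm (f c) \<le> K" using assms by simp
  finally have "0 \<le> K" .
  then have "abs_avg c r f \<le> abs_avg c r (\<lambda>_. K)"
    by (intro abs_avg_mono) (use assms in auto)
  then show ?thesis using \<open>0 \<le> K\<close> assms by (simp add: abs_avg_const)
qed

lemma abs_avg_mono_ball:
  fixes c :: "'a::euclidean_space"
  assumes "ball c' r' \<subseteq> ball c r" "0 < r'" "0 < r"
  shows "abs_avg c' r' f \<le> ennreal ((r / r') ^ DIM('a)) * abs_avg c r f"
proof -
  have "(\<integral>\<^sup>+y\<in>ball c' r'. ennreal (norm (f y)) \<partial>lebesgue) \<le> (\<integral>\<^sup>+y\<in>ball c r. ennreal (norm (f y)) \<partial>lebesgue)"
    by (intro nn_integral_mono mult_left_mono) (use assms in \<open>auto simp: indicator_def\<close>)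
  also have "\<dots> = abs_avg c r f * ennreal (unit_ball_vol DIM('a) * r ^ DIM('a))"
    using assms by (simp only: nn_integral_ball_eq emeasure_lebesgue_ball)
  also have "unit_ball_vol DIM('a) * r ^ DIM('a) = (r / r') ^ DIM('a) * (unit_ball_vol DIM('a) * r' ^ DIM('a))"
    using assms by (simp add: power_divide)
  also have "abs_avg c r f * ennreal \<dots> = ennreal ((r / r') ^ DIM('a)) * abs_avg c r f * emeasure lebesgue (ball c' r')"
    using assms emeasure_lebesgue_ball[of r' c'] by (simp add: ennreal_mult mult_ac)
  finally show ?thesis using assms by (simp only: abs_avg_le_iff)
qed

text \<open>The constant is free, unlike the mean in the norm. This lets sums, truncations and
  maximal functions each bring their own constant, and makes sense before integrability is known;
  the mean is restored later at the cost of a factor 2.\<close>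

definition osc_le :: "'a::euclidean_space \<Rightarrow> real \<Rightarrow> ('a \<Rightarrow> 'b::real_normed_vector) \<Rightarrow> real \<Rightarrow> bool"
  where "osc_le c r f N \<longleftrightarrow> (\<exists>a. abs_avg c r (\<lambda>x. f x - a) \<le> ennreal N)"

lemma osc_le_mono: "osc_le c r f N \<Longrightarrow> N \<le> N' \<Longrightarrow> osc_le c r f N'"
  unfolding osc_le_def by (meson ennreal_leI order_trans)

lemma osc_leE:
  assumes "osc_le c r f N"
  obtains a where "abs_avg c r (\<lambda>x. f x - a) \<le> ennreal N"
  using assms unfolding osc_le_def by auto

lemma osc_le_of_abs_avg: "abs_avg c r f \<le> ennreal N \<Longrightarrow> osc_le c r f N"
  unfolding osc_le_def by (intro exI[of _ 0]) simp

lemma abs_avg_le_const_add: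
  fixes c :: "'a::euclidean_space" and a :: "'b::{second_countable_topology,real_normed_vector}"
  assumes "f \<in> borel_measurable lebesgue" "0 < r"
  shows "abs_avg c r f \<le> ennreal (norm a) + abs_avg c r (\<lambda>x. f x - a)"
proof -
  have "abs_avg c r f \<le> abs_avg c r (\<lambda>_. a) + abs_avg c r (\<lambda>x. f x - a)"
    by (rule abs_avg_add_le) (use assms in \<open>auto intro: norm_triangle_sub\<close>)
  with assms show ?thesis by (simp add: abs_avg_const)
qed

lemma const_le_abs_avg_add:
  fixes c :: "'a::euclidean_space" and a :: "'b::{second_countable_topology,real_normed_vector}"
  assumes "f \<in> borel_measurable lebesgue" "0 < r"
  shows "ennreal (norm a) \<le> abs_avg c r f + abs_avg c r (\<lambda>x. f x - a)"
proof -
  have "abs_avg c r (\<lambda>_. a) \<le> abs_avg c r f + abs_avg c r (\<lambda>x. f x - a)"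
    by (rule abs_avg_add_le) (use assms in \<open>auto intro: norm_triangle_sub simp: norm_minus_commute\<close>)
  with assms show ?thesis by (simp add: abs_avg_const)
qed

lemma osc_le_abs_avg_finite:
  fixes f :: "'a::euclidean_space \<Rightarrow> 'b::{second_countable_topology,real_normed_vector}"
  assumes "f \<in> borel_measurable lebesgue" "0 < r" "osc_le c r f N"
  shows "abs_avg c r f < \<infinity>"
proof -
  obtain a where "abs_avg c r (\<lambda>x. f x - a) \<le> ennreal N" using assms(3) by (rule osc_leE)
  then have "abs_avg c r f \<le> ennreal (norm a) + ennreal N"
    using abs_avg_le_const_add[OF assms(1,2)] by (meson add_left_mono order_trans)
  also have "\<dots> < \<infinity>" by simp
  finally show ?thesis .
qed

lemma osc_le_add:
  fixes f g :: "'a::euclidean_space \<Rightarrow> 'b::{second_countable_topology,real_normed_vector}"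
  assumes "f \<in> borel_measurable lebesgue" "osc_le c r f M" "0 \<le> M"
    and "g \<in> borel_measurable lebesgue" "osc_le c r g N" "0 \<le> N"
  shows "osc_le c r (\<lambda>x. f x + g x) (M + N)"
proof -
  obtain a b where a: "abs_avg c r (\<lambda>x. f x - a) \<le> ennreal M" and b: "abs_avg c r (\<lambda>x. g x - b) \<le> ennreal N"
    using assms(2,5) unfolding osc_le_def by blast
  have "abs_avg c r (\<lambda>x. f x + g x - (a + b)) \<le> abs_avg c r (\<lambda>x. f x - a) + abs_avg c r (\<lambda>x. g x - b)"
    using assms(1,4) by (intro abs_avg_add_le) (auto simp: add_diff_add norm_triangle_ineq)
  also have "\<dots> \<le> ennreal (M + N)" using a b assms(3,6) by (simp add: add_mono)
  finally show ?thesis unfolding osc_le_def by blast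
qed

text \<open>With \<open>a\<close> the constant of the larger ball, \<open>norm a\<close> differs
  from the average of \<open>norm f\<close> over either ball by at most the mean deviation there,
  which is at most \<open>N\<close> on the larger ball and at most the volume ratio times
  \<open>N\<close> on the smaller one. Adding the two gives both directions.\<close>

lemma abs_avg_ball_compare:
  fixes f :: "'a::euclidean_space \<Rightarrow> 'b::{second_countable_topology,real_normed_vector}"
  assumes f: "f \<in> borel_measurable lebesgue" and r: "0 < r'" "0 < r" and sub: "ball c' r' \<subseteq> ball c r"
    and osc: "osc_le c r f N" and N: "0 \<le> N"
  shows "abs_avg c' r' f \<le> abs_avg c r f + ennreal ((1 + (r / r') ^ DIM('a)) * N)"
    and "abs_avg c r f \<le> abs_avg c' r' f + ennreal ((1 + (r / r') ^ DIM('a)) * N)"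
proof -
  obtain a where a: "abs_avg c r (\<lambda>x. f x - a) \<le> ennreal N" using osc by (rule osc_leE)
  have "abs_avg c' r' (\<lambda>x. f x - a) \<le> ennreal ((r / r') ^ DIM('a)) * abs_avg c r (\<lambda>x. f x - a)"
    by (rule abs_avg_mono_ball[OF sub r])
  also have "\<dots> \<le> ennreal ((r / r') ^ DIM('a)) * ennreal N"
    by (intro mult_left_mono a) simp
  finally have a': "abs_avg c' r' (\<lambda>x. f x - a) \<le> ennreal ((r / r') ^ DIM('a) * N)"
    using r N by (simp add: ennreal_mult)
  have e: "ennreal ((1 + (r / r') ^ DIM('a)) * N) = ennreal N + ennreal ((r / r') ^ DIM('a) * N)"
    using r N by (simp add: ring_distribs ennreal_plus[symmetric] del: ennreal_plus)
  have "abs_avg c' r' f \<le> ennreal (norm a) + ennreal ((r / r') ^ DIM('a) * N)"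
    using abs_avg_le_const_add[OF f r(1)] a' by (meson add_left_mono order_trans)
  also have "\<dots> \<le> abs_avg c r f + ennreal N + ennreal ((r / r') ^ DIM('a) * N)"
    using const_le_abs_avg_add[OF f r(2)] a by (intro add_right_mono) (meson add_left_mono order_trans)
  finally show "abs_avg c' r' f \<le> abs_avg c r f + ennreal ((1 + (r / r') ^ DIM('a)) * N)"
    unfolding e by (simp add: add.assoc)
  have "abs_avg c r f \<le> ennreal (norm a) + ennreal N"
    using abs_avg_le_const_add[OF f r(2)] a by (meson add_left_mono order_trans)
  also have "\<dots> \<le> abs_avg c' r' f + ennreal ((r / r') ^ DIM('a) * N) + ennreal N"
    using const_le_abs_avg_add[OF f r(1)] a' by (intro add_right_mono) (meson add_left_mono order_trans)
  finally show "abs_avg c r f \<le> abs_avg c' r' f + ennreal ((1 + (r / r') ^ DIM('a)) * N)"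
    unfolding e by (simp add: ac_simps)
qed

text \<open>Capping the radii at \<open>R\<close> confines the stopping time argument to
  oscillations at scales up to \<open>3 * R\<close>, which is what the small balls of CMO call
  for.\<close>

definition local_maximal_op :: "real \<Rightarrow> ('a::euclidean_space \<Rightarrow> 'b::real_normed_vector) \<Rightarrow> 'a \<Rightarrow> ennreal"
  where "local_maximal_op R f x = (SUP (c, r)\<in>{(c, r). x \<in> ball c r \<and> r \<le> R}. abs_avg c r f)"

lemma less_local_maximal_op_iff:
  "t < local_maximal_op R f x \<longleftrightarrow> (\<exists>c r. x \<in> ball c r \<and> r \<le> R \<and> t < abs_avg c r f)"
  unfolding local_maximal_op_def by (auto simp: less_SUP_iff)

lemma less_maximal_op_iff:
  "t < maximal_op f x \<longleftrightarrow> (\<exists>c r. x \<in> ball c r \<and> t < abs_avg c r f)"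
  unfolding maximal_op_def by (auto simp: less_SUP_iff)

lemma abs_avg_le_maximal_op: "x \<in> ball c r \<Longrightarrow> abs_avg c r f \<le> maximal_op f x"
  unfolding maximal_op_def by (intro SUP_upper2[of "(c, r)"]) auto

lemma maximal_op_le: "(\<And>c r. x \<in> ball c r \<Longrightarrow> abs_avg c r f \<le> K) \<Longrightarrow> maximal_op f x \<le> K"
  unfolding maximal_op_def by (intro SUP_least) auto

text \<open>Superlevel sets are unions of open balls, so the operator is lower semicontinuous
  whatever \<open>f\<close> is.\<close>

lemma local_maximal_op_measurable [measurable]: "local_maximal_op R f \<in> borel_measurable borel"
proof (rule borel_measurableI_greater)
  fix t
  have "{x \<in> space borel. t < local_maximal_op R f x}
      = (\<Union>(c, r)\<in>{(c, r). r \<le> R \<and> t < abs_avg c r f}. ball c r)"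
    by (auto simp: less_local_maximal_op_iff) blast
  moreover have "open \<dots>" by auto
  ultimately show "{x \<in> space borel. t < local_maximal_op R f x} \<in> sets borel" by simp
qed

lemma local_maximal_op_level_set:
  "{y \<in> ball c r. t < local_maximal_op R f y} \<in> sets lebesgue"
proof -
  have "{y \<in> space borel. t < local_maximal_op R f y} \<inter> ball c r \<in> sets borel" by measurable
  also have "{y \<in> space borel. t < local_maximal_op R f y} \<inter> ball c r
    = {y \<in> ball c r. t < local_maximal_op R f y}" by auto
  finally show ?thesis by (rule sets_completionI_sets[of _ lborel, simplified])
qed

lemma maximal_op_measurable [measurable]: "maximal_op f \<in> borel_measurable borel"
proof (rule borel_measurableI_greater)
  fix t
  have "{x \<in> space borel. t < maximal_op f x} = (\<Union>(c, r)\<in>{(c, r). t < abs_avg c r f}. ball c r)"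
    by (auto simp: less_maximal_op_iff) blast
  moreover have "open \<dots>" by auto
  ultimately show "{x \<in> space borel. t < maximal_op f x} \<in> sets borel" by simp
qed

section \<open>The stopping time argument\<close>

lemma two_add_3_power_le: "0 < n \<Longrightarrow> 2 + 3 ^ n \<le> (60::real) ^ n"
proof (induction n rule: nat_induct_non_zero)
  case (Suc n)
  moreover have "0 \<le> (3::real) ^ n" by simp
  ultimately show ?case unfolding power_Suc by linarith
qed simp

lemma power_2_add_10_le: "0 < n \<Longrightarrow> 2 ^ n + 10 ^ n \<le> (60::real) ^ n"
proof (induction n rule: nat_induct_non_zero)
  case (Suc n)
  moreover have "0 \<le> (2::real) ^ n" "0 \<le> (10::real) ^ n" by simp_all
  ultimately show ?case unfolding power_Suc by linarith
qed simp

lemma ennreal_mult_mult_eq: "0 \<le> a \<Longrightarrow> 0 \<le> b \<Longrightarrow> ennreal a * (ennreal b * T) = ennreal (a * b) * T"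
  by (simp add: ennreal_mult mult.assoc)

lemma ennreal_le_add_diff: "x \<le> b + (x - b)" for x b :: ennreal
  using ennreal_minus_le_iff[of x b "x - b"] by simp

text \<open>Countable subadditivity, with the sum written as an integral over
  \<open>count_space\<close> so that Tonelli applies and a Vitali subfamily can be used without
  enumerating it.\<close>

lemma set_nn_integral_le_countable_cover:
  assumes "countable C" "\<And>i. i \<in> C \<Longrightarrow> X i \<in> sets M" "E \<subseteq> (\<Union>i\<in>C. X i)" "w \<in> borel_measurable M"
  shows "(\<integral>\<^sup>+y\<in>E. w y \<partial>M) \<le> (\<integral>\<^sup>+i. (\<integral>\<^sup>+y\<in>X i. w y \<partial>M) \<partial>count_space C)"
proof -
  have "(\<integral>\<^sup>+y\<in>E. w y \<partial>M) \<le> (\<integral>\<^sup>+y. (\<integral>\<^sup>+i. w y * indicator (X i) y \<partial>count_space C) \<partial>M)"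
  proof (intro nn_integral_mono)
    fix y
    show "w y * indicator E y \<le> (\<integral>\<^sup>+i. w y * indicator (X i) y \<partial>count_space C)"
    proof (cases "y \<in> E")
      case True
      then obtain i where i: "i \<in> C" "y \<in> X i" using assms(3) by blast
      have "w y = (\<integral>\<^sup>+j. w y * indicator {i} j \<partial>count_space C)"
        using i by (simp add: nn_integral_cmult_indicator)
      also have "\<dots> \<le> (\<integral>\<^sup>+j. w y * indicator (X j) y \<partial>count_space C)"
        using i by (intro nn_integral_mono mult_left_mono) (auto simp: indicator_def)
      finally show ?thesis using True by simp
    qed simp
  qed
  also have "\<dots> = (\<integral>\<^sup>+i. (\<integral>\<^sup>+y\<in>X i. w y \<partial>M) \<partial>count_space C)"
    using assms by (intro nn_integral_count_space_nn_integral) auto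
  finally show ?thesis .
qed

text \<open>The constant \<open>2 \<cdot> 60\<^sup>n\<close> makes every ball whose average exceeds the threshold much smaller
  than the given one, so the stopping balls and their dilates do not leave the range of radii.\<close>

lemma local_maximal_stopping_ball:
  fixes f :: "'a::euclidean_space \<Rightarrow> 'b::{second_countable_topology,real_normed_vector}"
  assumes f: "f \<in> borel_measurable lebesgue" and N: "0 < N"
    and osc: "\<And>c r. 0 < r \<Longrightarrow> r \<le> 3 * R \<Longrightarrow> osc_le c r f N"
    and r: "0 < r" "r \<le> R" and x: "x \<in> ball c r"
    and less: "abs_avg c r f + ennreal (2 * 60 ^ DIM('a) * N) < local_maximal_op r f x"
  obtains c' r' where "x \<in> ball c' r'" "0 < r'" "r' < r / 20"
    "abs_avg c r f + ennreal (2 * 60 ^ DIM('a) * N) < abs_avg c' r' f"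
    "\<And>c'' r''. x \<in> ball c'' r'' \<Longrightarrow> 2 * r' \<le> r'' \<Longrightarrow> r'' \<le> r \<Longrightarrow>
       abs_avg c'' r'' f \<le> abs_avg c r f + ennreal (2 * 60 ^ DIM('a) * N)"
    "\<And>y c'' r''. y \<in> ball c r \<Longrightarrow> y \<in> ball c'' r'' \<Longrightarrow> r'' \<le> r \<Longrightarrow>
       abs_avg c r f + ennreal (2 * 60 ^ DIM('a) * N) < abs_avg c'' r'' f \<Longrightarrow> r'' < r / 20"
proof -
  let ?b = "abs_avg c r f" and ?K = "2 * 60 ^ DIM('a) * N :: real"
  \<comment> \<open>A ball of radius between \<open>r / 20\<close> and \<open>r\<close> that meets
    \<open>ball c r\<close> lies in \<open>ball c (3 * r)\<close>, with ratio of radii at most 60.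
    Passing to that ball and back to \<open>ball c r\<close> costs
    \<open>(1 + 60^n) * N + (1 + 3^n) * N\<close>; this is the origin of the threshold
    \<open>2 * 60^n * N\<close>.\<close>
  have small: "s < r / 20"
    if y: "y \<in> ball c r" "y \<in> ball d s" and "s \<le> r" and gt: "?b + ennreal ?K < abs_avg d s f" for y d s
  proof (rule ccontr)
    assume "\<not> s < r / 20"
    then have s: "r / 20 \<le> s" "0 < s" using r by auto
    have sub: "ball d s \<subseteq> ball c (3 * r)"
    proof
      fix z assume "z \<in> ball d s"
      then have "dist c z \<le> dist c y + dist d y + dist d z" "dist d z < s"
        using dist_triangle[of c z y] dist_triangle[of y z d] by (auto simp: dist_commute)
      with y \<open>s \<le> r\<close> show "z \<in> ball c (3 * r)" by auto
    qed
    have osc3: "osc_le c (3 * r) f N" using r by (intro osc) auto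
    have "abs_avg d s f \<le> abs_avg c (3 * r) f + ennreal ((1 + (3 * r / s) ^ DIM('a)) * N)"
      using s r N by (intro abs_avg_ball_compare(1)[OF f _ _ sub osc3]) auto
    also have "abs_avg c (3 * r) f \<le> ?b + ennreal ((1 + (3 * r / r) ^ DIM('a)) * N)"
      using r N by (intro abs_avg_ball_compare(2)[OF f _ _ _ osc3]) auto
    finally have "abs_avg d s f \<le> ?b + ennreal ((1 + 3 ^ DIM('a)) * N + (1 + (3 * r / s) ^ DIM('a)) * N)"
      using N r s by (simp add: add.assoc)
    also have "\<dots> \<le> ?b + ennreal ?K"
    proof (intro add_left_mono ennreal_leI)
      have p: "DIM('a) > 0" by simp
      have "(3 * r / s) ^ DIM('a) \<le> 60 ^ DIM('a)"
        using s r by (intro power_mono) (auto simp: field_simps)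
      moreover have "1 + (1 + 3 ^ DIM('a)) \<le> (60::real) ^ DIM('a)"
        using two_add_3_power_le[OF p] by simp
      ultimately have "(1 + 3 ^ DIM('a)) + (1 + (3 * r / s) ^ DIM('a)) \<le> 2 * 60 ^ DIM('a)" by simp
      from mult_right_mono[OF this, of N]
      show "(1 + 3 ^ DIM('a)) * N + (1 + (3 * r / s) ^ DIM('a)) * N \<le> ?K"
        using N by (simp add: ring_distribs)
    qed
    finally show False using gt by simp
  qed
  \<comment> \<open>The supremum of the radii need not be attained. A radius above half of it
    suffices, since every ball through \<open>x\<close> with at least twice that radius, and at most
    \<open>r\<close>, then stays below the threshold.\<close>
  define S where "S = {s. \<exists>d. x \<in> ball d s \<and> s \<le> r \<and> ?b + ennreal ?K < abs_avg d s f}"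
  from less obtain d s where ds: "x \<in> ball d s" "s \<le> r" "?b + ennreal ?K < abs_avg d s f"
    unfolding less_local_maximal_op_iff by blast
  have "s \<in> S" unfolding S_def using ds by blast
  have "0 < s" using ds(1) by (rule radius_pos)
  have bdd: "bdd_above S" unfolding S_def by (intro bdd_aboveI[of _ r]) auto
  have "s \<le> Sup S" by (rule cSup_upper[OF \<open>s \<in> S\<close> bdd])
  then have "Sup S / 2 < Sup S" using \<open>0 < s\<close> by simp
  then obtain s' where s': "s' \<in> S" "Sup S / 2 < s'"
    using less_cSup_iff[OF _ bdd] \<open>s \<in> S\<close> by blast
  from s'(1) obtain d' where d': "x \<in> ball d' s'" "s' \<le> r" "?b + ennreal ?K < abs_avg d' s' f"
    unfolding S_def by blast
  show thesis
  proof (rule that[OF d'(1) _ small[OF x d'] d'(3)])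
    show "0 < s'" using d'(1) by (rule radius_pos)
    show "abs_avg c'' r'' f \<le> ?b + ennreal ?K" if "x \<in> ball c'' r''" "2 * s' \<le> r''" "r'' \<le> r" for c'' r''
    proof (rule ccontr)
      assume "\<not> ?thesis"
      with that have "r'' \<in> S" unfolding S_def by (auto simp: not_le)
      then have "r'' \<le> Sup S" by (rule cSup_upper[OF _ bdd])
      with that s' show False by simp
    qed
  qed (rule small)
qed

text \<open>The maximality of the stopping balls puts the average over their fivefold dilates below the
  threshold, so that the induction hypothesis applies to these dilates, whose total measure is at
  most half of the measure of the original ball.\<close>

lemma local_maximal_distribution:
  fixes f :: "'a::euclidean_space \<Rightarrow> 'b::{second_countable_topology,real_normed_vector}"
  assumes f: "f \<in> borel_measurable lebesgue" and N: "0 < N"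
    and osc: "\<And>c r. 0 < r \<Longrightarrow> r \<le> 3 * R \<Longrightarrow> osc_le c r f N"
    and r: "0 < r" "r \<le> R"
  shows "emeasure lebesgue {y \<in> ball c r. abs_avg c r f + ennreal (real m * (3 * 60 ^ DIM('a) * N)) < local_maximal_op r f y}
    \<le> ennreal ((1 / 2) ^ m) * emeasure lebesgue (ball c r)"
  using r
proof (induction m arbitrary: c r)
  case 0
  have "emeasure lebesgue {y \<in> ball c r. abs_avg c r f + ennreal (real 0 * (3 * 60 ^ DIM('a) * N)) < local_maximal_op r f y}
    \<le> emeasure lebesgue (ball c r)"
    by (intro emeasure_mono) auto
  then show ?case by simp
next
  case (Suc m)
  note r = Suc.prems
  let ?b = "abs_avg c r f" and ?K = "2 * 60 ^ DIM('a) * N :: real"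
  let ?L = "3 * 60 ^ DIM('a) * N :: real" and ?v = "emeasure lebesgue (ball c r)"
  have p: "DIM('a) > 0" by simp
  define E where "E = {y \<in> ball c r. ?b + ennreal (real (Suc m) * ?L) < local_maximal_op r f y}"
  have b: "?b < \<infinity>" using r by (intro osc_le_abs_avg_finite[OF f _ osc]) auto
  have KL: "?K \<le> real (Suc m) * ?L"
  proof -
    have "1 * ?L \<le> real (Suc m) * ?L" using N by (intro mult_right_mono) auto
    then show ?thesis using N by simp
  qed
  \<comment> \<open>The last clause carries the induction: inside the fivefold dilate a point of
    \<open>E\<close> already lies in the level set of order \<open>m\<close> belonging to that
    dilate.\<close>
  define good where "good x c' r' \<longleftrightarrow> x \<in> ball c' r' \<and> 0 < r' \<and> r' < r / 20 \<and> ?b + ennreal ?K < abs_avg c' r' f \<and>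
      E \<inter> ball c' (5 * r') \<subseteq> {y \<in> ball c' (5 * r'). abs_avg c' (5 * r') f + ennreal (real m * ?L) < local_maximal_op (5 * r') f y}" for x c' r'
  have "\<exists>c' r'. good x c' r'"
    if "x \<in> E" for x
  proof -
    have xB: "x \<in> ball c r" and "?b + ennreal (real (Suc m) * ?L) < local_maximal_op r f x"
      using that by (auto simp: E_def)
    moreover have "?b + ennreal ?K \<le> ?b + ennreal (real (Suc m) * ?L)"
      by (intro add_left_mono ennreal_leI KL)
    ultimately have "?b + ennreal ?K < local_maximal_op r f x" by (meson le_less_trans)
    from local_maximal_stopping_ball[OF f N osc r xB this] obtain c' r' where
      c': "x \<in> ball c' r'" "0 < r'" "r' < r / 20" "?b + ennreal ?K < abs_avg c' r' f"
      and max: "\<And>c'' r''. x \<in> ball c'' r'' \<Longrightarrow> 2 * r' \<le> r'' \<Longrightarrow> r'' \<le> r \<Longrightarrow> abs_avg c'' r'' f \<le> ?b + ennreal ?K"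
      and small: "\<And>y c'' r''. y \<in> ball c r \<Longrightarrow> y \<in> ball c'' r'' \<Longrightarrow> r'' \<le> r \<Longrightarrow> ?b + ennreal ?K < abs_avg c'' r'' f \<Longrightarrow> r'' < r / 20"
      by blast
    have D: "abs_avg c' (5 * r') f \<le> ?b + ennreal ?K"
      using c' r by (intro max) auto
    have "abs_avg c' (5 * r') f + ennreal (real m * ?L) < local_maximal_op (5 * r') f y"
      if y: "y \<in> E" "y \<in> ball c' (5 * r')" for y
    proof -
      have "?b + ennreal (real (Suc m) * ?L) < local_maximal_op r f y" and yB: "y \<in> ball c r"
        using y by (auto simp: E_def)
      then obtain d s where ds: "y \<in> ball d s" "s \<le> r" "?b + ennreal (real (Suc m) * ?L) < abs_avg d s f"
        unfolding less_local_maximal_op_iff by blast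
      have s0: "0 < s" using ds(1) by (rule radius_pos)
      have s: "s < r / 20"
        by (rule small[OF yB ds(1,2)]) (meson ds(3) le_less_trans add_left_mono ennreal_leI KL)
      \<comment> \<open>Otherwise enlarging the radius by \<open>10 * r'\<close> captures
        \<open>x\<close>, and maximality of the stopping ball brings the average down to the lower
        threshold. The enlargement at most triples the radius, so it costs
        \<open>(1 + 3^n) * N\<close>; the level spacing \<open>3 * 60^n * N\<close> exceeds
        \<open>2 * 60^n * N\<close> by enough to absorb this.\<close>
      have "s \<le> 5 * r'"
      proof (rule ccontr)
        assume "\<not> s \<le> 5 * r'"
        then have s': "5 * r' < s" by simp
        have "dist d x \<le> dist d y + dist c' y + dist c' x"
          using dist_triangle[of d x y] dist_triangle[of y x c'] by (auto simp: dist_commute)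
        then have "x \<in> ball d (s + 10 * r')" using ds(1) c'(1) y(2) c'(2) by simp
        then have le: "abs_avg d (s + 10 * r') f \<le> ?b + ennreal ?K"
          by (rule max) (use c' s s0 r in auto)
        have "osc_le d (s + 10 * r') f N" using c' s s0 r by (intro osc) auto
        then have "abs_avg d s f \<le> abs_avg d (s + 10 * r') f + ennreal ((1 + ((s + 10 * r') / s) ^ DIM('a)) * N)"
          using s0 c' N by (intro abs_avg_ball_compare(1)[OF f]) auto
        also have "\<dots> \<le> ?b + ennreal ?K + ennreal ((1 + 3 ^ DIM('a)) * N)"
          using s' s0 c' N by (intro add_mono le ennreal_leI mult_right_mono add_left_mono power_mono) (auto simp: field_simps)
        also have "\<dots> = ?b + ennreal (?K + (1 + 3 ^ DIM('a)) * N)"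
          using N by (simp add: add.assoc)
        also have "\<dots> \<le> ?b + ennreal (real (Suc m) * ?L)"
        proof (intro add_left_mono ennreal_leI)
          have "1 + 3 ^ DIM('a) \<le> (60::real) ^ DIM('a)"
            using two_add_3_power_le[OF p] by simp
          from mult_right_mono[OF this, of N] have "?K + (1 + 3 ^ DIM('a)) * N \<le> 1 * ?L" using N by simp
          also have "\<dots> \<le> real (Suc m) * ?L" using N by (intro mult_right_mono) auto
          finally show "?K + (1 + 3 ^ DIM('a)) * N \<le> real (Suc m) * ?L" .
        qed
        finally show False using ds(3) by simp
      qed
      have "abs_avg c' (5 * r') f + ennreal (real m * ?L) \<le> ?b + ennreal ?K + ennreal (real m * ?L)"
        by (intro add_right_mono D)
      also have "\<dots> = ?b + ennreal (?K + real m * ?L)" using N by (simp add: add.assoc)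
      also have "\<dots> \<le> ?b + ennreal (real (Suc m) * ?L)"
        using N by (intro add_left_mono ennreal_leI) (simp add: ring_distribs)
      also have "\<dots> < abs_avg d s f" by fact
      finally show ?thesis unfolding less_local_maximal_op_iff using ds(1) \<open>s \<le> 5 * r'\<close> by blast
    qed
    then have "E \<inter> ball c' (5 * r') \<subseteq> {y \<in> ball c' (5 * r'). abs_avg c' (5 * r') f + ennreal (real m * ?L) < local_maximal_op (5 * r') f y}"
      by blast
    with c' show ?thesis unfolding good_def by blast
  qed
  then obtain p q where "\<And>x. x \<in> E \<Longrightarrow> good x (p x) (q x)" by metis
  then have pq: "\<And>x. x \<in> E \<Longrightarrow> x \<in> ball (p x) (q x)" "\<And>x. x \<in> E \<Longrightarrow> 0 < q x" "\<And>x. x \<in> E \<Longrightarrow> q x < r / 20"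
    and gt: "\<And>x. x \<in> E \<Longrightarrow> ?b + ennreal ?K < abs_avg (p x) (q x) f"
    and EE: "\<And>x. x \<in> E \<Longrightarrow> E \<inter> ball (p x) (5 * q x) \<subseteq> {y \<in> ball (p x) (5 * q x). abs_avg (p x) (5 * q x) f + ennreal (real m * ?L) < local_maximal_op (5 * q x) f y}"
    unfolding good_def by blast+
  have "E \<subseteq> (\<Union>x\<in>E. ball (p x) (q x))" using pq by blast
  then obtain C where C: "countable C" "C \<subseteq> E"
     "pairwise (\<lambda>i j. disjnt (ball (p i) (q i)) (ball (p j) (q j))) C"
     "E \<subseteq> (\<Union>i\<in>C. ball (p i) (5 * q i))"
    by (rule Vitali_covering_lemma_balls[of E p q E r]) (use pq r in \<open>force simp: less_imp_le\<close>)
  have df: "disjoint_family_on (\<lambda>i. ball (p i) (q i)) C"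
    using C(3) by (auto simp: disjoint_family_on_def pairwise_def disjnt_def)
  have Esets: "E \<in> sets lebesgue" unfolding E_def by (rule local_maximal_op_level_set)
  have sub2: "ball (p i) (q i) \<subseteq> ball c (2 * r)" if "i \<in> C" for i
  proof
    fix z assume z: "z \<in> ball (p i) (q i)"
    have i: "i \<in> E" using that C by blast
    have "dist c z \<le> dist c i + dist (p i) i + dist (p i) z"
      using dist_triangle[of c z i] dist_triangle[of i z "p i"] by (auto simp: dist_commute)
    moreover have "dist c i < r" using i by (auto simp: E_def)
    ultimately show "z \<in> ball c (2 * r)" using pq[OF i] z by auto
  qed
  \<comment> \<open>All stopping balls lie in \<open>ball c (2 * r)\<close>, so one constant
    \<open>a\<close> serves them all. The mean of \<open>norm (f - a)\<close> is at most
    \<open>N\<close> on the large ball but at least \<open>(2 * 60^n - 2^n) * N\<close> on each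
    stopping ball; as these are disjoint, their total measure is small.\<close>
  obtain a where a: "abs_avg c (2 * r) (\<lambda>x. f x - a) \<le> ennreal N"
    using osc[of "2 * r" c] r unfolding osc_le_def by auto
  define w where "w = (\<lambda>x. ennreal (norm (f x - a)))"
  have w [measurable]: "w \<in> borel_measurable lebesgue" unfolding w_def using f by measurable
  have low: "ennreal ((2 * 60 ^ DIM('a) - 2 ^ DIM('a)) * N) * emeasure lebesgue (ball (p i) (q i)) \<le> (\<integral>\<^sup>+y\<in>ball (p i) (q i). w y \<partial>lebesgue)"
    if "i \<in> C" for i
  proof -
    have i: "i \<in> E" using that C by blast
    note q0 = pq(2)[OF i]
    have "abs_avg c r (\<lambda>x. f x - a) \<le> ennreal ((2 * r / r) ^ DIM('a)) * abs_avg c (2 * r) (\<lambda>x. f x - a)"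
      using r by (intro abs_avg_mono_ball) auto
    also have "\<dots> \<le> ennreal (2 ^ DIM('a)) * ennreal N" using a r by (intro mult_mono) auto
    finally have 1: "abs_avg c r (\<lambda>x. f x - a) \<le> ennreal (2 ^ DIM('a) * N)" using N by (simp add: ennreal_mult)
    have "?b + ennreal ?K \<le> abs_avg (p i) (q i) f" using gt[OF i] by simp
    also have "\<dots> \<le> ennreal (norm a) + abs_avg (p i) (q i) (\<lambda>x. f x - a)"
      by (rule abs_avg_le_const_add[OF f q0])
    also have "ennreal (norm a) \<le> ?b + ennreal (2 ^ DIM('a) * N)"
      using const_le_abs_avg_add[OF f r(1), of a c] 1 by (meson add_left_mono order_trans)
    finally have "?b + ennreal ?K \<le> ?b + (ennreal (2 ^ DIM('a) * N) + abs_avg (p i) (q i) (\<lambda>x. f x - a))"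
      by (simp add: add.assoc)
    then have "ennreal ?K \<le> ennreal (2 ^ DIM('a) * N) + abs_avg (p i) (q i) (\<lambda>x. f x - a)"
      using b by (subst (asm) ennreal_add_left_cancel_le) auto
    then have "ennreal ?K - ennreal (2 ^ DIM('a) * N) \<le> abs_avg (p i) (q i) (\<lambda>x. f x - a)"
      by (subst ennreal_minus_le_iff) auto
    then have "ennreal ((2 * 60 ^ DIM('a) - 2 ^ DIM('a)) * N) \<le> abs_avg (p i) (q i) (\<lambda>x. f x - a)"
      using N by (simp add: ennreal_minus left_diff_distrib)
    then have "ennreal ((2 * 60 ^ DIM('a) - 2 ^ DIM('a)) * N) * emeasure lebesgue (ball (p i) (q i))
        \<le> abs_avg (p i) (q i) (\<lambda>x. f x - a) * emeasure lebesgue (ball (p i) (q i))"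
      by (rule mult_right_mono) simp
    also have "\<dots> = (\<integral>\<^sup>+y\<in>ball (p i) (q i). w y \<partial>lebesgue)"
      unfolding w_def by (rule nn_integral_ball_eq[OF q0, symmetric])
    finally show ?thesis .
  qed
  have "ennreal ((2 * 60 ^ DIM('a) - 2 ^ DIM('a)) * N) * (\<integral>\<^sup>+i. emeasure lebesgue (ball (p i) (q i)) \<partial>count_space C)
      \<le> (\<integral>\<^sup>+i. (\<integral>\<^sup>+y\<in>ball (p i) (q i). w y \<partial>lebesgue) \<partial>count_space C)"
    by (subst nn_integral_cmult[symmetric]) (auto intro!: nn_integral_mono low simp del: emeasure_completion)
  also have "\<dots> = (\<integral>\<^sup>+i. emeasure (density lebesgue w) (ball (p i) (q i)) \<partial>count_space C)"
    by (intro nn_integral_cong) (simp add: emeasure_density)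
  also have "\<dots> = emeasure (density lebesgue w) (\<Union>i\<in>C. ball (p i) (q i))"
    using C(1) df by (intro emeasure_UN_countable[symmetric]) auto
  also have "\<dots> \<le> emeasure (density lebesgue w) (ball c (2 * r))"
    using sub2 by (intro emeasure_mono) auto
  also have "\<dots> = (\<integral>\<^sup>+y\<in>ball c (2 * r). w y \<partial>lebesgue)" by (simp add: emeasure_density)
  also have "\<dots> \<le> ennreal N * emeasure lebesgue (ball c (2 * r))"
    unfolding w_def using a r by (subst abs_avg_le_iff[symmetric]) auto
  finally have sum1: "ennreal ((2 * 60 ^ DIM('a) - 2 ^ DIM('a)) * N) * (\<integral>\<^sup>+i. emeasure lebesgue (ball (p i) (q i)) \<partial>count_space C)
      \<le> ennreal N * emeasure lebesgue (ball c (2 * r))" .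
  define T where "T = (\<integral>\<^sup>+i. emeasure lebesgue (ball (p i) (q i)) \<partial>count_space C)"
  \<comment> \<open>Dilating by 5 costs \<open>5^n\<close> and passing from radius
    \<open>2 * r\<close> to \<open>r\<close> costs \<open>2^n\<close>, so the gain of one half
    requires \<open>2 * 60^n - 2^n\<close> to be at least \<open>2 * 10^n\<close>.\<close>
  have T: "ennreal (5 ^ DIM('a)) * T \<le> ennreal (1 / 2) * ?v"
  proof -
    have **: "2 * 10 ^ DIM('a) \<le> 2 * 60 ^ DIM('a) - (2 ^ DIM('a) :: real)"
    proof -
      have "(10::real) ^ DIM('a) \<le> 60 ^ DIM('a)" by (intro power_mono) auto
      then show ?thesis using power_2_add_10_le[OF p] by linarith
    qed
    have "(2::real) ^ DIM('a) * 5 ^ DIM('a) = 10 ^ DIM('a)" by (simp flip: power_mult_distrib)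
    then have *: "2 * 2 ^ DIM('a) * N * 5 ^ DIM('a) = 2 * 10 ^ DIM('a) * N" by (simp add: mult_ac)
    have "ennreal (2 * 2 ^ DIM('a) * N) * (ennreal (5 ^ DIM('a)) * T) = ennreal (2 * 2 ^ DIM('a) * N * 5 ^ DIM('a)) * T"
      using N by (intro ennreal_mult_mult_eq) auto
    also have "\<dots> = ennreal (2 * 10 ^ DIM('a) * N) * T" by (simp only: *)
    also have "\<dots> \<le> ennreal ((2 * 60 ^ DIM('a) - 2 ^ DIM('a)) * N) * T"
      using N ** by (intro mult_right_mono ennreal_leI) auto
    also have "\<dots> \<le> ennreal N * emeasure lebesgue (ball c (2 * r))" using sum1 by (simp add: T_def)
    also have "\<dots> = ennreal N * (ennreal (2 ^ DIM('a)) * ?v)"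
      using r by (subst emeasure_lebesgue_ball_scale[of 2 r c c]) auto
    also have "\<dots> = ennreal (2 * 2 ^ DIM('a) * N) * (ennreal (1 / 2) * ?v)"
      using N by (subst (1 2) ennreal_mult_mult_eq) (auto simp: mult_ac)
    finally show ?thesis
      using N by (subst (asm) ennreal_mult_le_mult_iff) auto
  qed
  have "emeasure lebesgue E = (\<integral>\<^sup>+y\<in>E. 1 \<partial>lebesgue)" using Esets by simp
  also have "\<dots> \<le> (\<integral>\<^sup>+i. (\<integral>\<^sup>+y\<in>E \<inter> ball (p i) (5 * q i). 1 \<partial>lebesgue) \<partial>count_space C)"
    using C(1,4) Esets by (intro set_nn_integral_le_countable_cover) auto
  also have "\<dots> = (\<integral>\<^sup>+i. emeasure lebesgue (E \<inter> ball (p i) (5 * q i)) \<partial>count_space C)"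
    using Esets by (intro nn_integral_cong) simp
  also have "\<dots> \<le> (\<integral>\<^sup>+i. ennreal ((1 / 2) ^ m * 5 ^ DIM('a)) * emeasure lebesgue (ball (p i) (q i)) \<partial>count_space C)"
  proof (intro nn_integral_mono)
    fix i assume "i \<in> space (count_space C)"
    then have i: "i \<in> E" using C by auto
    have "emeasure lebesgue (E \<inter> ball (p i) (5 * q i)) \<le>
       emeasure lebesgue {y \<in> ball (p i) (5 * q i). abs_avg (p i) (5 * q i) f + ennreal (real m * ?L) < local_maximal_op (5 * q i) f y}"
      by (rule emeasure_mono[OF EE[OF i] local_maximal_op_level_set])
    also have "\<dots> \<le> ennreal ((1 / 2) ^ m) * emeasure lebesgue (ball (p i) (5 * q i))"
      using pq[OF i] r by (intro Suc.IH) auto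
    also have "\<dots> = ennreal ((1 / 2) ^ m * 5 ^ DIM('a)) * emeasure lebesgue (ball (p i) (q i))"
      using pq[OF i] by (subst emeasure_lebesgue_ball_scale[of 5 "q i" _ "p i"]) (auto simp: ennreal_mult mult.assoc)
    finally show "emeasure lebesgue (E \<inter> ball (p i) (5 * q i)) \<le> ennreal ((1 / 2) ^ m * 5 ^ DIM('a)) * emeasure lebesgue (ball (p i) (q i))" .
  qed
  also have "\<dots> = ennreal ((1 / 2) ^ m) * (ennreal (5 ^ DIM('a)) * T)"
    unfolding T_def by (subst nn_integral_cmult) (auto simp: ennreal_mult mult.assoc)
  also have "\<dots> \<le> ennreal ((1 / 2) ^ m) * (ennreal (1 / 2) * ?v)"
    by (intro mult_left_mono T) simp
  also have "\<dots> = ennreal ((1 / 2) ^ Suc m) * ?v"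
    by (subst ennreal_mult_mult_eq) (auto simp: mult.commute)
  finally show ?case unfolding E_def .
qed

text \<open>A discrete layer cake estimate: among the levels \<open>0, L, 2 * L, ...\<close> at
  least \<open>t / L\<close> lie strictly below \<open>t\<close>, all of them if \<open>t\<close> is
  infinite.\<close>

lemma ennreal_le_suminf_levels:
  fixes t :: ennreal and L :: real
  assumes L: "0 < L"
  shows "t \<le> (\<Sum>m. ennreal L * (if ennreal (real m * L) < t then 1 else 0))"
    (is "t \<le> suminf ?g")
proof -
  have *: "ennreal (real k * L) \<le> suminf ?g" if "\<And>m. m < k \<Longrightarrow> ennreal (real m * L) < t" for k
  proof -
    have "ennreal (real k * L) = (\<Sum>m<k. ?g m)"
      using that L by (simp add: ennreal_mult ennreal_of_nat_eq_real_of_nat)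
    also have "\<dots> \<le> suminf ?g" by (intro sum_le_suminf) auto
    finally show ?thesis .
  qed
  show ?thesis
  proof (cases t rule: ennreal_cases)
    case (real x)
    have "ennreal (real (nat \<lceil>x / L\<rceil>) * L) \<le> suminf ?g"
    proof (rule *)
      fix m assume "m < nat \<lceil>x / L\<rceil>"
      then have "real m < x / L" by linarith
      then have "real m * L < x" using L by (simp add: field_simps)
      then show "ennreal (real m * L) < t" using real L by (simp add: ennreal_less_iff)
    qed
    moreover have "x / L \<le> real (nat \<lceil>x / L\<rceil>)" by linarith
    then have "x \<le> real (nat \<lceil>x / L\<rceil>) * L" using L by (simp add: field_simps)
    then have "t \<le> ennreal (real (nat \<lceil>x / L\<rceil>) * L)" using real by (simp add: ennreal_leI)
    ultimately show ?thesis by (rule order_trans[rotated])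
  next
    case top
    show ?thesis
    proof (cases "suminf ?g" rule: ennreal_cases)
      case (real s)
      obtain k where "s / L < real k" using reals_Archimedean2 by blast
      then have "s < real k * L" using L by (simp add: field_simps)
      moreover have "ennreal (real k * L) \<le> suminf ?g" using top by (intro *) simp
      ultimately have False using real by (simp add: ennreal_le_iff2) 
      then show ?thesis ..
    qed simp
  qed
qed

text \<open>Level sets spaced by \<open>3 * 60^n * N\<close> have measures decaying like
  \<open>(1/2)^m\<close>, so the layer sum is a geometric series and contributes the factor
  2.\<close>

lemma local_maximal_integral:
  fixes f :: "'a::euclidean_space \<Rightarrow> 'b::{second_countable_topology,real_normed_vector}"
  assumes f: "f \<in> borel_measurable lebesgue" and N: "0 < N"
    and osc: "\<And>c r. 0 < r \<Longrightarrow> r \<le> 3 * R \<Longrightarrow> osc_le c r f N"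
    and r: "0 < r" "r \<le> R"
  shows "(\<integral>\<^sup>+y\<in>ball c r. (local_maximal_op r f y - abs_avg c r f) \<partial>lebesgue)
    \<le> ennreal (6 * 60 ^ DIM('a) * N) * emeasure lebesgue (ball c r)"
proof -
  let ?b = "abs_avg c r f" and ?L = "3 * 60 ^ DIM('a) * N :: real"
  define E where "E m = {y \<in> ball c r. ?b + ennreal (real m * ?L) < local_maximal_op r f y}" for m
  have L: "0 < ?L" using N by simp
  have b: "?b < \<infinity>" using r by (intro osc_le_abs_avg_finite[OF f _ osc]) auto
  have E: "E m \<in> sets lebesgue" for m unfolding E_def by (rule local_maximal_op_level_set)
  have pt: "(local_maximal_op r f y - ?b) * indicator (ball c r) y \<le> (\<Sum>m. ennreal ?L * indicator (E m) y)" for y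
  proof (cases "y \<in> ball c r")
    case True
    have "ennreal (real m * ?L) < local_maximal_op r f y - ?b \<longleftrightarrow> y \<in> E m" for m
      using True b by (auto simp: E_def not_le[symmetric] ennreal_minus_le_iff)
    then show ?thesis
      using ennreal_le_suminf_levels[OF L, of "local_maximal_op r f y - ?b"] True by (simp add: indicator_def of_bool_def)
  qed simp
  have "(\<integral>\<^sup>+y\<in>ball c r. (local_maximal_op r f y - ?b) \<partial>lebesgue) \<le> (\<integral>\<^sup>+y. (\<Sum>m. ennreal ?L * indicator (E m) y) \<partial>lebesgue)"
    by (intro nn_integral_mono pt)
  also have "\<dots> = (\<Sum>m. \<integral>\<^sup>+y. ennreal ?L * indicator (E m) y \<partial>lebesgue)"
    using E by (intro nn_integral_suminf) auto
  also have "\<dots> = (\<Sum>m. ennreal ?L * emeasure lebesgue (E m))"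
    using E by (simp add: nn_integral_cmult_indicator del: emeasure_completion)
  also have "\<dots> \<le> (\<Sum>m. ennreal ?L * (ennreal ((1 / 2) ^ m) * emeasure lebesgue (ball c r)))"
    unfolding E_def by (intro suminf_le mult_left_mono local_maximal_distribution[OF f N osc r]) auto
  also have "\<dots> = ennreal ?L * emeasure lebesgue (ball c r) * (\<Sum>m. ennreal ((1 / 2) ^ m))"
    unfolding ennreal_suminf_cmult[symmetric] by (intro suminf_cong) (simp add: mult_ac del: emeasure_completion)
  also have "(\<Sum>m. ennreal ((1 / 2) ^ m)) = ennreal 2"
    using suminf_geometric[of "1 / 2 :: real"] by (subst suminf_ennreal2) (auto intro: summable_geometric)
  also have "ennreal ?L * emeasure lebesgue (ball c r) * ennreal 2 = ennreal 2 * (ennreal ?L * emeasure lebesgue (ball c r))"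
    by (rule mult.commute)
  also have "\<dots> = ennreal (2 * ?L) * emeasure lebesgue (ball c r)"
    using L by (intro ennreal_mult_mult_eq) auto
  also have "2 * ?L = 6 * 60 ^ DIM('a) * N" by simp
  finally show ?thesis .
qed

section \<open>The supremum of averages over larger balls and the integral of
  \<open>Mf - A\<^sub>B\<close>\<close>

definition large_avg :: "'a::euclidean_space \<Rightarrow> real \<Rightarrow> ('a \<Rightarrow> 'b::real_normed_vector) \<Rightarrow> ennreal"
  where "large_avg c r f = (SUP (d, s)\<in>{(d, s). ball c r \<subseteq> ball d s}. abs_avg d s f)"

lemma abs_avg_le_large_avg: "ball c r \<subseteq> ball d s \<Longrightarrow> abs_avg d s f \<le> large_avg c r f"
  unfolding large_avg_def by (intro SUP_upper2[of "(d, s)"]) auto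

lemma large_avg_le: "(\<And>d s. ball c r \<subseteq> ball d s \<Longrightarrow> abs_avg d s f \<le> K) \<Longrightarrow> large_avg c r f \<le> K"
  unfolding large_avg_def by (intro SUP_least) auto

lemma large_avg_le_maximal_op: "y \<in> ball c r \<Longrightarrow> large_avg c r f \<le> maximal_op f y"
  by (intro large_avg_le abs_avg_le_maximal_op) blast

text \<open>Balls of radius at most \<open>r\<close> are left to the local operator; larger balls
  meeting \<open>ball c r\<close> have to be compared with \<open>large_avg\<close>. That comparison
  is kept as the hypothesis \<open>large\<close>, because it is justified differently for a global
  BMO bound and at small scales.\<close>

lemma maximal_minus_large_avg_integral:
  fixes f :: "'a::euclidean_space \<Rightarrow> 'b::{second_countable_topology,real_normed_vector}"
  assumes f: "f \<in> borel_measurable lebesgue" and N: "0 < N"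
    and osc: "\<And>c r. 0 < r \<Longrightarrow> r \<le> 3 * R \<Longrightarrow> osc_le c r f N"
    and r: "0 < r" "r \<le> R" and e: "0 \<le> e" and fin: "large_avg c r f < \<infinity>"
    and large: "\<And>y d s. y \<in> ball c r \<Longrightarrow> y \<in> ball d s \<Longrightarrow> r < s \<Longrightarrow> abs_avg d s f \<le> large_avg c r f + ennreal e"
  shows "(\<integral>\<^sup>+y\<in>ball c r. (maximal_op f y - large_avg c r f) \<partial>lebesgue)
    \<le> ennreal (6 * 60 ^ DIM('a) * N + e) * emeasure lebesgue (ball c r)"
proof -
  let ?A = "large_avg c r f" and ?b = "abs_avg c r f"
  have pt: "maximal_op f y - ?A \<le> (local_maximal_op r f y - ?b) + ennreal e" if y: "y \<in> ball c r" for y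
  proof -
    have "maximal_op f y \<le> ?A + ((local_maximal_op r f y - ?b) + ennreal e)"
    proof (rule maximal_op_le)
      fix d s assume ds: "y \<in> ball d s"
      show "abs_avg d s f \<le> ?A + ((local_maximal_op r f y - ?b) + ennreal e)"
      proof (cases "s \<le> r")
        case True
        then have "abs_avg d s f \<le> local_maximal_op r f y"
          unfolding local_maximal_op_def using ds by (intro SUP_upper2[of "(d, s)"]) auto
        also have "\<dots> \<le> ?b + (local_maximal_op r f y - ?b)"
          by (rule ennreal_le_add_diff)
        also have "\<dots> \<le> ?A + ((local_maximal_op r f y - ?b) + ennreal e)"
          by (intro add_mono abs_avg_le_large_avg) auto
        finally show ?thesis .
      next
        case False
        then have "abs_avg d s f \<le> ?A + ennreal e" by (intro large[OF y ds]) simp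
        also have "\<dots> \<le> ?A + ((local_maximal_op r f y - ?b) + ennreal e)"
          by (intro add_mono) auto
        finally show ?thesis .
      qed
    qed
    then show ?thesis using fin by (auto simp: ennreal_minus_le_iff)
  qed
  have m: "local_maximal_op r f \<in> borel_measurable lebesgue"
    using local_maximal_op_measurable[of r f] by (intro measurable_completion) simp
  have "(\<integral>\<^sup>+y\<in>ball c r. (maximal_op f y - ?A) \<partial>lebesgue) \<le> (\<integral>\<^sup>+y. (local_maximal_op r f y - ?b) * indicator (ball c r) y + ennreal e * indicator (ball c r) y \<partial>lebesgue)"
    using pt by (intro nn_integral_mono) (auto simp: indicator_def)
  also have "\<dots> = (\<integral>\<^sup>+y\<in>ball c r. (local_maximal_op r f y - ?b) \<partial>lebesgue) + ennreal e * emeasure lebesgue (ball c r)"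
    using m by (subst nn_integral_add) (auto simp: nn_integral_cmult_indicator simp del: emeasure_completion)
  also have "\<dots> \<le> ennreal (6 * 60 ^ DIM('a) * N) * emeasure lebesgue (ball c r) + ennreal e * emeasure lebesgue (ball c r)"
    by (intro add_right_mono local_maximal_integral[OF f N osc r])
  also have "\<dots> = ennreal (6 * 60 ^ DIM('a) * N + e) * emeasure lebesgue (ball c r)"
    using N e by (simp add: ring_distribs del: emeasure_completion)
  finally show ?thesis .
qed

text \<open>A ball of radius \<open>s > r\<close> that meets \<open>ball c r\<close> contains it
  after its radius is enlarged by \<open>2 * r\<close>. The radius at most triples, so with a global
  oscillation bound the loss is at most \<open>60^n * N\<close>.\<close>

lemma maximal_minus_large_avg_integral_bmo:
  fixes f :: "'a::euclidean_space \<Rightarrow> 'b::{second_countable_topology,real_normed_vector}"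
  assumes f: "f \<in> borel_measurable lebesgue" and N: "0 < N"
    and osc: "\<And>c r. 0 < r \<Longrightarrow> osc_le c r f N" and r: "0 < r" and fin: "large_avg c r f < \<infinity>"
  shows "(\<integral>\<^sup>+y\<in>ball c r. (maximal_op f y - large_avg c r f) \<partial>lebesgue)
    \<le> ennreal (7 * 60 ^ DIM('a) * N) * emeasure lebesgue (ball c r)"
proof -
  have le: "abs_avg d s f \<le> large_avg c r f + ennreal (60 ^ DIM('a) * N)"
    if y: "y \<in> ball c r" "y \<in> ball d s" and s: "r < s" for y d s
  proof -
    have sub: "ball c r \<subseteq> ball d (s + 2 * r)"
    proof
      fix z assume "z \<in> ball c r"
      moreover have "dist d z \<le> dist d y + dist c y + dist c z"
        using dist_triangle[of d z y] dist_triangle[of y z c] by (auto simp: dist_commute)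
      ultimately show "z \<in> ball d (s + 2 * r)" using y by simp
    qed
    have "abs_avg d s f \<le> abs_avg d (s + 2 * r) f + ennreal ((1 + ((s + 2 * r) / s) ^ DIM('a)) * N)"
      using r s N by (intro abs_avg_ball_compare(1)[OF f _ _ _ osc]) auto
    also have "\<dots> \<le> large_avg c r f + ennreal (60 ^ DIM('a) * N)"
    proof (intro add_mono abs_avg_le_large_avg ennreal_leI mult_right_mono)
      have "((s + 2 * r) / s) ^ DIM('a) \<le> 3 ^ DIM('a)"
        using r s by (intro power_mono) (auto simp: field_simps)
      then show "1 + ((s + 2 * r) / s) ^ DIM('a) \<le> 60 ^ DIM('a)"
        using two_add_3_power_le[of "DIM('a)"] by simp
    qed (use r s N sub in auto)
    finally show ?thesis .
  qed
  have "(\<integral>\<^sup>+y\<in>ball c r. (maximal_op f y - large_avg c r f) \<partial>lebesgue)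
    \<le> ennreal (6 * 60 ^ DIM('a) * N + 60 ^ DIM('a) * N) * emeasure lebesgue (ball c r)"
    using N r fin by (intro maximal_minus_large_avg_integral[OF f N osc _ order_refl] le) auto
  also have "6 * 60 ^ DIM('a) * N + 60 ^ DIM('a) * N = 7 * 60 ^ DIM('a) * N" by simp
  finally show ?thesis .
qed

section \<open>Boundedness on BMO\<close>

text \<open>A real-parameter substitute for the norm, equivalent to it up to a factor 3. The
  oscillation bound is demanded for all radii, as beyond the critical radius it follows from the
  bound on averages.\<close>

definition bmo_le :: "('a::euclidean_space \<Rightarrow> real) \<Rightarrow> ('a \<Rightarrow> 'b::real_normed_vector) \<Rightarrow> real \<Rightarrow> bool"
  where "bmo_le V f N \<longleftrightarrow> (\<forall>c r. 0 < r \<longrightarrow>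
    osc_le c r f N \<and> (critical_radius V c \<le> ennreal r \<longrightarrow> abs_avg c r f \<le> ennreal N))"

lemma bmo_leD:
  assumes "bmo_le V f N" "0 < r"
  shows "osc_le c r f N" "critical_radius V c \<le> ennreal r \<Longrightarrow> abs_avg c r f \<le> ennreal N"
  using assms unfolding bmo_le_def by auto

lemma bmo_le_of_norm:
  assumes "BMO_L_norm V f \<le> ennreal N"
  shows "bmo_le V f N"
  unfolding bmo_le_def
proof (intro allI impI)
  fix c r assume r: "0 < (r::real)"
  have 1: "abs_avg c r (\<lambda>y. f y - ball_avg c r f) \<le> ennreal N" if "ennreal r < critical_radius V c"
  proof -
    have "abs_avg c r (\<lambda>y. f y - ball_avg c r f) \<le> (SUP (c, r)\<in>{(c, r). 0 < r \<and> ennreal r < critical_radius V c}.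
        abs_avg c r (\<lambda>y. f y - ball_avg c r f))"
      using that r by (intro SUP_upper2[of "(c, r)"]) auto
    also have "\<dots> \<le> BMO_L_norm V f" unfolding BMO_L_norm_def by simp
    finally show ?thesis using assms by (rule order_trans)
  qed
  have 2: "abs_avg c r f \<le> ennreal N" if "critical_radius V c \<le> ennreal r"
  proof -
    have "abs_avg c r f \<le> (SUP (c, r)\<in>{(c, r). 0 < r \<and> critical_radius V c \<le> ennreal r}. abs_avg c r f)"
      using that r by (intro SUP_upper2[of "(c, r)"]) auto
    also have "\<dots> \<le> BMO_L_norm V f" unfolding BMO_L_norm_def by simp
    finally show ?thesis using assms by (rule order_trans)
  qed
  show "osc_le c r f N \<and> (critical_radius V c \<le> ennreal r \<longrightarrow> abs_avg c r f \<le> ennreal N)"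
    using 1 2 osc_le_of_abs_avg by (metis linorder_not_less osc_le_def)
qed

lemma norm_ball_avg_minus_le:
  fixes f :: "'a::euclidean_space \<Rightarrow> 'b::{banach, second_countable_topology}"
  assumes f: "f \<in> borel_measurable lebesgue" and r: "0 < r" and a: "abs_avg c r (\<lambda>x. f x - a) \<le> ennreal N"
    and N: "0 \<le> N"
  shows "norm (ball_avg c r f - a) \<le> N"
proof -
  let ?B = "ball c r"
  define v where "v = measure lebesgue ?B"
  have v: "0 < v" unfolding v_def using measure_lebesgue_ball[OF r, of c] unit_ball_vol_pos[of "real DIM('a)"] r by simp
  have ev: "emeasure lebesgue ?B = ennreal v"
    unfolding v_def using emeasure_lebesgue_ball_pos[OF r, of c] by (intro emeasure_eq_ennreal_measure) auto
  have le: "(\<integral>\<^sup>+y\<in>?B. ennreal (norm (f y - a)) \<partial>lebesgue) \<le> ennreal (N * v)"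
    using a r N v by (simp add: abs_avg_le_iff ev ennreal_mult del: emeasure_completion)
  have i1: "set_integrable lebesgue ?B (\<lambda>y. f y - a)"
    unfolding set_integrable_def
  proof (rule integrableI_bounded)
    show "(\<lambda>x. indicat_real ?B x *\<^sub>R (f x - a)) \<in> borel_measurable lebesgue"
      using f by (intro borel_measurable_scaleR borel_measurable_indicator) auto
    have "(\<integral>\<^sup>+x. ennreal (norm (indicat_real ?B x *\<^sub>R (f x - a))) \<partial>lebesgue) = (\<integral>\<^sup>+y\<in>?B. ennreal (norm (f y - a)) \<partial>lebesgue)"
      by (intro nn_integral_cong) (auto simp: indicator_def)
    also have "\<dots> < \<infinity>" using le by (simp add: le_less_trans)
    finally show "(\<integral>\<^sup>+x. ennreal (norm (indicat_real ?B x *\<^sub>R (f x - a))) \<partial>lebesgue) < \<infinity>" .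
  qed
  have i2: "set_integrable lebesgue ?B (\<lambda>y. a)"
    unfolding set_integrable_def using ev by (intro integrable_scaleR_left) (auto intro!: integrable_real_indicator simp del: emeasure_completion)
  have i3: "set_integrable lebesgue ?B f" using set_integral_add(1)[OF i1 i2] by simp
  have "integrable lebesgue (indicat_real ?B)"
    using ev by (intro integrable_real_indicator) (auto simp del: emeasure_completion)
  then have i4: "(LINT y:?B|lebesgue. a) = v *\<^sub>R a"
    unfolding set_lebesgue_integral_def by (subst integral_scaleR_left) (auto simp: v_def)
  have "(LINT y:?B|lebesgue. f y - a) = (LINT y:?B|lebesgue. f y) - v *\<^sub>R a"
    using set_integral_diff(2)[OF i3 i2] i4 by simp
  then have "ball_avg c r f - a = (LINT y:?B|lebesgue. f y - a) /\<^sub>R v"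
    unfolding ball_avg_def v_def[symmetric] using v by (simp add: scaleR_diff_right)
  moreover have "norm (LINT y:?B|lebesgue. f y - a) \<le> N * v"
  proof -
    have "ennreal (norm (LINT y:?B|lebesgue. f y - a)) \<le> (\<integral>\<^sup>+x. ennreal (norm (indicat_real ?B x *\<^sub>R (f x - a))) \<partial>lebesgue)"
      unfolding set_lebesgue_integral_def by (rule integral_norm_bound_ennreal[OF i1[unfolded set_integrable_def]])
    also have "\<dots> = (\<integral>\<^sup>+y\<in>?B. ennreal (norm (f y - a)) \<partial>lebesgue)"
      by (intro nn_integral_cong) (auto simp: indicator_def)
    also have "\<dots> \<le> ennreal (N * v)" by (rule le)
    finally show ?thesis using N v by (simp add: ennreal_le_iff)
  qed
  ultimately show ?thesis using v by (simp add: field_simps)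
qed

lemma abs_avg_minus_ball_avg_le:
  fixes f :: "'a::euclidean_space \<Rightarrow> 'b::{banach, second_countable_topology}"
  assumes f: "f \<in> borel_measurable lebesgue" and r: "0 < r" and a: "abs_avg c r (\<lambda>x. f x - a) \<le> ennreal N"
    and N: "0 \<le> N"
  shows "abs_avg c r (\<lambda>x. f x - ball_avg c r f) \<le> ennreal (2 * N)"
proof -
  have n: "norm (a - ball_avg c r f) \<le> N"
    using norm_ball_avg_minus_le[OF assms] by (simp add: norm_minus_commute)
  have "abs_avg c r (\<lambda>x. f x - ball_avg c r f) \<le> abs_avg c r (\<lambda>x. f x - a) + abs_avg c r (\<lambda>x. a - ball_avg c r f)"
    using f by (intro abs_avg_add_le) (auto intro: order_trans[OF _ norm_triangle_ineq])
  also have "\<dots> \<le> ennreal N + ennreal N"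
    using a n r by (intro add_mono) (auto simp: abs_avg_const ennreal_leI)
  also have "\<dots> = ennreal (2 * N)" using N by (simp flip: ennreal_plus)
  finally show ?thesis .
qed

text \<open>The 3 is 2 + 1: replacing the free constant by the mean at most doubles the deviation,
  while the averages beyond the critical radius keep the bound \<open>N\<close>.\<close>

lemma norm_le_of_bmo_le:
  fixes f :: "'a::euclidean_space \<Rightarrow> 'b::{banach, second_countable_topology}"
  assumes f: "f \<in> borel_measurable lebesgue" and "bmo_le V f N" and N: "0 \<le> N"
  shows "BMO_L_norm V f \<le> ennreal (3 * N)"
proof -
  have "(SUP (c, r)\<in>{(c, r). 0 < r \<and> ennreal r < critical_radius V c}.
        abs_avg c r (\<lambda>y. f y - ball_avg c r f)) \<le> ennreal (2 * N)"
    using abs_avg_minus_ball_avg_le[OF f _ _ N] bmo_leD(1)[OF assms(2)] by (intro SUP_least) (fastforce simp: osc_le_def)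
  moreover have "(SUP (c, r)\<in>{(c, r). 0 < r \<and> critical_radius V c \<le> ennreal r}. abs_avg c r f) \<le> ennreal N"
    using bmo_leD[OF assms(2)] by (intro SUP_least) auto
  ultimately have "BMO_L_norm V f \<le> ennreal (2 * N) + ennreal N"
    unfolding BMO_L_norm_def by (rule add_mono)
  also have "\<dots> = ennreal (3 * N)" using N by (simp flip: ennreal_plus)
  finally show ?thesis .
qed

lemma bmo_le_add:
  fixes f g :: "'a::euclidean_space \<Rightarrow> 'b::{second_countable_topology,real_normed_vector}"
  assumes f: "f \<in> borel_measurable lebesgue" "bmo_le V f M" "0 \<le> M"
    and g: "g \<in> borel_measurable lebesgue" "bmo_le V g N" "0 \<le> N"
  shows "bmo_le V (\<lambda>x. f x + g x) (M + N)"
  unfolding bmo_le_def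
proof (intro allI impI conjI)
  fix c r assume r: "0 < (r::real)"
  show "osc_le c r (\<lambda>x. f x + g x) (M + N)"
    using f g bmo_leD(1)[OF f(2) r] bmo_leD(1)[OF g(2) r] by (intro osc_le_add)
  assume "critical_radius V c \<le> ennreal r"
  then have "abs_avg c r f \<le> ennreal M" "abs_avg c r g \<le> ennreal N"
    using bmo_leD(2)[OF f(2) r] bmo_leD(2)[OF g(2) r] by auto
  moreover have "abs_avg c r (\<lambda>x. f x + g x) \<le> abs_avg c r f + abs_avg c r g"
    using f(1) g(1) by (intro abs_avg_add_le) (auto simp: norm_triangle_ineq)
  ultimately show "abs_avg c r (\<lambda>x. f x + g x) \<le> ennreal (M + N)"
    using f(3) g(3) by (simp add: add_mono order_trans)
qed

text \<open>The embedding \<open>of_real\<close> preserves norms; this carries estimates for the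
  real-valued maximal function over to \<open>maximal_fun\<close>, whose values lie in the scalar
  type of \<open>f\<close>.\<close>

lemma bmo_le_of_real:
  fixes F :: "'a::euclidean_space \<Rightarrow> real"
  assumes "bmo_le V F N"
  shows "bmo_le V (\<lambda>x. of_real (F x) :: 'b::real_normed_algebra_1) N"
  unfolding bmo_le_def
proof (intro allI impI conjI)
  fix c r assume r: "0 < (r::real)"
  obtain a where a: "abs_avg c r (\<lambda>x. F x - a) \<le> ennreal N"
    using bmo_leD(1)[OF assms r] unfolding osc_le_def by blast
  have "abs_avg c r (\<lambda>x. of_real (F x) - of_real a :: 'b) = abs_avg c r (\<lambda>x. F x - a)"
    by (intro abs_avg_cong) (simp flip: of_real_diff)
  with a show "osc_le c r (\<lambda>x. of_real (F x) :: 'b) N" unfolding osc_le_def by metis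
  assume "critical_radius V c \<le> ennreal r"
  moreover have "abs_avg c r (\<lambda>x. of_real (F x) :: 'b) = abs_avg c r F" by (intro abs_avg_cong) simp
  ultimately show "abs_avg c r (\<lambda>x. of_real (F x) :: 'b) \<le> ennreal N"
    using bmo_leD(2)[OF assms r] by simp
qed

section \<open>Averages over balls containing a given ball\<close>

lemma ball_subset_double: "ball c r \<subseteq> ball d s \<Longrightarrow> 0 < r \<Longrightarrow> ball d s \<subseteq> ball (c::'a::euclidean_space) (2 * s)"
proof
  fix z assume *: "ball c r \<subseteq> ball d s" "0 < r" "z \<in> ball d s"
  have "c \<in> ball c r" using * by simp
  then have "c \<in> ball d s" using * by blast
  with * dist_triangle[of c z d] show "z \<in> ball c (2 * s)" by (auto simp: dist_commute)
qed

lemma ball_subset_radius_le: "ball c r \<subseteq> ball (d::'a::euclidean_space) s \<Longrightarrow> 0 < r \<Longrightarrow> r \<le> s"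
  by (simp add: ball_subset_ball_iff) (metis dist_not_less_zero dual_order.trans le_add_same_cancel2 not_le)

lemma abs_avg_containing_ball_le:
  fixes f :: "'a::euclidean_space \<Rightarrow> 'b::real_normed_vector"
  assumes "ball c r \<subseteq> ball d s" "0 < r"
  shows "abs_avg d s f \<le> ennreal (2 ^ DIM('a)) * abs_avg c (2 * s) f"
  using abs_avg_mono_ball[OF ball_subset_double[OF assms], of f] ball_subset_radius_le[OF assms] assms(2) by simp

text \<open>A ball of radius \<open>s\<close> containing \<open>ball c r\<close> lies in
  \<open>ball c (2 * s)\<close>. Recentring at \<open>c\<close> brings in the critical radius at
  \<open>c\<close> alone, so critical radii at different points never have to be compared.\<close>

lemma large_avg_le_of_critical:
  fixes f :: "'a::euclidean_space \<Rightarrow> 'b::{second_countable_topology,real_normed_vector}"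
  assumes f: "bmo_le V f N" and N: "0 \<le> N" and r: "0 < r" and c: "critical_radius V c \<le> ennreal r"
  shows "large_avg c r f \<le> ennreal (2 ^ DIM('a) * N)"
proof (rule large_avg_le)
  fix d s assume ds: "ball c r \<subseteq> ball d s"
  have rs: "r \<le> s" by (rule ball_subset_radius_le[OF ds r])
  have "abs_avg d s f \<le> ennreal (2 ^ DIM('a)) * abs_avg c (2 * s) f"
    by (rule abs_avg_containing_ball_le[OF ds r])
  also have "\<dots> \<le> ennreal (2 ^ DIM('a)) * ennreal N"
    using rs r c by (intro mult_mono bmo_leD(2)[OF f] order_trans[OF c]) (auto simp: ennreal_leI)
  finally show "abs_avg d s f \<le> ennreal (2 ^ DIM('a) * N)" using N by (simp add: ennreal_mult)
qed

text \<open>Finiteness comes from a finite critical radius: large containing balls become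
  supercritical after recentring at \<open>c\<close>, and the rest lie in one fixed ball and have
  radius at least \<open>r\<close>. In plain BMO the supremum can be infinite, as for
  \<open>ln (norm x)\<close>.\<close>

lemma large_avg_finite:
  fixes f :: "'a::euclidean_space \<Rightarrow> 'b::{second_countable_topology,real_normed_vector}"
  assumes m: "f \<in> borel_measurable lebesgue" and f: "bmo_le V f N" and N: "0 \<le> N" and r: "0 < r"
    and c: "critical_radius V c < \<infinity>"
  shows "large_avg c r f < \<infinity>"
proof -
  obtain t where t: "critical_radius V c = ennreal t" "0 \<le> t" using c by (cases "critical_radius V c" rule: ennreal_cases) auto
  define s0 where "s0 = max r t"
  have s0: "r \<le> s0" "critical_radius V c \<le> ennreal s0" using t by (auto simp: s0_def ennreal_leI)
  define K where "K = ennreal ((2 * s0 / r) ^ DIM('a)) * abs_avg c (2 * s0) f"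
  have "large_avg c r f \<le> max K (ennreal (2 ^ DIM('a) * N))"
  proof (rule large_avg_le)
    fix d s assume ds: "ball c r \<subseteq> ball d s"
    have rs: "r \<le> s" by (rule ball_subset_radius_le[OF ds r])
    show "abs_avg d s f \<le> max K (ennreal (2 ^ DIM('a) * N))"
    proof (cases "s \<le> s0")
      case True
      have "ball d s \<subseteq> ball c (2 * s0)" using ball_subset_double[OF ds r] subset_ball[of "2 * s" "2 * s0" c] True by auto
      then have "abs_avg d s f \<le> ennreal ((2 * s0 / s) ^ DIM('a)) * abs_avg c (2 * s0) f"
        using rs r s0 by (intro abs_avg_mono_ball) auto
      also have "\<dots> \<le> K" unfolding K_def using rs r s0
        by (intro mult_right_mono ennreal_leI power_mono divide_left_mono) auto
      finally show ?thesis by (simp add: le_max_iff_disj)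
    next
      case False
      have "abs_avg d s f \<le> ennreal (2 ^ DIM('a)) * abs_avg c (2 * s) f"
        by (rule abs_avg_containing_ball_le[OF ds r])
      also have "\<dots> \<le> ennreal (2 ^ DIM('a)) * ennreal N"
        using rs r False s0 by (intro mult_mono bmo_leD(2)[OF f] order_trans[OF s0(2)]) (auto simp: ennreal_leI)
      also have "\<dots> = ennreal (2 ^ DIM('a) * N)" using N by (simp add: ennreal_mult)
      finally show ?thesis by (simp add: le_max_iff_disj)
    qed
  qed
  also have "\<dots> < \<infinity>"
    unfolding K_def using osc_le_abs_avg_finite[OF m _ bmo_leD(1)[OF f], of "2 * s0" c] s0 r
    by (auto simp: ennreal_mult_less_top)
  finally show ?thesis .
qed

section \<open>From the extended-valued to the real-valued maximal function\<close>

abbreviation real_maximal :: "('a::euclidean_space \<Rightarrow> 'b::real_normed_vector) \<Rightarrow> 'a \<Rightarrow> real"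
  where "real_maximal f x \<equiv> enn2real (maximal_op f x)"

lemma maximal_op_measurable_lebesgue [measurable]: "maximal_op f \<in> borel_measurable lebesgue"
  using maximal_op_measurable[of f] by (intro measurable_completion) simp

lemma real_maximal_measurable [measurable]: "real_maximal f \<in> borel_measurable borel"
  by measurable

lemma set_nn_integral_maximal_le:
  assumes r: "0 < r" 
    and int: "(\<integral>\<^sup>+y\<in>ball c r. (maximal_op f y - large_avg c r f) \<partial>lebesgue) \<le> K * emeasure lebesgue (ball c r)"
  shows "(\<integral>\<^sup>+y\<in>ball c r. maximal_op f y \<partial>lebesgue) \<le> (large_avg c r f + K) * emeasure lebesgue (ball c r)"
proof -
  let ?A = "large_avg c r f"
  have "(\<integral>\<^sup>+y\<in>ball c r. maximal_op f y \<partial>lebesgue) \<le> (\<integral>\<^sup>+y. ?A * indicator (ball c r) y + (maximal_op f y - ?A) * indicator (ball c r) y \<partial>lebesgue)"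
  proof (intro nn_integral_mono)
    fix y
    have "maximal_op f y \<le> ?A + (maximal_op f y - ?A)"
      by (rule ennreal_le_add_diff)
    then show "maximal_op f y * indicator (ball c r) y \<le> ?A * indicator (ball c r) y + (maximal_op f y - ?A) * indicator (ball c r) y"
      by (auto simp: indicator_def)
  qed
  also have "\<dots> = ?A * emeasure lebesgue (ball c r) + (\<integral>\<^sup>+y\<in>ball c r. (maximal_op f y - ?A) \<partial>lebesgue)"
    by (subst nn_integral_add) (auto simp: nn_integral_cmult_indicator simp del: emeasure_completion)
  also have "\<dots> \<le> ?A * emeasure lebesgue (ball c r) + K * emeasure lebesgue (ball c r)"
    by (intro add_left_mono int)
  finally show ?thesis by (simp add: distrib_right)
qed

lemma AE_lebesgue_of_balls:
  assumes "\<And>k::nat. AE x in lebesgue. x \<in> ball (0::'a::euclidean_space) (real (Suc k)) \<longrightarrow> P x"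
  shows "AE x in lebesgue. P x"
proof -
  have "AE x in lebesgue. \<forall>k. x \<in> ball 0 (real (Suc k)) \<longrightarrow> P x"
    using assms by (subst AE_all_countable) auto
  then show ?thesis
  proof (rule AE_mp, intro AE_I2 impI)
    fix x :: 'a assume *: "\<forall>k. x \<in> ball 0 (real (Suc k)) \<longrightarrow> P x"
    obtain k where "norm x < real k" using reals_Archimedean2 by blast
    then have "x \<in> ball 0 (real (Suc k))" by simp
    with * show "P x" by blast
  qed
qed

text \<open>The mean of \<open>Mf\<close> over a ball is at most \<open>A\<^sub>B\<close> plus a
  multiple of \<open>N\<close>, both finite; balls around the origin exhaust the space.\<close>

lemma maximal_op_AE_finite:
  fixes f :: "'a::euclidean_space \<Rightarrow> 'b::{second_countable_topology,real_normed_vector}"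
  assumes m: "f \<in> borel_measurable lebesgue" and f: "bmo_le V f N" and N: "0 < N"
    and c: "critical_radius V 0 < \<infinity>"
  shows "AE x in lebesgue. maximal_op f x < \<infinity>"
proof (rule AE_lebesgue_of_balls)
  fix k :: nat
  let ?r = "real (Suc k)"
  have r: "0 < ?r" by simp
  have fin: "large_avg 0 ?r f < \<infinity>" using N c by (intro large_avg_finite[OF m f _ r]) auto
  have "(\<integral>\<^sup>+y\<in>ball 0 ?r. maximal_op f y \<partial>lebesgue) \<le> (large_avg 0 ?r f + ennreal (7 * 60 ^ DIM('a) * N)) * emeasure lebesgue (ball (0::'a) ?r)"
    by (intro set_nn_integral_maximal_le[OF r] maximal_minus_large_avg_integral_bmo[OF m N bmo_leD(1)[OF f] r fin])
  also have "\<dots> < \<infinity>"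
    using fin emeasure_lebesgue_ball_pos[OF r, of "0::'a"] by (auto simp: ennreal_mult_less_top simp del: emeasure_completion)
  finally have *: "(\<integral>\<^sup>+y\<in>ball 0 ?r. maximal_op f y \<partial>lebesgue) \<noteq> \<infinity>" by simp
  have "AE y in lebesgue. maximal_op f y * indicator (ball 0 ?r) y \<noteq> \<infinity>"
    by (intro nn_integral_PInf_AE[OF _ *]) (auto intro!: borel_measurable_times_ennreal borel_measurable_indicator)
  then show "AE x in lebesgue. x \<in> ball 0 ?r \<longrightarrow> maximal_op f x < \<infinity>"
    by (rule AE_mp) (auto simp: less_top)
qed

text \<open>On the ball \<open>A\<^sub>B \<le> Mf\<close>, so the absolute value is the truncated
  difference of extended numbers; \<open>enn2real\<close> is harmless off the null set where
  \<open>Mf\<close> is infinite.\<close>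

lemma abs_avg_real_maximal_minus_large_avg:
  assumes r: "0 < r" and fin: "large_avg c r f < \<infinity>" and AE: "AE x in lebesgue. maximal_op f x < \<infinity>"
    and int: "(\<integral>\<^sup>+y\<in>ball c r. (maximal_op f y - large_avg c r f) \<partial>lebesgue) \<le> K * emeasure lebesgue (ball c r)"
  shows "abs_avg c r (\<lambda>y. real_maximal f y - enn2real (large_avg c r f)) \<le> K"
  unfolding abs_avg_le_iff[OF r]
proof (rule order_trans[OF nn_integral_mono_AE int])
  show "AE y in lebesgue. ennreal (norm (real_maximal f y - enn2real (large_avg c r f))) * indicator (ball c r) y
      \<le> (maximal_op f y - large_avg c r f) * indicator (ball c r) y"
    using AE
  proof (rule AE_mp, intro AE_I2 impI)
    fix y assume *: "maximal_op f y < \<infinity>"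
    show "ennreal (norm (real_maximal f y - enn2real (large_avg c r f))) * indicator (ball c r) y
      \<le> (maximal_op f y - large_avg c r f) * indicator (ball c r) y"
    proof (cases "y \<in> ball c r")
      case True
      then have le: "large_avg c r f \<le> maximal_op f y" by (rule large_avg_le_maximal_op)
      obtain A where A: "large_avg c r f = ennreal A" "0 \<le> A" using fin by (cases "large_avg c r f" rule: ennreal_cases) auto
      obtain M where M: "maximal_op f y = ennreal M" "0 \<le> M" using * by (cases "maximal_op f y" rule: ennreal_cases) auto
      show ?thesis using le A M True by (simp add: ennreal_minus)
    qed simp
  qed
qed

lemma abs_avg_real_maximal_le:
  assumes r: "0 < r" 
    and int: "(\<integral>\<^sup>+y\<in>ball c r. (maximal_op f y - large_avg c r f) \<partial>lebesgue) \<le> K * emeasure lebesgue (ball c r)"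
  shows "abs_avg c r (real_maximal f) \<le> large_avg c r f + K"
  unfolding abs_avg_le_iff[OF r]
proof (rule order_trans[OF nn_integral_mono set_nn_integral_maximal_le[OF r int]])
  show "ennreal (norm (real_maximal f y)) * indicator (ball c r) y \<le> maximal_op f y * indicator (ball c r) y" for y
    by (intro mult_right_mono) (cases "maximal_op f y" rule: ennreal_cases, auto)
qed

lemma real_maximal_bmo_le:
  fixes f :: "'a::euclidean_space \<Rightarrow> 'b::{second_countable_topology,real_normed_vector}"
  assumes m: "f \<in> borel_measurable lebesgue" and f: "bmo_le V f N" and N: "0 < N"
    and c: "\<And>c. critical_radius V c < \<infinity>"
  shows "bmo_le V (real_maximal f) (8 * 60 ^ DIM('a) * N)"
  unfolding bmo_le_def
proof (intro allI impI conjI)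
  fix c :: 'a and r assume r: "0 < (r::real)"
  have N': "0 \<le> N" using N by simp
  note fin = large_avg_finite[OF m f N' r c]
  note int = maximal_minus_large_avg_integral_bmo[OF m N bmo_leD(1)[OF f] r fin]
  have "osc_le c r (real_maximal f) (7 * 60 ^ DIM('a) * N)"
    unfolding osc_le_def using abs_avg_real_maximal_minus_large_avg[OF r fin maximal_op_AE_finite[OF m f N c] int] by blast
  then show "osc_le c r (real_maximal f) (8 * 60 ^ DIM('a) * N)" using N by (rule_tac osc_le_mono) auto
  \<comment> \<open>The eighth copy of \<open>60^n * N\<close> pays for \<open>2^n * N\<close>, the
    bound on \<open>A\<^sub>B\<close> beyond the critical radius.\<close>
  assume "critical_radius V c \<le> ennreal r"
  then have "abs_avg c r (real_maximal f) \<le> ennreal (2 ^ DIM('a) * N) + ennreal (7 * 60 ^ DIM('a) * N)"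
    using abs_avg_real_maximal_le[OF r int] large_avg_le_of_critical[OF f N' r] by (meson add_right_mono order_trans)
  also have "\<dots> = ennreal ((2 ^ DIM('a) + 7 * 60 ^ DIM('a)) * N)" using N by (simp add: ring_distribs)
  also have "\<dots> \<le> ennreal (8 * 60 ^ DIM('a) * N)"
    using N power_mono[of 2 "60::real" "DIM('a)"] by (intro ennreal_leI mult_right_mono) auto
  finally show "abs_avg c r (real_maximal f) \<le> ennreal (8 * 60 ^ DIM('a) * N)" .
qed

section \<open>The critical radius\<close>

lemma le_add_powr_mult:
  fixes v T q :: real
  assumes "0 \<le> v" "0 < T" "1 \<le> q"
  shows "v \<le> T + v powr q * T powr (1 - q)"
proof (cases "v \<le> T")
  case True
  then show ?thesis by (simp add: add_increasing2)
next
  case False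
  then have "v = v powr q * v powr (1 - q)" using assms by (simp flip: powr_add)
  also have "\<dots> \<le> v powr q * T powr (1 - q)"
    using False assms by (intro mult_left_mono powr_mono2') auto
  finally show ?thesis using assms by simp
qed

lemma powr_le_one_add_powr:
  fixes v p q :: real
  assumes "0 \<le> v" "0 \<le> p" "p \<le> q"
  shows "v powr p \<le> 1 + v powr q"
proof (cases "v \<le> 1")
  case True
  then have "v powr p \<le> 1" using assms by (intro powr_le1) auto
  then show ?thesis by (simp add: add_increasing2)
next
  case False
  then have "v powr p \<le> v powr q" using assms by (intro powr_mono) auto
  then show ?thesis by simp
qed

section \<open>Integrals of \<open>V\<close> and its powers over balls\<close>

lemma Lq_loc_integrable_ball:
  fixes V :: "'a::euclidean_space \<Rightarrow> real"
  assumes V: "V \<in> Lq_loc q" and p: "0 \<le> p" "p \<le> q"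
  shows "set_integrable lebesgue (ball x r) (\<lambda>y. \<bar>V y\<bar> powr p)"
proof -
  have m [measurable]: "V \<in> borel_measurable lebesgue" using V by (simp add: Lq_loc_def)
  have "set_integrable lebesgue (cball x r) (\<lambda>y. \<bar>V y\<bar> powr q)" using V by (simp add: Lq_loc_def)
  then have 1: "set_integrable lebesgue (ball x r) (\<lambda>y. \<bar>V y\<bar> powr q)"
    by (rule set_integrable_subset) auto
  have 2: "set_integrable lebesgue (ball x r) (\<lambda>y. 1 :: real)"
    unfolding set_integrable_def using emeasure_lborel_ball_finite[of x r]
    by (auto intro!: integrable_real_indicator)
  show ?thesis
    unfolding set_integrable_def
  proof (rule Bochner_Integration.integrable_bound)
    show "integrable lebesgue (\<lambda>y. indicat_real (ball x r) y *\<^sub>R (1 + \<bar>V y\<bar> powr q))"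
      using set_integral_add(1)[OF 2 1] by (simp add: set_integrable_def)
    show "(\<lambda>y. indicat_real (ball x r) y *\<^sub>R (\<bar>V y\<bar> powr p)) \<in> borel_measurable lebesgue"
      by (intro borel_measurable_scaleR borel_measurable_indicator) auto
    show "AE y in lebesgue. norm (indicat_real (ball x r) y *\<^sub>R (\<bar>V y\<bar> powr p))
        \<le> norm (indicat_real (ball x r) y *\<^sub>R (1 + \<bar>V y\<bar> powr q))"
      using powr_le_one_add_powr[OF _ p] by (intro AE_I2) (simp add: indicator_def)
  qed
qed

lemma Lq_loc_integrable_ball_self:
  fixes V :: "'a::euclidean_space \<Rightarrow> real"
  assumes V: "V \<in> Lq_loc q" and q: "1 \<le> q"
  shows "set_integrable lebesgue (ball x r) V"
proof -
  have m: "V \<in> borel_measurable lebesgue" using V by (simp add: Lq_loc_def)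
  have "set_integrable lebesgue (ball x r) (\<lambda>y. \<bar>V y\<bar> powr 1)"
    using q by (intro Lq_loc_integrable_ball[OF V]) auto
  then have "integrable lebesgue (\<lambda>y. \<bar>indicat_real (ball x r) y *\<^sub>R V y\<bar>)"
    by (simp add: set_integrable_def abs_mult)
  then show ?thesis
    unfolding set_integrable_def using m
    by (subst (asm) integrable_abs_iff) (auto intro!: borel_measurable_scaleR borel_measurable_indicator)
qed

lemma set_integral_mono_ball:
  fixes V :: "'a::euclidean_space \<Rightarrow> real"
  assumes "set_integrable lebesgue A V" "set_integrable lebesgue B V" "AE y in lebesgue. 0 \<le> V y" "A \<subseteq> B"
  shows "(LINT y:A|lebesgue. V y) \<le> (LINT y:B|lebesgue. V y)"
  unfolding set_lebesgue_integral_def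
proof (intro integral_mono_AE assms(1,2)[unfolded set_integrable_def])
  show "AE y in lebesgue. indicat_real A y *\<^sub>R V y \<le> indicat_real B y *\<^sub>R V y"
    using assms(3) by eventually_elim (use assms(4) in \<open>auto simp: indicator_def\<close>)
qed

lemma set_integral_nonneg_of_AE:
  fixes V :: "'a \<Rightarrow> real"
  assumes "AE y in M. 0 \<le> V y"
  shows "0 \<le> (LINT y:A|M. V y)"
  unfolding set_lebesgue_integral_def
proof (rule integral_nonneg_AE)
  show "AE y in M. 0 \<le> indicat_real A y *\<^sub>R V y" using assms by eventually_elim auto
qed

text \<open>Integrates \<open>V \<le> T + V\<^sup>p T\<^sup>1\<^sup>-\<^sup>p\<close> outside the smaller ball; the free parameter \<open>T\<close> takes the
  place of Hoelder's inequality.\<close>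

lemma Lq_loc_integral_ball_le:
  fixes V :: "'a::euclidean_space \<Rightarrow> real"
  assumes V: "V \<in> Lq_loc q" and nonneg: "AE y in lebesgue. 0 \<le> V y" and p: "1 \<le> p" "p \<le> q"
    and T: "0 < T" and s: "k \<le> s" "0 < s"
  shows "(LINT y:ball x s|lebesgue. V y) \<le> (LINT y:ball x k|lebesgue. V y) + T * (unit_ball_vol DIM('a) * s ^ DIM('a))
    + T powr (1 - p) * ((LINT y:ball x s|lebesgue. \<bar>V y\<bar> powr p) - (LINT y:ball x k|lebesgue. \<bar>V y\<bar> powr p))"
proof -
  have p0: "0 \<le> p" "1 \<le> q" using p by auto
  note i1 = Lq_loc_integrable_ball_self[OF V p0(2), unfolded set_integrable_def]
  note i2 = Lq_loc_integrable_ball[OF V p0(1) p(2), unfolded set_integrable_def]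
  have i3: "integrable lebesgue (indicat_real (ball x s))"
    using emeasure_lborel_ball_finite[of x s] by (auto intro!: integrable_real_indicator)
  let ?I = "\<lambda>s y. indicat_real (ball x s) y"
  have "(LINT y|lebesgue. ?I s y *\<^sub>R V y) \<le> (LINT y|lebesgue. ?I k y *\<^sub>R V y + T * ?I s y
      + T powr (1 - p) * (?I s y *\<^sub>R (\<bar>V y\<bar> powr p) - ?I k y *\<^sub>R (\<bar>V y\<bar> powr p)))"
  proof (intro integral_mono_AE i1 Bochner_Integration.integrable_add integrable_mult_right Bochner_Integration.integrable_diff i2 i3)
    show "AE y in lebesgue. ?I s y *\<^sub>R V y \<le> ?I k y *\<^sub>R V y + T * ?I s y
      + T powr (1 - p) * (?I s y *\<^sub>R (\<bar>V y\<bar> powr p) - ?I k y *\<^sub>R (\<bar>V y\<bar> powr p))"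
      using nonneg
    proof (rule AE_mp, intro AE_I2 impI)
      fix y assume v: "0 \<le> V y"
      have "V y \<le> T + T powr (1 - p) * V y powr p"
        using le_add_powr_mult[OF v T p(1)] by (simp add: mult.commute)
      then show "?I s y *\<^sub>R V y \<le> ?I k y *\<^sub>R V y + T * ?I s y
      + T powr (1 - p) * (?I s y *\<^sub>R (\<bar>V y\<bar> powr p) - ?I k y *\<^sub>R (\<bar>V y\<bar> powr p))"
        using v T s by (auto simp: indicator_def)
    qed
  qed
  also have "\<dots> = (LINT y|lebesgue. ?I k y *\<^sub>R V y) + T * (LINT y|lebesgue. ?I s y)
      + T powr (1 - p) * ((LINT y|lebesgue. ?I s y *\<^sub>R (\<bar>V y\<bar> powr p)) - (LINT y|lebesgue. ?I k y *\<^sub>R (\<bar>V y\<bar> powr p)))"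
    by (simp add: i1 i2 i3 del: real_scaleR_def) 
  also have "(LINT y|lebesgue. ?I s y) = unit_ball_vol DIM('a) * s ^ DIM('a)"
    using measure_lebesgue_ball[OF s(2), of x] by simp
  finally show ?thesis unfolding set_lebesgue_integral_def .
qed

text \<open>The reverse Hoelder inequality rewritten in terms of the scaled integral that defines
  the critical radius. The remaining power \<open>s^(n - 2 q)\<close> decays for
  \<open>q > n / 2\<close> and disappears in the borderline case \<open>q = n / 2\<close>.\<close>

lemma reverse_Holder_integral_powr_le:
  fixes V :: "'a::euclidean_space \<Rightarrow> real"
  assumes V: "V \<in> reverse_Holder q" and q: "1 \<le> q"
  obtains K where "0 < K" "\<And>s. 0 < s \<Longrightarrow> (LINT y:ball x s|lebesgue. \<bar>V y\<bar> powr q)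
    \<le> K * s powr (real DIM('a) - 2 * q) * (s powr (2 - real DIM('a)) * (LINT y:ball x s|lebesgue. V y)) powr q"
proof -
  from V obtain C where C: "0 < C" "\<And>c r. 0 < r \<Longrightarrow> ball_avg c r (\<lambda>y. V y powr q) powr (1 / q) \<le> C * ball_avg c r V"
    and nonneg: "AE y in lebesgue. 0 \<le> V y" and L: "V \<in> Lq_loc q"
    unfolding reverse_Holder_def by blast
  define \<beta> where "\<beta> = unit_ball_vol (real DIM('a))"
  have \<beta>: "0 < \<beta>" by (simp add: \<beta>_def)
  show thesis
  proof (rule that[of "\<beta> * (C / \<beta>) powr q"])
    show "0 < \<beta> * (C / \<beta>) powr q" using \<beta> C(1) by simp
    fix s :: real assume s: "0 < s"
    define J where "J = (LINT y:ball x s|lebesgue. \<bar>V y\<bar> powr q)"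
    define I where "I = (LINT y:ball x s|lebesgue. V y)"
    have J: "(LINT y:ball x s|lebesgue. V y powr q) = J"
      unfolding J_def set_lebesgue_integral_def
    proof (rule integral_cong_AE)
      show "AE y in lebesgue. indicat_real (ball x s) y *\<^sub>R (V y powr q) = indicat_real (ball x s) y *\<^sub>R (\<bar>V y\<bar> powr q)"
        using nonneg by eventually_elim auto
    qed (use L in \<open>auto simp: Lq_loc_def intro!: borel_measurable_scaleR borel_measurable_indicator\<close>)
    have J0: "0 \<le> J" unfolding J_def by (intro set_integral_nonneg_of_AE) auto
    have I0: "0 \<le> I" unfolding I_def by (rule set_integral_nonneg_of_AE[OF nonneg])
    have ms: "measure lebesgue (ball x s) = \<beta> * s ^ DIM('a)" using measure_lebesgue_ball[OF s, of x] by (simp add: \<beta>_def)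
    have "(J / (\<beta> * s ^ DIM('a))) powr (1 / q) \<le> C * (I / (\<beta> * s ^ DIM('a)))"
      using C(2)[OF s, of x] unfolding ball_avg_def J ms I_def[symmetric] by (simp add: divide_inverse mult.commute)
    then have "((J / (\<beta> * s ^ DIM('a))) powr (1 / q)) powr q \<le> (C * (I / (\<beta> * s ^ DIM('a)))) powr q"
      using q by (intro powr_mono2) auto
    moreover have "((J / (\<beta> * s ^ DIM('a))) powr (1 / q)) powr q = J / (\<beta> * s ^ DIM('a))"
      using q J0 \<beta> s by (simp add: powr_powr)
    ultimately have "J \<le> \<beta> * s ^ DIM('a) * (C * (I / (\<beta> * s ^ DIM('a)))) powr q"
      using \<beta> s by (simp add: pos_divide_le_eq mult.commute)
    also have "C * (I / (\<beta> * s ^ DIM('a))) = (C / \<beta>) * (s powr (-2) * (s powr (2 - real DIM('a)) * I))"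
    proof -
      have "s powr (-2) * s powr (2 - real DIM('a)) = inverse (s ^ DIM('a))"
        unfolding powr_add[symmetric] using s by (simp add: powr_minus powr_realpow)
      then have e: "inverse (s ^ DIM('a)) = s powr (-2) * s powr (2 - real DIM('a))" by (rule sym)
      have "C * (I / (\<beta> * s ^ DIM('a))) = (C / \<beta>) * (inverse (s ^ DIM('a)) * I)"
        by (simp add: divide_inverse mult_ac)
      then show ?thesis by (simp only: e mult.assoc)
    qed
    also have "\<dots> powr q = (C / \<beta>) powr q * (s powr (- 2 * q) * (s powr (2 - real DIM('a)) * I) powr q)"
      by (simp only: powr_mult powr_powr)
    also have "\<beta> * s ^ DIM('a) * \<dots> = \<beta> * (C / \<beta>) powr q * (s powr (real DIM('a)) * s powr (- 2 * q)) * (s powr (2 - real DIM('a)) * I) powr q"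
      using s by (simp only: powr_realpow mult_ac)
    also have "s powr (real DIM('a)) * s powr (- 2 * q) = s powr (real DIM('a) - 2 * q)"
      by (simp flip: powr_add)
    finally show "J \<le> \<beta> * (C / \<beta>) powr q * s powr (real DIM('a) - 2 * q) * (s powr (2 - real DIM('a)) * I) powr q" .
  qed
qed

text \<open>If the scaled integral stayed bounded along a sequence of radii, then \<open>V\<^sup>q\<close> would be integrable
  on the whole space; this forces the scaled integral to tend to zero, hence \<open>V = 0\<close>.\<close>

lemma reverse_Holder_scaled_integral_tendsto:
  fixes V :: "'a::euclidean_space \<Rightarrow> real"
  assumes V: "V \<in> reverse_Holder q" and n: "3 \<le> DIM('a)" and q: "real DIM('a) / 2 \<le> q"
    and nz: "\<not> (AE x in lebesgue. V x = 0)"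
  shows "\<exists>S>0. \<forall>s\<ge>S. K < s powr (2 - real DIM('a)) * (LINT y:ball 0 s|lebesgue. V y)"
proof (rule ccontr)
  let ?n = "real DIM('a)"
  define u where "u s = s powr (2 - ?n) * (LINT y:ball 0 s|lebesgue. V y)" for s
  define J where "J s = (LINT y:ball 0 s|lebesgue. \<bar>V y\<bar> powr q)" for s
  assume "\<not> ?thesis"
  then have freq: "\<exists>s\<ge>S. u s \<le> K" if "0 < S" for S
    using that unfolding u_def by (meson not_le)
  have nonneg: "AE y in lebesgue. 0 \<le> V y" and L: "V \<in> Lq_loc q" using V by (auto simp: reverse_Holder_def)
  have q1: "1 \<le> q" "1 < q" using n q by auto
  have "0 \<le> q" using q1 by simp
  have u0: "0 \<le> u s" for s
    unfolding u_def by (intro mult_nonneg_nonneg set_integral_nonneg_of_AE[OF nonneg]) simp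
  have J0: "0 \<le> J s" for s
    unfolding J_def by (intro set_integral_nonneg_of_AE) auto
  have Jmono: "J k \<le> J s" if "k \<le> s" for k s
    unfolding J_def using that \<open>0 \<le> q\<close> by (intro set_integral_mono_ball Lq_loc_integrable_ball[OF L]) auto
  obtain C where C: "0 < C" "\<And>s. 0 < s \<Longrightarrow> (LINT y:ball 0 s|lebesgue. \<bar>V y\<bar> powr q)
    \<le> C * s powr (?n - 2 * q) * (s powr (2 - ?n) * (LINT y:ball 0 s|lebesgue. V y)) powr q"
    by (rule reverse_Holder_integral_powr_le[OF V q1(1), of 0]) blast
  note C = C[folded J_def u_def]
  have K0: "0 \<le> K" using freq[of 1] u0 order_trans by (metis zero_less_one)
  have Jsmall: "J k = 0" if small: "\<And>e. 0 < e \<Longrightarrow> \<exists>s\<ge>k. J s \<le> e" for k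
  proof (rule ccontr)
    assume "J k \<noteq> 0"
    with J0[of k] obtain s where "k \<le> s" "J s \<le> J k / 2" using small[of "J k / 2"] by auto
    with Jmono[of k s] J0[of k] \<open>J k \<noteq> 0\<close> show False by simp
  qed
  \<comment> \<open>For \<open>q > n / 2\<close> the factor \<open>s^(n - 2 q)\<close> tends to
    zero, so boundedness of \<open>u\<close> along a sequence is enough. For
    \<open>q = n / 2\<close> it only bounds \<open>J\<close>; but then the mass of
    \<open>V^q\<close> outside a large ball is small, which makes \<open>u\<close> small at large
    radii and hence \<open>J\<close> small.\<close>
  have "\<exists>s\<ge>k. J s \<le> e" if e: "0 < e" for k e
  proof (cases "?n / 2 < q")
    case True
    have "((\<lambda>s. C * s powr (?n - 2 * q) * K powr q) \<longlongrightarrow> C * 0 * K powr q) at_top"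
      using True by (intro tendsto_intros tendsto_neg_powr filterlim_ident) auto
    then have "eventually (\<lambda>s. C * s powr (?n - 2 * q) * K powr q < e) at_top"
      using e by (intro order_tendstoD) auto
    then obtain S where S: "\<And>s. S \<le> s \<Longrightarrow> C * s powr (?n - 2 * q) * K powr q < e"
      unfolding eventually_at_top_linorder by blast
    obtain s where s: "max (max S k) 1 \<le> s" "u s \<le> K" using freq[of "max (max S k) 1"] by (auto simp: less_max_iff_disj)
    have "J s \<le> C * s powr (?n - 2 * q) * u s powr q" using s by (intro C(2)) auto
    also have "\<dots> \<le> C * s powr (?n - 2 * q) * K powr q"
      using C(1) s u0 q1 by (intro mult_left_mono powr_mono2) auto
    also have "\<dots> \<le> e" using S[of s] s by simp
    finally show ?thesis using s by auto
  next
    case False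
    then have qn: "q = ?n / 2" using q by simp
    have Ju: "J s \<le> C * u s powr q" if "0 < s" for s using C(2)[OF that] that by (simp add: qn)
    have bdd: "bdd_above (range J)"
    proof (rule bdd_aboveI2[of _ _ "C * K powr q"])
      fix k
      obtain s where s: "max k 1 \<le> s" "u s \<le> K" using freq[of "max k 1"] by (auto simp: less_max_iff_disj)
      have "J k \<le> J s" using s by (intro Jmono) auto
      also have "\<dots> \<le> C * u s powr q" using s by (intro Ju) auto
      also have "\<dots> \<le> C * K powr q" using C(1) s u0 q1 by (intro mult_left_mono powr_mono2) auto
      finally show "J k \<le> C * K powr q" .
    qed
    \<comment> \<open>The three contributions to \<open>u s\<close>, from the ball of radius
      \<open>k0\<close>, from the level \<open>T\<close> and from the tail of \<open>J\<close>, are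
      each at most \<open>d\<close>; their sum \<open>3 * d\<close> is the value of
      \<open>u s\<close> at which \<open>C * u s powr q\<close> equals \<open>e\<close>.\<close>
    define d where "d = (e / C) powr (1 / q) / 3"
    have d: "0 < d" using e C(1) by (simp add: d_def)
    define \<beta> where "\<beta> = unit_ball_vol ?n"
    have \<beta>: "0 < \<beta>" by (simp add: \<beta>_def)
    define l where "l = d / \<beta>"
    have l: "0 < l" using d \<beta> by (simp add: l_def)
    have "Sup (range J) - d / l powr (1 - q) < Sup (range J)" using d l by simp
    then obtain k0 where k0: "Sup (range J) - d / l powr (1 - q) < J k0"
      using less_cSup_iff[OF _ bdd] by auto
    define I0 where "I0 = (LINT y:ball 0 k0|lebesgue. V y)"
    have "((\<lambda>s. s powr (2 - ?n) * I0) \<longlongrightarrow> 0 * I0) at_top"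
      using n by (intro tendsto_intros tendsto_neg_powr filterlim_ident) auto
    then have "eventually (\<lambda>s. s powr (2 - ?n) * I0 < d) at_top" using d by (intro order_tendstoD) auto
    then obtain S where S: "\<And>s. S \<le> s \<Longrightarrow> s powr (2 - ?n) * I0 < d"
      unfolding eventually_at_top_linorder by blast
    define s where "s = max (max S k) (max k0 1)"
    have s: "S \<le> s" "k \<le> s" "k0 \<le> s" "0 < s" by (auto simp: s_def)
    \<comment> \<open>The factor \<open>s^(-2)\<close> is the natural scaling of a potential; for
      \<open>q = n / 2\<close> it cancels all powers of \<open>s\<close>, leaving
      \<open>l * \<beta> = d\<close> and the factor \<open>l powr (1 - q)\<close> in front of the
      tail.\<close>
    define T where "T = l * s powr (-2)"
    have T: "0 < T" using l s by (simp add: T_def)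
    have "(LINT y:ball 0 s|lebesgue. V y) \<le> I0 + T * (\<beta> * s ^ DIM('a)) + T powr (1 - q) * (J s - J k0)"
      unfolding I0_def \<beta>_def J_def by (rule Lq_loc_integral_ball_le[OF L nonneg q1(1) order_refl T s(3,4)])
    then have "u s \<le> s powr (2 - ?n) * (I0 + T * (\<beta> * s ^ DIM('a)) + T powr (1 - q) * (J s - J k0))"
      unfolding u_def by (intro mult_left_mono) auto
    also have "\<dots> = s powr (2 - ?n) * I0 + (s powr (2 - ?n) * T * s ^ DIM('a)) * \<beta>
        + (s powr (2 - ?n) * T powr (1 - q)) * (J s - J k0)"
      by (simp add: algebra_simps)
    also have "s powr (2 - ?n) * T * s ^ DIM('a) = l"
    proof -
      have "s powr (2 - ?n) * T * s ^ DIM('a) = l * (s powr (2 - ?n) * s powr (-2) * s powr ?n)"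
        using s(4) by (simp only: T_def powr_realpow mult_ac)
      also have "s powr (2 - ?n) * s powr (-2) * s powr ?n = 1"
        using s(4) by (simp flip: powr_add)
      finally show ?thesis by simp
    qed
    also have "s powr (2 - ?n) * T powr (1 - q) = l powr (1 - q)"
    proof -
      have "T powr (1 - q) = l powr (1 - q) * s powr (-2 * (1 - q))"
        unfolding T_def using l by (subst powr_mult) (auto simp only: powr_powr)
      moreover have "s powr (2 - ?n) * s powr (-2 * (1 - q)) = 1"
        unfolding powr_add[symmetric] using s(4) by (simp add: qn)
      ultimately show ?thesis by (simp add: mult_ac)
    qed
    also have "J s - J k0 \<le> d / l powr (1 - q)"
      using k0 cSup_upper[OF rangeI bdd, of s] by simp
    finally have "u s \<le> s powr (2 - ?n) * I0 + l * \<beta> + l powr (1 - q) * (d / l powr (1 - q))"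
      by (simp add: mult_left_mono)
    also have "\<dots> \<le> d + d + d" using S[OF s(1)] \<beta> l by (simp add: l_def)
    finally have "u s \<le> (e / C) powr (1 / q)" by (simp add: d_def)
    then have "u s powr q \<le> ((e / C) powr (1 / q)) powr q" using u0 q1 by (intro powr_mono2) auto
    also have "\<dots> = e / C" using e C(1) q1 by (simp add: powr_powr)
    finally have "C * u s powr q \<le> e" using C(1) by (simp add: field_simps)
    with Ju[OF s(4)] s(2) show ?thesis by (intro exI[of _ s]) auto
  qed
  then have J: "J k = 0" for k by (intro Jsmall) auto
  have "AE x in lebesgue. V x = 0"
  proof (rule AE_lebesgue_of_balls)
    fix k :: nat
    let ?r = "real (Suc k)"
    have "(LINT y|lebesgue. indicat_real (ball 0 ?r) y *\<^sub>R (\<bar>V y\<bar> powr q)) = 0"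
      using J[of ?r] by (simp only: J_def set_lebesgue_integral_def)
    then have "AE y in lebesgue. indicat_real (ball 0 ?r) y *\<^sub>R (\<bar>V y\<bar> powr q) = 0"
      using Lq_loc_integrable_ball[OF L \<open>0 \<le> q\<close> order_refl, of 0 ?r]
      by (subst (asm) integral_nonneg_eq_0_iff_AE) (auto simp: set_integrable_def)
    then show "AE x in lebesgue. x \<in> ball 0 ?r \<longrightarrow> V x = 0"
      by (rule AE_mp) (auto simp: indicator_def)
  qed
  with nz show False ..
qed

text \<open>For \<open>r > 2 * norm x + 2 * S\<close> the ball of radius \<open>r / 2\<close> at the
  origin lies in \<open>ball x r\<close>. Halving the radius multiplies \<open>r^(2-n)\<close> by
  \<open>2^(n-2)\<close>, so scaled integrals above \<open>2^(n-2)\<close> at the origin force a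
  value above 1 at \<open>x\<close>.\<close>

lemma critical_radius_le_linear:
  fixes V :: "'a::euclidean_space \<Rightarrow> real"
  assumes V: "V \<in> reverse_Holder q" and n: "3 \<le> DIM('a)" and q: "real DIM('a) / 2 \<le> q"
    and nz: "\<not> (AE x in lebesgue. V x = 0)"
  obtains S where "0 < S" "\<And>x. critical_radius V x \<le> ennreal (2 * norm x + 2 * S)"
proof -
  let ?n = "real DIM('a)"
  have nonneg: "AE y in lebesgue. 0 \<le> V y" and L: "V \<in> Lq_loc q" using V by (auto simp: reverse_Holder_def)
  have q1: "1 \<le> q" using n q by auto
  obtain S where S: "0 < S" "\<And>s. S \<le> s \<Longrightarrow> 2 powr (?n - 2) < s powr (2 - ?n) * (LINT y:ball 0 s|lebesgue. V y)"
    using reverse_Holder_scaled_integral_tendsto[OF V n q nz] by blast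
  show thesis
  proof (rule that[OF S(1)])
    fix x :: 'a
    show "critical_radius V x \<le> ennreal (2 * norm x + 2 * S)"
      unfolding critical_radius_def
    proof (intro SUP_least ennreal_leI, rule ccontr)
      fix r assume "r \<in> {r. 0 < r \<and> r powr (2 - ?n) * (LINT y:ball x r|lebesgue. V y) \<le> 1}"
        and "\<not> r \<le> 2 * norm x + 2 * S"
      then have r: "0 < r" "r powr (2 - ?n) * (LINT y:ball x r|lebesgue. V y) \<le> 1" "2 * norm x + 2 * S < r" by auto
      have "S \<le> r / 2" using r(3) norm_ge_zero[of x] by linarith
      then have "2 powr (?n - 2) < (r / 2) powr (2 - ?n) * (LINT y:ball 0 (r / 2)|lebesgue. V y)" by (rule S(2))
      also have "\<dots> \<le> (r / 2) powr (2 - ?n) * (LINT y:ball x r|lebesgue. V y)"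
      proof (intro mult_left_mono set_integral_mono_ball Lq_loc_integrable_ball_self[OF L q1] nonneg)
        show "ball 0 (r / 2) \<subseteq> ball x r"
        proof
          fix z :: 'a assume "z \<in> ball 0 (r / 2)"
          then have "norm z < r / 2" by simp
          then have "dist x z < r" using r(3) S(1) norm_triangle_ineq4[of x z] by (simp add: dist_norm)
          then show "z \<in> ball x r" by simp
        qed
      qed simp
      also have "\<dots> = 2 powr (?n - 2) * (r powr (2 - ?n) * (LINT y:ball x r|lebesgue. V y))"
      proof -
        have "(r / 2) powr (2 - ?n) = 2 powr (?n - 2) * r powr (2 - ?n)"
        proof -
          have "(2::real) powr (?n - 2) = 2 powr (- (2 - ?n))" by simp
          also have "\<dots> = 1 / 2 powr (2 - ?n)" by (rule powr_minus_divide)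
          finally have e: "(2::real) powr (?n - 2) = 1 / 2 powr (2 - ?n)" .
          show ?thesis unfolding e powr_divide by simp
        qed
        then show ?thesis by (simp only: mult.assoc)
      qed
      also have "\<dots> \<le> 2 powr (?n - 2) * 1" by (intro mult_left_mono r(2)) auto
      finally show False by simp
    qed
  qed
qed

text \<open>By absolute continuity, the integral of \<open>V^(n/2)\<close> over
  \<open>ball x r\<close> is small as \<open>r\<close> tends to 0, uniformly for \<open>x\<close> in
  a bounded set. The exponent \<open>n / 2\<close> is scale invariant, so this makes the scaled
  integral of \<open>V\<close> at most 1.\<close>

lemma critical_radius_ge_locally:
  fixes V :: "'a::euclidean_space \<Rightarrow> real"
  assumes V: "V \<in> reverse_Holder q" and n: "3 \<le> DIM('a)" and q: "real DIM('a) / 2 \<le> q"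
  obtains r where "0 < r" "\<And>x. norm x \<le> R \<Longrightarrow> ennreal r \<le> critical_radius V x"
proof -
  let ?n = "real DIM('a)"
  have nonneg: "AE y in lebesgue. 0 \<le> V y" and L: "V \<in> Lq_loc q" using V by (auto simp: reverse_Holder_def)
  have m [measurable]: "V \<in> borel_measurable lebesgue" using L by (simp add: Lq_loc_def)
  define p where "p = ?n / 2"
  have p: "1 \<le> p" "0 \<le> p" "p \<le> q" using n q by (auto simp: p_def)
  define \<beta> where "\<beta> = unit_ball_vol ?n"
  have \<beta>: "0 < \<beta>" by (simp add: \<beta>_def)
  \<comment> \<open>These values make both terms of the final estimate equal to one half:
    \<open>l * \<beta> = 1/2\<close> and \<open>l powr (1 - p) * (2 * e) = 1/2\<close>.\<close>
  define l where "l = 1 / (2 * \<beta>)"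
  have l: "0 < l" using \<beta> by (simp add: l_def)
  define e where "e = 1 / (4 * l powr (1 - p))"
  have e: "0 < e" using l by (simp add: e_def)
  define W where "W y = indicat_real (ball 0 (\<bar>R\<bar> + 1)) y *\<^sub>R (\<bar>V y\<bar> powr p)" for y
  have W: "integrable lebesgue W"
    using Lq_loc_integrable_ball[OF L p(2,3), of 0 "\<bar>R\<bar> + 1"] by (simp add: W_def[abs_def] set_integrable_def)
  have W0: "0 \<le> W y" for y by (simp add: W_def)
  have Wm [measurable]: "W \<in> borel_measurable lebesgue" using W by auto
  \<comment> \<open>\<open>W\<close> is split at height \<open>k\<close>: by dominated convergence
    the part above \<open>k\<close> has total integral below \<open>e\<close> for some
    \<open>k\<close>, and the part below contributes at most \<open>k\<close> times the volume of
    the ball. This makes the smallness uniform in \<open>x\<close>.\<close>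
  have lim: "(\<lambda>k. LINT y|lebesgue. (if real k < W y then W y else 0)) \<longlonglongrightarrow> (LINT y|(lebesgue :: 'a measure). 0 :: real)"
  proof (rule integral_dominated_convergence[where w = W])
    show "integrable lebesgue W" by (rule W)
    show "AE y in lebesgue. (\<lambda>k. if real k < W y then W y else 0) \<longlonglongrightarrow> 0"
    proof (intro AE_I2 tendsto_eventually)
      fix y
      obtain k0 where "W y < real k0" using reals_Archimedean2 by blast
      then show "eventually (\<lambda>k. (if real k < W y then W y else 0) = 0) sequentially"
        by (intro eventually_sequentiallyI[of k0]) auto
    qed
    show "AE y in lebesgue. norm (if real k < W y then W y else 0) \<le> W y" for k
      using W0 by (intro AE_I2) auto
  qed auto
  then have "eventually (\<lambda>k. (LINT y|lebesgue. (if real k < W y then W y else 0)) < e) sequentially"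
    using e by (intro order_tendstoD) auto
  then obtain k where k: "(LINT y|lebesgue. (if real k < W y then W y else 0)) < e"
    by (auto simp: eventually_sequentially)
  have ik: "integrable lebesgue (\<lambda>y. if real k < W y then W y else 0)"
    by (rule Bochner_Integration.integrable_bound[OF W]) (use W0 in auto)
  have "((\<lambda>r. real k * (\<beta> * r ^ DIM('a))) \<longlongrightarrow> real k * (\<beta> * 0 ^ DIM('a))) (at_right 0)"
    by (intro tendsto_intros)
  from order_tendstoD(2)[OF this, of e] have "eventually (\<lambda>r. real k * (\<beta> * r ^ DIM('a)) < e) (at_right 0)"
    using e by (simp add: power_0_left)
  then obtain b where b: "0 < b" "\<And>r. 0 < r \<Longrightarrow> r < b \<Longrightarrow> real k * (\<beta> * r ^ DIM('a)) < e"
    unfolding eventually_at_right_field by auto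
  define r where "r = min (b / 2) (1 / 2)"
  have r: "0 < r" "r < b" "r < 1" using b(1) by (auto simp: r_def)
  show thesis
  proof (rule that[OF r(1)])
    fix x :: 'a assume x: "norm x \<le> R"
    have sub: "ball x r \<subseteq> ball 0 (\<bar>R\<bar> + 1)"
    proof
      fix z :: 'a assume "z \<in> ball x r"
      then show "z \<in> ball 0 (\<bar>R\<bar> + 1)" using x r(3) norm_triangle_sub[of z x] by (simp add: dist_norm norm_minus_commute)
    qed
    have "(LINT y:ball x r|lebesgue. \<bar>V y\<bar> powr p) \<le> (LINT y|lebesgue. real k * indicat_real (ball x r) y + (if real k < W y then W y else 0))"
      unfolding set_lebesgue_integral_def
    proof (intro integral_mono Lq_loc_integrable_ball[OF L p(2,3), unfolded set_integrable_def] Bochner_Integration.integrable_add ik integrable_mult_right)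
      show "integrable lebesgue (indicat_real (ball x r))"
        using emeasure_lborel_ball_finite[of x r] by (auto intro!: integrable_real_indicator)
      show "indicat_real (ball x r) y *\<^sub>R (\<bar>V y\<bar> powr p) \<le> real k * indicat_real (ball x r) y + (if real k < W y then W y else 0)" for y
        using sub W0[of y] by (cases "y \<in> ball x r") (auto simp: W_def subset_iff)
    qed
    also have "\<dots> = real k * (LINT y|lebesgue. indicat_real (ball x r) y) + (LINT y|lebesgue. (if real k < W y then W y else 0))"
      using ik emeasure_lborel_ball_finite[of x r] by (subst Bochner_Integration.integral_add) (auto intro!: integrable_real_indicator)
    also have "(LINT y|lebesgue. indicat_real (ball x r) y) = \<beta> * r ^ DIM('a)"
      using measure_lebesgue_ball[OF r(1), of x] by (simp add: \<beta>_def)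
    finally have W2: "(LINT y:ball x r|lebesgue. \<bar>V y\<bar> powr p) \<le> 2 * e" using k b(2)[OF r(1,2)] by simp
    define T where "T = l * r powr (-2)"
    have T: "0 < T" using l r by (simp add: T_def)
    have "(LINT y:ball x r|lebesgue. V y) \<le> T * (\<beta> * r ^ DIM('a)) + T powr (1 - p) * (LINT y:ball x r|lebesgue. \<bar>V y\<bar> powr p)"
      using Lq_loc_integral_ball_le[OF L nonneg p(1,3) T _ r(1), of 0 x] r(1) by (simp add: \<beta>_def set_lebesgue_integral_def)
    also have "\<dots> \<le> T * (\<beta> * r ^ DIM('a)) + T powr (1 - p) * (2 * e)"
      by (intro add_left_mono mult_left_mono W2) auto
    finally have "r powr (2 - ?n) * (LINT y:ball x r|lebesgue. V y) \<le> r powr (2 - ?n) * (T * (\<beta> * r ^ DIM('a)) + T powr (1 - p) * (2 * e))"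
      by (intro mult_left_mono) auto
    also have "\<dots> = l * \<beta> * (r powr (2 - ?n) * r powr (-2) * r powr ?n) + l powr (1 - p) * (2 * e) * (r powr (2 - ?n) * r powr (-2 * (1 - p)))"
    proof -
      have "T powr (1 - p) = l powr (1 - p) * r powr (-2 * (1 - p))"
        unfolding T_def using l by (subst powr_mult) (auto simp only: powr_powr)
      moreover have "r ^ DIM('a) = r powr ?n" using r(1) by (simp only: powr_realpow)
      ultimately show ?thesis by (simp only: T_def distrib_left mult_ac)
    qed
    also have "r powr (2 - ?n) * r powr (-2) * r powr ?n = 1" unfolding powr_add[symmetric] using r by simp
    also have "r powr (2 - ?n) * r powr (-2 * (1 - p)) = 1" unfolding powr_add[symmetric] using r by (simp add: p_def)
    also have "l * \<beta> * 1 + l powr (1 - p) * (2 * e) * 1 = 1" using \<beta> l by (simp add: l_def e_def)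
    finally show "ennreal r \<le> critical_radius V x"
      unfolding critical_radius_def using r(1) by (intro SUP_upper) auto
  qed
qed

section \<open>The vanishing condition for the maximal function\<close>

lemma maximal_op_add_le:
  fixes f g :: "'a::euclidean_space \<Rightarrow> 'b::{second_countable_topology,real_normed_vector}"
  assumes "f \<in> borel_measurable lebesgue" "g \<in> borel_measurable lebesgue"
  shows "maximal_op (\<lambda>x. f x + g x) x \<le> maximal_op f x + maximal_op g x"
proof (rule maximal_op_le)
  fix c r assume "x \<in> ball c r"
  then have "abs_avg c r f \<le> maximal_op f x" "abs_avg c r g \<le> maximal_op g x"
    by (simp_all add: abs_avg_le_maximal_op)
  moreover have "abs_avg c r (\<lambda>x. f x + g x) \<le> abs_avg c r f + abs_avg c r g"
    using assms by (intro abs_avg_add_le) (auto simp: norm_triangle_ineq)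
  ultimately show "abs_avg c r (\<lambda>x. f x + g x) \<le> maximal_op f x + maximal_op g x"
    by (meson add_mono order_trans)
qed

lemma large_avg_triangle:
  fixes f g h :: "'a::euclidean_space \<Rightarrow> 'b::{second_countable_topology,real_normed_vector}"
  assumes "g \<in> borel_measurable lebesgue" "h \<in> borel_measurable lebesgue"
    and "\<And>x. norm (f x) \<le> norm (g x) + norm (h x)"
  shows "large_avg c r f \<le> large_avg c r g + large_avg c r h"
proof (rule large_avg_le)
  fix d s assume "ball c r \<subseteq> ball d s"
  then have "abs_avg d s g \<le> large_avg c r g" "abs_avg d s h \<le> large_avg c r h"
    by (simp_all add: abs_avg_le_large_avg)
  moreover have "abs_avg d s f \<le> abs_avg d s g + abs_avg d s h"
    using assms by (intro abs_avg_add_le) auto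
  ultimately show "abs_avg d s f \<le> large_avg c r g + large_avg c r h"
    by (meson add_mono order_trans)
qed

lemma abs_avg_bounded_support_le:
  fixes g :: "'a::euclidean_space \<Rightarrow> 'b::real_normed_vector"
  assumes G: "\<And>x. norm (g x) \<le> G" and supp: "\<And>x. S \<le> norm x \<Longrightarrow> g x = 0" and S: "0 < S" and s: "0 < s"
  shows "abs_avg d s g \<le> ennreal (G * (S / s) ^ DIM('a))"
proof -
  have G0: "0 \<le> G" using G[of 0] norm_ge_zero[of "g 0"] by linarith
  have "(\<integral>\<^sup>+y\<in>ball d s. ennreal (norm (g y)) \<partial>lebesgue) \<le> (\<integral>\<^sup>+y. ennreal G * indicator (ball (0::'a) S) y \<partial>lebesgue)"
    using G supp by (intro nn_integral_mono) (auto simp: indicator_def ennreal_leI not_less)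
  also have "\<dots> = ennreal G * emeasure lebesgue (ball (0::'a) S)"
    by (simp add: nn_integral_cmult_indicator del: emeasure_completion)
  also have "\<dots> = ennreal (G * (S / s) ^ DIM('a)) * emeasure lebesgue (ball d s)"
    unfolding emeasure_lebesgue_ball[OF S] emeasure_lebesgue_ball[OF s]
    using G0 S s by (simp add: ennreal_mult[symmetric] power_divide)
  finally show ?thesis using s by (simp only: abs_avg_le_iff)
qed

text \<open>\<open>Mg\<close> is bounded everywhere and small outside a ball around the origin. A
  large ball dilutes this exceptional ball, and a moderate ball with distant centre misses
  it.\<close>

lemma maximal_op_bounded_support_vanishing:
  fixes g :: "'a::euclidean_space \<Rightarrow> 'b::real_normed_vector"
  assumes G: "\<And>x. norm (g x) \<le> G" and supp: "\<And>x. S \<le> norm x \<Longrightarrow> g x = 0" and S: "0 < S" and e: "0 < e"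
  obtains R where "0 < R" "\<And>c r. 0 < r \<Longrightarrow> R < norm c \<or> R < r \<Longrightarrow>
    (\<integral>\<^sup>+y\<in>ball c r. maximal_op g y \<partial>lebesgue) \<le> ennreal e * emeasure lebesgue (ball c r)"
proof -
  have G0: "0 \<le> G" using G[of 0] norm_ge_zero[of "g 0"] by linarith
  have Mle: "maximal_op g x \<le> ennreal G" for x
  proof (rule maximal_op_le)
    fix c r assume "x \<in> ball c r"
    then have "0 < r" by (rule radius_pos)
    then show "abs_avg c r g \<le> ennreal G" by (rule abs_avg_le_sup) (rule G)
  qed
  \<comment> \<open>A ball through \<open>x\<close> that meets the support has
    \<open>2 * s > norm x - S\<close>. The part \<open>3 * S\<close> of \<open>R1\<close> then gives
    \<open>S < s\<close>, which allows the power to be reduced to 1, and the part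
    \<open>4 * G * S / e\<close> gives \<open>G * S / s \<le> e / 2\<close>.\<close>
  define R1 where "R1 = 3 * S + 4 * G * S / e"
  have R1: "3 * S \<le> R1" "0 < R1" using S G0 e by (auto simp: R1_def add_pos_nonneg)
  have far: "maximal_op g x \<le> ennreal (e / 2)" if x: "R1 \<le> norm x" for x
  proof (rule maximal_op_le)
    fix d s assume xd: "x \<in> ball d s"
    then have s: "0 < s" by (rule radius_pos)
    show "abs_avg d s g \<le> ennreal (e / 2)"
    proof (cases "norm x - S < 2 * s")
      case True
      have "2 * S \<le> norm x - S" "4 * G * S / e \<le> norm x - S" using x R1 S by (auto simp: R1_def)
      then have "S < s" and "4 * G * S / e < 2 * s" using True S by linarith+
      then have *: "2 * G * S \<le> e * s" using e by (simp add: field_simps)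
      have "abs_avg d s g \<le> ennreal (G * (S / s) ^ DIM('a))" by (rule abs_avg_bounded_support_le[OF G supp S s])
      also have "\<dots> \<le> ennreal (G * (S / s) ^ 1)"
        using S s \<open>S < s\<close> G0 by (intro ennreal_leI mult_left_mono power_decreasing) auto
      also have "\<dots> \<le> ennreal (e / 2)"
        using * s by (intro ennreal_leI) (simp add: field_simps)
      finally show ?thesis .
    next
      case False
      have "abs_avg d s g \<le> ennreal 0"
      proof (rule abs_avg_le_sup[OF s])
        fix z assume "z \<in> ball d s"
        then have "dist x z < 2 * s" using xd dist_triangle[of x z d] by (auto simp: dist_commute)
        then have "S \<le> norm z" using False norm_triangle_sub[of x z] by (simp add: dist_norm)
        then show "norm (g z) \<le> 0" by (simp add: supp)
      qed
      then show ?thesis by simp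
    qed
  qed
  \<comment> \<open>The factor is chosen so that a ball of radius above \<open>R2\<close> has volume
    at least \<open>2 * G / e\<close> times that of \<open>ball 0 R1\<close>.\<close>
  define R2 where "R2 = R1 * (1 + 2 * G / e)"
  have R2: "0 < R2" using R1 G0 e by (auto simp: R2_def intro!: mult_pos_pos add_pos_nonneg)
  show thesis
  proof (rule that[of "R1 + R2"])
    show "0 < R1 + R2" using R1 R2 by simp
    fix c :: 'a and r :: real assume r: "0 < r" and cr: "R1 + R2 < norm c \<or> R1 + R2 < r"
    show "(\<integral>\<^sup>+y\<in>ball c r. maximal_op g y \<partial>lebesgue) \<le> ennreal e * emeasure lebesgue (ball c r)"
    proof (cases "R2 < r")
      case True
      have "(\<integral>\<^sup>+y\<in>ball c r. maximal_op g y \<partial>lebesgue) \<le>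
          (\<integral>\<^sup>+y. ennreal (e / 2) * indicator (ball c r) y + ennreal G * indicator (ball 0 R1) y \<partial>lebesgue)"
      proof (intro nn_integral_mono)
        fix y
        show "maximal_op g y * indicator (ball c r) y \<le> ennreal (e / 2) * indicator (ball c r) y + ennreal G * indicator (ball 0 R1) y"
          using far[of y] Mle[of y] by (cases "R1 \<le> norm y") (auto simp: indicator_def intro: order_trans[OF Mle] add_increasing)
      qed
      also have "\<dots> = ennreal (e / 2) * emeasure lebesgue (ball c r) + ennreal G * emeasure lebesgue (ball (0::'a) R1)"
        by (subst nn_integral_add) (auto simp: nn_integral_cmult_indicator simp del: emeasure_completion)
      also have "ennreal G * emeasure lebesgue (ball (0::'a) R1) \<le> ennreal (e / 2) * emeasure lebesgue (ball c r)"
      proof -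
        define t where "t = 1 + 2 * G / e"
        have t: "1 \<le> t" "2 * G / e \<le> t" using G0 e by (auto simp: t_def)
        have "2 * G / e \<le> t ^ 1" using t by simp
        also have "\<dots> \<le> t ^ DIM('a)" using t by (intro power_increasing) auto
        finally have "2 * G / e * R1 ^ DIM('a) \<le> t ^ DIM('a) * R1 ^ DIM('a)" using R1 by (intro mult_right_mono) auto
        also have "\<dots> = R2 ^ DIM('a)" by (simp add: R2_def t_def power_mult_distrib)
        also have "\<dots> \<le> r ^ DIM('a)" using True R2 by (intro power_mono) auto
        finally have "G * R1 ^ DIM('a) \<le> e / 2 * r ^ DIM('a)" using e by (simp add: field_simps)
        then have "unit_ball_vol DIM('a) * (G * R1 ^ DIM('a)) \<le> unit_ball_vol DIM('a) * (e / 2 * r ^ DIM('a))"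
          by (intro mult_left_mono) auto
        then show ?thesis
          unfolding emeasure_lebesgue_ball[OF r] emeasure_lebesgue_ball[OF R1(2)]
          using G0 e r R1 by (simp add: ennreal_mult[symmetric] ennreal_leI mult_ac)
      qed
      finally have "(\<integral>\<^sup>+y\<in>ball c r. maximal_op g y \<partial>lebesgue) \<le> (ennreal (e / 2) + ennreal (e / 2)) * emeasure lebesgue (ball c r)"
        by (simp add: distrib_right add_left_mono del: emeasure_completion)
      also have "ennreal (e / 2) + ennreal (e / 2) = ennreal e" using e by (simp flip: ennreal_plus)
      finally show ?thesis .
    next
      case False
      then have c: "R1 + R2 < norm c" using cr R1 by auto
      have "(\<integral>\<^sup>+y\<in>ball c r. maximal_op g y \<partial>lebesgue) \<le> (\<integral>\<^sup>+y. ennreal e * indicator (ball c r) y \<partial>lebesgue)"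
      proof (intro nn_integral_mono)
        fix y
        show "maximal_op g y * indicator (ball c r) y \<le> ennreal e * indicator (ball c r) y"
        proof (cases "y \<in> ball c r")
          case True
          then have "R1 \<le> norm y" using c False norm_triangle_sub[of c y] by (simp add: dist_norm)
          then have "maximal_op g y \<le> ennreal (e / 2)" by (rule far)
          also have "\<dots> \<le> ennreal e" using e by (intro ennreal_leI) auto
          finally show ?thesis by (simp add: mult_right_mono)
        qed simp
      qed
      then show ?thesis by (simp add: nn_integral_cmult_indicator del: emeasure_completion)
    qed
  qed
qed

text \<open>The two copies of \<open>K\<close> come from \<open>Mg\<close> itself and from
  \<open>A\<^sub>B(g)\<close>, the price of replacing \<open>A\<^sub>B(w)\<close> by
  \<open>A\<^sub>B(g + w)\<close>. The latter is a constant below \<open>Mg\<close> on the ball,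
  hence below its mean.\<close>

lemma maximal_minus_large_avg_split:
  fixes g w :: "'a::euclidean_space \<Rightarrow> 'b::{second_countable_topology,real_normed_vector}"
  assumes g: "g \<in> borel_measurable lebesgue" and w: "w \<in> borel_measurable lebesgue" and r: "0 < r"
    and Mg: "(\<integral>\<^sup>+y\<in>ball c r. maximal_op g y \<partial>lebesgue) \<le> K * emeasure lebesgue (ball c r)"
    and Mw: "(\<integral>\<^sup>+y\<in>ball c r. (maximal_op w y - large_avg c r w) \<partial>lebesgue) \<le> L * emeasure lebesgue (ball c r)"
    and fin: "large_avg c r (\<lambda>x. g x + w x) < \<infinity>"
  shows "large_avg c r g \<le> K"
    and "(\<integral>\<^sup>+y\<in>ball c r. (maximal_op (\<lambda>x. g x + w x) y - large_avg c r (\<lambda>x. g x + w x)) \<partial>lebesgue)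
      \<le> (2 * K + L) * emeasure lebesgue (ball c r)"
proof -
  let ?f = "\<lambda>x. g x + w x" and ?v = "emeasure lebesgue (ball c r)"
  have "large_avg c r g * ?v = (\<integral>\<^sup>+y\<in>ball c r. large_avg c r g \<partial>lebesgue)"
    by (simp add: nn_integral_cmult_indicator del: emeasure_completion)
  also have "\<dots> \<le> (\<integral>\<^sup>+y\<in>ball c r. maximal_op g y \<partial>lebesgue)"
    by (intro nn_integral_mono) (auto simp: indicator_def large_avg_le_maximal_op)
  finally have Ag: "large_avg c r g * ?v \<le> (\<integral>\<^sup>+y\<in>ball c r. maximal_op g y \<partial>lebesgue)" .
  from order_trans[OF this Mg] show "large_avg c r g \<le> K"
    using emeasure_lebesgue_ball_pos[OF r, of c]
    by (simp only: ennreal_mult_le_mult_iff mult.commute[of _ ?v] not_False_eq_True)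
  have pt: "maximal_op ?f y - large_avg c r ?f \<le> maximal_op g y + large_avg c r g + (maximal_op w y - large_avg c r w)"
    if y: "y \<in> ball c r" for y
  proof -
    let ?D = "maximal_op w y - large_avg c r w"
    have 1: "maximal_op w y \<le> large_avg c r w + ?D"
      by (rule ennreal_le_add_diff)
    have 2: "large_avg c r w \<le> large_avg c r ?f + large_avg c r g"
    proof (rule large_avg_triangle)
      show "norm (w x) \<le> norm (?f x) + norm (g x)" for x
        using norm_triangle_ineq4[of "?f x" "g x"] by simp
    qed (use g w in auto)
    have "maximal_op ?f y \<le> maximal_op g y + maximal_op w y" by (rule maximal_op_add_le[OF g w])
    also have "\<dots> \<le> maximal_op g y + (large_avg c r ?f + large_avg c r g + ?D)"
      by (intro add_left_mono order_trans[OF 1] add_right_mono 2)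
    also have "\<dots> = large_avg c r ?f + (maximal_op g y + large_avg c r g + ?D)"
      by (simp only: ac_simps)
    finally have "maximal_op ?f y \<le> large_avg c r ?f + (maximal_op g y + large_avg c r g + ?D)" .
    then show ?thesis using fin by (auto simp: ennreal_minus_le_iff)
  qed
  have "(\<integral>\<^sup>+y\<in>ball c r. (maximal_op ?f y - large_avg c r ?f) \<partial>lebesgue) \<le>
      (\<integral>\<^sup>+y. maximal_op g y * indicator (ball c r) y + large_avg c r g * indicator (ball c r) y
        + (maximal_op w y - large_avg c r w) * indicator (ball c r) y \<partial>lebesgue)"
    using pt by (intro nn_integral_mono) (auto simp: indicator_def)
  also have "\<dots> = (\<integral>\<^sup>+y\<in>ball c r. maximal_op g y \<partial>lebesgue) + large_avg c r g * ?v
      + (\<integral>\<^sup>+y\<in>ball c r. (maximal_op w y - large_avg c r w) \<partial>lebesgue)"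
    by (simp add: nn_integral_add nn_integral_cmult_indicator del: emeasure_completion)
  also have "\<dots> \<le> K * ?v + K * ?v + L * ?v"
    by (intro add_mono Mg Mw order_trans[OF Ag Mg])
  also have "\<dots> = (2 * K + L) * ?v" by (simp add: distrib_right mult_2 del: emeasure_completion)
  finally show "(\<integral>\<^sup>+y\<in>ball c r. (maximal_op ?f y - large_avg c r ?f) \<partial>lebesgue) \<le> (2 * K + L) * ?v" .
qed

text \<open>A single \<open>R\<close> bounds distant centres and large radii from below and,
  inverted, small radii from above. The condition persists when \<open>R\<close> grows, so
  \<open>R\<close> may be chosen beyond any prescribed number.\<close>

definition vanishing :: "('a::euclidean_space \<Rightarrow> real) \<Rightarrow> ('a \<Rightarrow> 'b::real_normed_vector) \<Rightarrow> bool"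
  where "vanishing V F \<longleftrightarrow> (\<forall>e>0. \<exists>R>0. \<forall>c r. 0 < r \<longrightarrow> R < norm c \<or> R < r \<or> r < 1 / R \<longrightarrow>
    osc_le c r F e \<and> (critical_radius V c \<le> ennreal r \<longrightarrow> abs_avg c r F \<le> ennreal e))"

text \<open>At small scales the large balls are compared using that a ball of radius \<open>s \<ge> R\<close> loses only
  the factor \<open>(1 + 2 r / s)\<^sup>n\<close> when it is enlarged to contain a ball of radius \<open>r\<close> it meets.\<close>

lemma maximal_minus_large_avg_small_scale:
  fixes f :: "'a::euclidean_space \<Rightarrow> 'b::{second_countable_topology,real_normed_vector}"
  assumes f: "f \<in> borel_measurable lebesgue" and N: "0 < N" and R: "0 < R"
    and osc: "\<And>c r. 0 < r \<Longrightarrow> r \<le> 3 * R \<Longrightarrow> osc_le c r f N"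
    and fin: "\<And>c r. 0 < r \<Longrightarrow> large_avg c r f < \<infinity>" and B: "0 \<le> B"
  obtains r0 where "0 < r0" "r0 \<le> R" "\<And>c r. norm c \<le> B \<Longrightarrow> 0 < r \<Longrightarrow> r < r0 \<Longrightarrow>
    (\<integral>\<^sup>+y\<in>ball c r. (maximal_op f y - large_avg c r f) \<partial>lebesgue)
    \<le> ennreal (8 * 60 ^ DIM('a) * N) * emeasure lebesgue (ball c r)"
proof -
  obtain K0 where K0: "large_avg 0 R f = ennreal K0" "0 \<le> K0"
    using fin[OF R, of 0] by (cases "large_avg 0 R f" rule: ennreal_cases) auto
  define K where "K = (B / R + 2) ^ DIM('a) * K0"
  have K: "0 \<le> K" using B R K0 by (simp add: K_def)
  \<comment> \<open>The ball \<open>ball 0 (B + 2 * t)\<close> contains both \<open>ball d t\<close>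
    and \<open>ball 0 R\<close>, and its radius is at most \<open>B / R + 2\<close> times
    \<open>t\<close>. Hence one finite number bounds the averages over all balls of radius at least
    \<open>R\<close> that meet the bounded region.\<close>
  have big: "abs_avg d t f \<le> ennreal K" if "R \<le> t" "c \<in> ball d t" "norm c \<le> B" for c d t
  proof -
    have t: "0 < t" using that R by simp
    have "ball d t \<subseteq> ball 0 (B + 2 * t)"
    proof
      fix z assume "z \<in> ball d t"
      then show "z \<in> ball 0 (B + 2 * t)"
        using that dist_triangle[of 0 z c] dist_triangle[of c z d] by (auto simp: dist_commute)
    qed
    then have "abs_avg d t f \<le> ennreal (((B + 2 * t) / t) ^ DIM('a)) * abs_avg 0 (B + 2 * t) f"
      using t B by (intro abs_avg_mono_ball) auto
    also have "\<dots> \<le> ennreal ((B / R + 2) ^ DIM('a)) * large_avg 0 R f"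
    proof (intro mult_mono ennreal_leI power_mono abs_avg_le_large_avg)
      have "B / t \<le> B / R" using that R B by (intro divide_left_mono) auto
      then show "(B + 2 * t) / t \<le> B / R + 2" using t by (simp add: add_divide_distrib)
    qed (use that t B R in auto)
    also have "\<dots> = ennreal K" using K0 B R by (simp add: K_def ennreal_mult)
    finally show ?thesis .
  qed
  \<comment> \<open>Since the averages are bounded by \<open>K\<close>, a volume ratio close to 1
    turns into an additive error below \<open>N\<close>; this fixes how small \<open>r\<close> must
    be.\<close>
  have "((\<lambda>r. ((1 + 2 * r / R) ^ DIM('a) - 1) * K) \<longlongrightarrow> ((1 + 2 * 0 / R) ^ DIM('a) - 1) * K) (at_right 0)"
    using R by (intro tendsto_intros) auto
  from order_tendstoD(2)[OF this, of N] have "eventually (\<lambda>r. ((1 + 2 * r / R) ^ DIM('a) - 1) * K < N) (at_right 0)"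
    using N by simp
  then obtain b where b: "0 < b" "\<And>r. 0 < r \<Longrightarrow> r < b \<Longrightarrow> ((1 + 2 * r / R) ^ DIM('a) - 1) * K < N"
    unfolding eventually_at_right_field by auto
  show thesis
  proof (rule that[of "min b R"])
    fix c :: 'a and r assume c: "norm c \<le> B" and r: "0 < r" "r < min b R"
    have large: "abs_avg d s f \<le> large_avg c r f + ennreal (2 * 60 ^ DIM('a) * N)"
      if y: "y \<in> ball c r" "y \<in> ball d s" and s: "r < s" for y d s
    proof -
      have cd: "dist c d < r + s" using y dist_triangle[of c d y] by (simp add: dist_commute)
      have sub: "ball c r \<subseteq> ball d (s + 2 * r)"
      proof
        fix z assume "z \<in> ball c r"
        then show "z \<in> ball d (s + 2 * r)" using cd dist_triangle[of d z c] by (simp add: dist_commute)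
      qed
      show ?thesis
      proof (cases "s \<le> R")
        case True
        have "abs_avg d s f \<le> abs_avg d (s + 2 * r) f + ennreal ((1 + ((s + 2 * r) / s) ^ DIM('a)) * N)"
          using r s N True by (intro abs_avg_ball_compare(1)[OF f _ _ _ osc]) auto
        also have "\<dots> \<le> large_avg c r f + ennreal (2 * 60 ^ DIM('a) * N)"
        proof (intro add_mono abs_avg_le_large_avg ennreal_leI mult_right_mono)
          have "((s + 2 * r) / s) ^ DIM('a) \<le> 3 ^ DIM('a)"
            using r s by (intro power_mono) (auto simp: field_simps)
          then have "1 + ((s + 2 * r) / s) ^ DIM('a) \<le> 60 ^ DIM('a)"
            using two_add_3_power_le[of "DIM('a)"] by simp
          also have "(60::real) ^ DIM('a) \<le> 2 * 60 ^ DIM('a)" by simp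
          finally show "1 + ((s + 2 * r) / s) ^ DIM('a) \<le> 2 * 60 ^ DIM('a)" .
        qed (use r s N sub in auto)
        finally show ?thesis .
      next
        case False
        have s0: "0 < s" using r s by simp
        have "abs_avg d (s + 2 * r) f \<le> ennreal K"
          using False r c cd by (intro big[of _ c]) (auto simp: dist_commute)
        then obtain A where A: "abs_avg d (s + 2 * r) f = ennreal A" "0 \<le> A" "A \<le> K"
          using K by (cases "abs_avg d (s + 2 * r) f" rule: ennreal_cases) (auto simp: top_unique)
        have "abs_avg d s f \<le> ennreal (((s + 2 * r) / s) ^ DIM('a)) * abs_avg d (s + 2 * r) f"
          using s0 r by (intro abs_avg_mono_ball) auto
        also have "\<dots> \<le> ennreal ((1 + 2 * r / R) ^ DIM('a) * A)"
        proof -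
          have "2 * r / s \<le> 2 * r / R" using False r R by (intro divide_left_mono) auto
          then have "(s + 2 * r) / s \<le> 1 + 2 * r / R" using s0 by (simp add: add_divide_distrib)
          then have "((s + 2 * r) / s) ^ DIM('a) \<le> (1 + 2 * r / R) ^ DIM('a)"
            using s0 r by (intro power_mono) auto
          then show ?thesis using A s0 r
            by (simp add: ennreal_mult[symmetric] ennreal_leI mult_right_mono)
        qed
        also have "(1 + 2 * r / R) ^ DIM('a) * A \<le> A + N"
        proof -
          have "1 \<le> (1 + 2 * r / R) ^ DIM('a)" using r R by (intro one_le_power) auto
          then have "((1 + 2 * r / R) ^ DIM('a) - 1) * A \<le> ((1 + 2 * r / R) ^ DIM('a) - 1) * K"
            using A by (intro mult_left_mono) auto
          also have "\<dots> \<le> N" using b(2)[of r] r by simp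
          finally show ?thesis by (simp add: algebra_simps)
        qed
        also have "ennreal (A + N) = abs_avg d (s + 2 * r) f + ennreal N" using A N by simp
        also have "\<dots> \<le> large_avg c r f + ennreal (2 * 60 ^ DIM('a) * N)"
        proof (intro add_mono abs_avg_le_large_avg sub ennreal_leI)
          have "1 * N \<le> 2 * 60 ^ DIM('a) * N"
          proof (rule mult_right_mono)
            have "(1::real) \<le> 60 ^ DIM('a)" by (intro one_le_power) auto
            then show "(1::real) \<le> 2 * 60 ^ DIM('a)" by linarith
          qed (use N in auto)
          then show "N \<le> 2 * 60 ^ DIM('a) * N" by simp
        qed
        finally show ?thesis by (simp add: ennreal_leI)
      qed
    qed
    have "(\<integral>\<^sup>+y\<in>ball c r. (maximal_op f y - large_avg c r f) \<partial>lebesgue)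
      \<le> ennreal (6 * 60 ^ DIM('a) * N + 2 * 60 ^ DIM('a) * N) * emeasure lebesgue (ball c r)"
      using N r by (intro maximal_minus_large_avg_integral[OF f N osc _ _ _ fin large]) auto
    also have "6 * 60 ^ DIM('a) * N + 2 * 60 ^ DIM('a) * N = 8 * 60 ^ DIM('a) * N" by simp
    finally show "(\<integral>\<^sup>+y\<in>ball c r. (maximal_op f y - large_avg c r f) \<partial>lebesgue)
      \<le> ennreal (8 * 60 ^ DIM('a) * N) * emeasure lebesgue (ball c r)" .
  qed (use b R in auto)
qed

lemma compact_support_uniform_osc:
  fixes g :: "'a::euclidean_space \<Rightarrow> 'b::real_normed_vector"
  assumes g: "continuous_on UNIV g" and supp: "\<And>x. S \<le> norm x \<Longrightarrow> g x = 0" and e: "0 < e"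
  obtains d where "0 < d" "\<And>x y. dist x y < d \<Longrightarrow> dist (g x) (g y) < e"
proof -
  have "uniformly_continuous_on (cball 0 (S + 1)) g"
    by (intro compact_uniformly_continuous continuous_on_subset[OF g]) auto
  then obtain d where d: "0 < d" "\<And>x y. x \<in> cball 0 (S + 1) \<Longrightarrow> y \<in> cball 0 (S + 1) \<Longrightarrow> dist x y < d \<Longrightarrow> dist (g x) (g y) < e"
    using e unfolding uniformly_continuous_on_def by (metis dist_commute)
  show thesis
  proof (rule that[of "min d 1"])
    fix x y :: 'a assume xy: "dist x y < min d 1"
    show "dist (g x) (g y) < e"
    proof (cases "S \<le> norm x \<and> S \<le> norm y")
      case True
      then show ?thesis using supp e by simp
    next
      case False
      then have "norm x \<le> S + 1 \<and> norm y \<le> S + 1"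
        using xy norm_triangle_sub[of x y] norm_triangle_sub[of y x] by (auto simp: dist_norm norm_minus_commute)
      then show ?thesis using d(2)[of x y] xy by auto
    qed
  qed (use d in auto)
qed

lemma real_maximal_vanishing:
  fixes f :: "'a::euclidean_space \<Rightarrow> 'b::{second_countable_topology,real_normed_vector}"
  assumes f: "f \<in> borel_measurable lebesgue" "bmo_le V f N" "0 < N"
    and approx: "\<And>e. 0 < e \<Longrightarrow> \<exists>g S. continuous_on UNIV g \<and> (\<forall>x. S \<le> norm x \<longrightarrow> g x = 0) \<and> bmo_le V (\<lambda>x. f x - g x) e"
    and fin: "\<And>c. critical_radius V c < \<infinity>"
    and loc: "\<And>B. \<exists>r>0. \<forall>x. norm x \<le> B \<longrightarrow> ennreal r \<le> critical_radius V x"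
  shows "vanishing V (real_maximal f)"
  unfolding vanishing_def
proof (intro allI impI)
  fix e :: real assume e: "0 < e"
  define P where "P = (60::real) ^ DIM('a)"
  have P: "1 \<le> P" unfolding P_def by (intro one_le_power) auto
  \<comment> \<open>At small scales the bound is \<open>8 * P\<close> times the oscillation
    \<open>2 * \<delta>\<close> of \<open>f\<close>, which is exactly \<open>e\<close>; elsewhere
    the errors add up to at most \<open>3 * \<delta> + 8 * P * \<delta>\<close>, which is
    less.\<close>
  define \<delta> where "\<delta> = e / (16 * P)"
  have \<delta>: "0 < \<delta>" using e P by (simp add: \<delta>_def)
  have e16: "e = 16 * P * \<delta>" using P by (simp add: \<delta>_def)
  have PD: "\<delta> \<le> P * \<delta>" using P \<delta> by simp
  obtain g S0 where g: "continuous_on UNIV g" "\<And>x. S0 \<le> norm x \<Longrightarrow> g x = 0" "bmo_le V (\<lambda>x. f x - g x) \<delta>"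
    using approx[OF \<delta>] by blast
  define S where "S = max S0 1"
  have S: "0 < S" "\<And>x. S \<le> norm x \<Longrightarrow> g x = 0" using g(2) by (auto simp: S_def)
  have gm: "g \<in> borel_measurable lebesgue" using borel_measurable_continuous_onI[OF g(1)] by (intro measurable_completion) simp
  define w where "w x = f x - g x" for x
  have wm: "w \<in> borel_measurable lebesgue" unfolding w_def[abs_def] using f(1) gm by simp
  have w: "bmo_le V w \<delta>" using g(3) by (simp add: w_def[abs_def])
  have fgw: "(\<lambda>x. g x + w x) = f" by (simp add: w_def)
  have "compact (g ` cball 0 S)" by (intro compact_continuous_image continuous_on_subset[OF g(1)]) auto
  then obtain G where "\<forall>y\<in>g ` cball 0 S. norm y \<le> G" using compact_imp_bounded bounded_iff by blast
  then have G: "norm (g x) \<le> max G 0" for x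
    using S(2)[of x] by (cases "S \<le> norm x") (auto simp: max.coboundedI1)
  obtain R1 where R1: "0 < R1" "\<And>c r. 0 < r \<Longrightarrow> R1 < norm c \<or> R1 < r \<Longrightarrow>
    (\<integral>\<^sup>+y\<in>ball c r. maximal_op g y \<partial>lebesgue) \<le> ennreal \<delta> * emeasure lebesgue (ball c r)"
    using maximal_op_bounded_support_vanishing[where g = g, OF G S(2,1) \<delta>] by blast
  \<comment> \<open>Small balls near the origin will have radius below \<open>r1\<close>, hence
    below the critical radius, so that for them the clause on averages is void.\<close>
  obtain r1 where r1: "0 < r1" "\<And>x. norm x \<le> R1 \<Longrightarrow> ennreal r1 \<le> critical_radius V x"
    using loc[of R1] by blast
  obtain d where d: "0 < d" "\<And>x y. dist x y < d \<Longrightarrow> dist (g x) (g y) < \<delta>"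
    by (rule compact_support_uniform_osc[OF g(1,2) \<delta>]) blast+
  \<comment> \<open>At radii up to \<open>d = 3 * R0\<close> the oscillation of \<open>g\<close> is
    at most \<open>\<delta>\<close> by uniform continuity, and that of \<open>w\<close> by its
    norm.\<close>
  define R0 where "R0 = d / 3"
  have R0: "0 < R0" using d by (simp add: R0_def)
  have osc: "osc_le c r f (2 * \<delta>)" if r: "0 < r" "r \<le> 3 * R0" for c r
  proof -
    have "abs_avg c r (\<lambda>x. g x - g c) \<le> ennreal \<delta>"
    proof (rule abs_avg_le_sup[OF r(1)])
      fix x assume "x \<in> ball c r"
      then have "dist x c < d" using r by (simp add: R0_def dist_commute)
      from d(2)[OF this] show "norm (g x - g c) \<le> \<delta>" by (simp add: dist_norm)
    qed
    then have "osc_le c r g \<delta>" unfolding osc_le_def by blast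
    from osc_le_add[OF gm this _ wm bmo_leD(1)[OF w r(1)]] \<delta> show ?thesis by (simp add: fgw)
  qed
  have fin': "large_avg c r f < \<infinity>" if "0 < r" for c r
    using f(3) that by (intro large_avg_finite[OF f(1,2)] fin) auto
  have AE: "AE x in lebesgue. maximal_op f x < \<infinity>" by (rule maximal_op_AE_finite[OF f fin])
  obtain r2 where r2: "0 < r2" "\<And>c r. norm c \<le> R1 \<Longrightarrow> 0 < r \<Longrightarrow> r < r2 \<Longrightarrow>
    (\<integral>\<^sup>+y\<in>ball c r. (maximal_op f y - large_avg c r f) \<partial>lebesgue)
    \<le> ennreal (8 * 60 ^ DIM('a) * (2 * \<delta>)) * emeasure lebesgue (ball c r)"
  proof -
    have "0 < 2 * \<delta>" "0 \<le> R1" using \<delta> R1 by auto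
    from maximal_minus_large_avg_small_scale[OF f(1) this(1) R0 osc fin' this(2)] that show thesis by blast
  qed
  define R where "R = R1 + 1 / min r1 r2"
  have R: "0 < R" "R1 < R" using R1 r1 r2 by (auto simp: R_def add_pos_pos)
  have Rr: "1 / R < min r1 r2"
  proof -
    have "1 / min r1 r2 < R" using R1 by (simp add: R_def)
    then have "1 / R < 1 / (1 / min r1 r2)" using r1 r2 R by (intro divide_strict_left_mono) auto
    then show ?thesis by simp
  qed
  show "\<exists>R>0. \<forall>c r. 0 < r \<longrightarrow> R < norm c \<or> R < r \<or> r < 1 / R \<longrightarrow>
    osc_le c r (real_maximal f) e \<and> (critical_radius V c \<le> ennreal r \<longrightarrow> abs_avg c r (real_maximal f) \<le> ennreal e)"
  proof (intro exI[of _ R] conjI allI R(1) impI)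
    fix c :: 'a and r :: real assume r: "0 < r" and cr: "R < norm c \<or> R < r \<or> r < 1 / R"
    have main: "osc_le c r (real_maximal f) e \<and> (critical_radius V c \<le> ennreal r \<longrightarrow> abs_avg c r (real_maximal f) \<le> ennreal e)"
    proof (cases "R1 < norm c \<or> R1 < r")
      case True
      have fw: "large_avg c r w < \<infinity>"
        using \<delta> r by (intro large_avg_finite[OF wm w] fin) auto
      note iw = maximal_minus_large_avg_integral_bmo[OF wm \<delta> bmo_leD(1)[OF w] r fw]
      have ff: "large_avg c r (\<lambda>x. g x + w x) < \<infinity>" using fin'[OF r] by (simp add: fgw)
      note sp = maximal_minus_large_avg_split[OF gm wm r R1(2)[OF r True] iw ff, unfolded fgw]
      have eq: "2 * ennreal \<delta> + ennreal (7 * 60 ^ DIM('a) * \<delta>) = ennreal (2 * \<delta> + 7 * P * \<delta>)"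
        using \<delta> P by (simp add: P_def ennreal_mult'')
      note sp2 = sp(2)[unfolded eq]
      have "osc_le c r (real_maximal f) (2 * \<delta> + 7 * P * \<delta>)"
        unfolding osc_le_def using abs_avg_real_maximal_minus_large_avg[OF r fin'[OF r] AE sp2] by blast
      then have 1: "osc_le c r (real_maximal f) e"
        by (rule osc_le_mono) (use e16 PD \<delta> in simp)
      have "abs_avg c r (real_maximal f) \<le> ennreal e" if cr': "critical_radius V c \<le> ennreal r"
      proof -
        have "large_avg c r f \<le> large_avg c r g + large_avg c r w"
          using gm wm by (rule large_avg_triangle) (simp add: fgw[symmetric] norm_triangle_ineq)
        also have "\<dots> \<le> ennreal \<delta> + ennreal (2 ^ DIM('a) * \<delta>)"
          using \<delta> by (intro add_mono sp(1) large_avg_le_of_critical[OF w _ r cr']) auto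
        also have "\<dots> \<le> ennreal (\<delta> + P * \<delta>)"
        proof -
          have "(2::real) ^ DIM('a) \<le> P" unfolding P_def by (intro power_mono) auto
          then show ?thesis using \<delta> by (simp add: ennreal_leI mult_right_mono flip: ennreal_plus)
        qed
        finally have "large_avg c r f \<le> ennreal (\<delta> + P * \<delta>)" .
        moreover have "abs_avg c r (real_maximal f) \<le> large_avg c r f + ennreal (2 * \<delta> + 7 * P * \<delta>)"
          by (rule abs_avg_real_maximal_le[OF r sp2])
        ultimately have "abs_avg c r (real_maximal f) \<le> ennreal (\<delta> + P * \<delta>) + ennreal (2 * \<delta> + 7 * P * \<delta>)"
          by (meson add_right_mono order_trans)
        also have "\<dots> = ennreal (\<delta> + P * \<delta> + (2 * \<delta> + 7 * P * \<delta>))" using \<delta> P by (intro ennreal_plus[symmetric]) auto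
        also have "\<dots> \<le> ennreal e" by (intro ennreal_leI) (use e16 PD \<delta> in simp)
        finally show ?thesis .
      qed
      with 1 show ?thesis by blast
    next
      case False
      then have rs: "r < min r1 r2" and c: "norm c \<le> R1" using cr R Rr by auto
      have "(\<integral>\<^sup>+y\<in>ball c r. (maximal_op f y - large_avg c r f) \<partial>lebesgue) \<le> ennreal e * emeasure lebesgue (ball c r)"
        using r2(2)[OF c r] rs by (simp add: e16 P_def mult_ac del: emeasure_completion)
      then have "osc_le c r (real_maximal f) e"
        unfolding osc_le_def using abs_avg_real_maximal_minus_large_avg[OF r fin'[OF r] AE] by blast
      moreover have "ennreal r < critical_radius V c"
      proof -
        have "ennreal r < ennreal r1" using rs r by (intro ennreal_lessI) auto
        then show ?thesis using r1(2)[OF c] by (rule less_le_trans)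
      qed
      ultimately show ?thesis by (simp add: not_le[symmetric])
    qed
    then show "osc_le c r (real_maximal f) e" by simp
    show "abs_avg c r (real_maximal f) \<le> ennreal e" if "critical_radius V c \<le> ennreal r" using main that by simp
  qed
qed

section \<open>Approximation by continuous functions with compact support\<close>

text \<open>If centres converge, the indicator functions of the balls converge off the limiting
  sphere, a null set; dominated convergence does the rest.\<close>

lemma continuous_on_ball_avg:
  fixes F :: "'a::euclidean_space \<Rightarrow> real"
  assumes int: "\<And>c r. set_integrable lebesgue (ball c r) F" and \<eta>: "0 < \<eta>"
  shows "continuous_on UNIV (\<lambda>x. ball_avg x \<eta> F)"
proof -
  have F: "F \<in> borel_measurable lebesgue"
  proof (rule borel_measurable_LIMSEQ_real)
    show "(\<lambda>k. indicat_real (ball 0 (real k)) x *\<^sub>R F x) \<longlonglongrightarrow> F x" for x :: 'a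
    proof (rule tendsto_eventually)
      obtain k0 where "norm x < real k0" using reals_Archimedean2 by blast
      then show "eventually (\<lambda>k. indicat_real (ball 0 (real k)) x *\<^sub>R F x = F x) sequentially"
        by (intro eventually_sequentiallyI[of k0]) auto
    qed
    show "(\<lambda>x. indicat_real (ball 0 (real k)) x *\<^sub>R F x) \<in> borel_measurable lebesgue" for k
      using int[of 0 "real k"] unfolding set_integrable_def by (rule borel_measurable_integrable)
  qed
  have "continuous (at x) (\<lambda>x. LINT y:ball x \<eta>|lebesgue. F y)" for x
    unfolding continuous_at_sequentially comp_def
  proof (intro allI impI)
    fix X :: "nat \<Rightarrow> 'a" assume X: "X \<longlonglongrightarrow> x"
    obtain B where B: "\<And>k. norm (X k) \<le> B"
      using convergent_imp_bounded[OF X] unfolding bounded_iff by auto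
    show "(\<lambda>k. LINT y:ball (X k) \<eta>|lebesgue. F y) \<longlonglongrightarrow> (LINT y:ball x \<eta>|lebesgue. F y)"
      unfolding set_lebesgue_integral_def
    proof (rule integral_dominated_convergence[where w = "\<lambda>y. norm (indicat_real (ball 0 (B + \<eta>)) y *\<^sub>R F y)"])
      show "integrable lebesgue (\<lambda>y. norm (indicat_real (ball 0 (B + \<eta>)) y *\<^sub>R F y))"
        using int[of 0 "B + \<eta>"] unfolding set_integrable_def by (rule integrable_norm)
      show "AE y in lebesgue. norm (indicat_real (ball (X k) \<eta>) y *\<^sub>R F y) \<le> norm (indicat_real (ball 0 (B + \<eta>)) y *\<^sub>R F y)" for k
      proof (intro AE_I2)
        fix y
        have "y \<in> ball 0 (B + \<eta>)" if "y \<in> ball (X k) \<eta>"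
          using that B[of k] norm_triangle_sub[of y "X k"] by (simp add: dist_norm norm_minus_commute)
        then show "norm (indicat_real (ball (X k) \<eta>) y *\<^sub>R F y) \<le> norm (indicat_real (ball 0 (B + \<eta>)) y *\<^sub>R F y)"
          by (cases "y \<in> ball (X k) \<eta>") (auto simp: indicator_def)
      qed
      have "AE y in lebesgue. y \<notin> sphere x \<eta>"
        using negligible_sphere[of x \<eta>] by (intro AE_not_in) (simp add: negligible_iff_null_sets)
      then show "AE y in lebesgue. (\<lambda>k. indicat_real (ball (X k) \<eta>) y *\<^sub>R F y) \<longlonglongrightarrow> indicat_real (ball x \<eta>) y *\<^sub>R F y"
      proof eventually_elim
        fix y assume y: "y \<notin> sphere x \<eta>"
        have lim: "(\<lambda>k. dist (X k) y) \<longlonglongrightarrow> dist x y" by (intro tendsto_intros X)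
        have "eventually (\<lambda>k. (y \<in> ball (X k) \<eta>) = (y \<in> ball x \<eta>)) sequentially"
        proof (cases "dist x y < \<eta>")
          case True
          from order_tendstoD(2)[OF lim True] show ?thesis by eventually_elim (use True in auto)
        next
          case False
          then have "\<eta> < dist x y" using y by (auto simp: sphere_def)
          from order_tendstoD(1)[OF lim this] show ?thesis by eventually_elim (use False in auto)
        qed
        then show "(\<lambda>k. indicat_real (ball (X k) \<eta>) y *\<^sub>R F y) \<longlonglongrightarrow> indicat_real (ball x \<eta>) y *\<^sub>R F y"
          by (intro tendsto_eventually) (auto elim!: eventually_mono simp: indicator_def)
      qed
    qed (use F in \<open>auto intro!: borel_measurable_scaleR borel_measurable_indicator\<close>)
  qed
  then have "continuous_on UNIV (\<lambda>x. LINT y:ball x \<eta>|lebesgue. F y)"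
    by (simp add: continuous_on_eq_continuous_at)
  then have "continuous_on UNIV (\<lambda>x. (LINT y:ball x \<eta>|lebesgue. F y) /\<^sub>R (unit_ball_vol DIM('a) * \<eta> ^ DIM('a)))"
    by (intro continuous_intros)
  then show ?thesis unfolding ball_avg_def measure_lebesgue_ball[OF \<eta>] .
qed

text \<open>Vitali balls of radius \<open>\<eta> / 5\<close> are disjoint, lie in
  \<open>ball c (2 * r)\<close>, and their fivefold dilates cover \<open>ball c r\<close>; the
  factor is \<open>5^n\<close> times \<open>2^n\<close>.\<close>

lemma abs_avg_le_of_small_balls:
  fixes h :: "'a::euclidean_space \<Rightarrow> 'b::{second_countable_topology,real_normed_vector}"
  assumes h: "h \<in> borel_measurable lebesgue" and \<eta>: "0 < \<eta>" "\<eta> \<le> r"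
    and small: "\<And>y. abs_avg y \<eta> h \<le> ennreal k" and k: "0 \<le> k"
  shows "abs_avg c r h \<le> ennreal (10 ^ DIM('a) * k)"
proof -
  have r: "0 < r" using \<eta> by simp
  have "ball c r \<subseteq> (\<Union>y\<in>ball c r. ball y (\<eta> / 5))" using \<eta> by force
  then obtain C where C: "countable C" "C \<subseteq> ball c r"
     "pairwise (\<lambda>i j. disjnt (ball i (\<eta> / 5)) (ball j (\<eta> / 5))) C"
     "ball c r \<subseteq> (\<Union>i\<in>C. ball i (5 * (\<eta> / 5)))"
    by (rule Vitali_covering_lemma_balls[of "ball c r" "\<lambda>y. y" "\<lambda>_. \<eta> / 5" "ball c r" \<eta>]) (use \<eta> in auto)
  have df: "disjoint_family_on (\<lambda>i. ball i (\<eta> / 5)) C"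
    using C(3) by (auto simp: disjoint_family_on_def pairwise_def disjnt_def)
  have "(\<integral>\<^sup>+y\<in>ball c r. ennreal (norm (h y)) \<partial>lebesgue) \<le> (\<integral>\<^sup>+i. (\<integral>\<^sup>+y\<in>ball i \<eta>. ennreal (norm (h y)) \<partial>lebesgue) \<partial>count_space C)"
    using C h by (intro set_nn_integral_le_countable_cover) auto
  also have "\<dots> \<le> (\<integral>\<^sup>+i. ennreal (k * 5 ^ DIM('a)) * emeasure lebesgue (ball i (\<eta> / 5)) \<partial>count_space C)"
  proof (intro nn_integral_mono)
    fix i
    have "(\<integral>\<^sup>+y\<in>ball i \<eta>. ennreal (norm (h y)) \<partial>lebesgue) \<le> ennreal k * emeasure lebesgue (ball i (5 * (\<eta> / 5)))"
      using small[of i] \<eta> by (simp add: abs_avg_le_iff del: emeasure_completion)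
    also have "\<dots> = ennreal (k * 5 ^ DIM('a)) * emeasure lebesgue (ball i (\<eta> / 5))"
      using \<eta> k by (subst emeasure_lebesgue_ball_scale[of 5 "\<eta> / 5" i i]) (auto simp: ennreal_mult_mult_eq simp del: emeasure_completion)
    finally show "(\<integral>\<^sup>+y\<in>ball i \<eta>. ennreal (norm (h y)) \<partial>lebesgue) \<le> ennreal (k * 5 ^ DIM('a)) * emeasure lebesgue (ball i (\<eta> / 5))" .
  qed
  also have "\<dots> = ennreal (k * 5 ^ DIM('a)) * (\<integral>\<^sup>+i. emeasure lebesgue (ball i (\<eta> / 5)) \<partial>count_space C)"
    by (rule nn_integral_cmult) simp
  also have "(\<integral>\<^sup>+i. emeasure lebesgue (ball i (\<eta> / 5)) \<partial>count_space C) = emeasure lebesgue (\<Union>i\<in>C. ball i (\<eta> / 5))"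
    using C(1) df by (intro emeasure_UN_countable[symmetric]) auto
  also have "\<dots> \<le> emeasure lebesgue (ball c (2 * r))"
  proof (intro emeasure_mono)
    show "(\<Union>i\<in>C. ball i (\<eta> / 5)) \<subseteq> ball c (2 * r)"
    proof
      fix z assume "z \<in> (\<Union>i\<in>C. ball i (\<eta> / 5))"
      then obtain i where "i \<in> ball c r" "z \<in> ball i (\<eta> / 5)" using C by blast
      then show "z \<in> ball c (2 * r)" using \<eta> dist_triangle[of c z i] by simp
    qed
  qed simp
  also have "\<dots> = ennreal (2 ^ DIM('a)) * emeasure lebesgue (ball c r)" using r by (intro emeasure_lebesgue_ball_scale) auto
  finally have "(\<integral>\<^sup>+y\<in>ball c r. ennreal (norm (h y)) \<partial>lebesgue) \<le> ennreal (k * 5 ^ DIM('a)) * (ennreal (2 ^ DIM('a)) * emeasure lebesgue (ball c r))"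
    by (simp add: mult_left_mono del: emeasure_completion)
  also have "\<dots> = ennreal (k * 5 ^ DIM('a) * 2 ^ DIM('a)) * emeasure lebesgue (ball c r)"
    using k by (intro ennreal_mult_mult_eq) auto
  also have "k * 5 ^ DIM('a) * 2 ^ DIM('a) = (5 * 2) ^ DIM('a) * k"
    by (simp only: power_mult_distrib mult_ac)
  also have "(5 * 2 :: real) = 10" by simp
  finally show ?thesis using r by (simp only: abs_avg_le_iff)
qed

text \<open>On balls of radius at most \<open>\<eta>\<close> the averages stay close to one
  constant, as all balls involved lie in a ball of radius \<open>2 * \<eta>\<close>. Larger balls
  are covered by balls of radius \<open>\<eta>\<close>, on which the error is small in mean, not
  just in oscillation. Thus fine scales control the error at every scale.\<close>

lemma ball_avg_error:
  fixes F :: "'a::euclidean_space \<Rightarrow> real"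
  assumes F: "F \<in> borel_measurable lebesgue" and \<eta>: "0 < \<eta>" and e: "0 \<le> e"
    and T: "(\<lambda>x. ball_avg x \<eta> F) \<in> borel_measurable lebesgue"
    and osc: "\<And>c r. 0 < r \<Longrightarrow> r \<le> 2 * \<eta> \<Longrightarrow> osc_le c r F e"
    and avg: "\<And>c r. 0 < r \<Longrightarrow> r \<le> 2 * \<eta> \<Longrightarrow> critical_radius V c \<le> ennreal r \<Longrightarrow> abs_avg c r F \<le> ennreal e"
  shows "bmo_le V (\<lambda>x. F x - ball_avg x \<eta> F) (2 * 20 ^ DIM('a) * e)"
proof -
  let ?T = "\<lambda>x. ball_avg x \<eta> F" and ?C = "2 * 20 ^ DIM('a) :: real"
  have C: "1 + 2 ^ DIM('a) \<le> ?C" "2 * 2 ^ DIM('a) * 10 ^ DIM('a) = ?C" "2 * 2 ^ DIM('a) \<le> ?C"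
  proof -
    have "(2::real) ^ DIM('a) \<le> 20 ^ DIM('a)" by (intro power_mono) auto
    moreover have "(1::real) \<le> 20 ^ DIM('a)" by (intro one_le_power) auto
    ultimately show "1 + 2 ^ DIM('a) \<le> ?C" "2 * 2 ^ DIM('a) \<le> ?C" by linarith+
    have "(20::real) ^ DIM('a) = (2 * 10) ^ DIM('a)" by simp
    then show "2 * 2 ^ DIM('a) * 10 ^ DIM('a) = ?C" unfolding power_mult_distrib by simp
  qed
  have near: "abs_avg c r (\<lambda>x. ?T x - a) \<le> ennreal (2 ^ DIM('a) * e)"
    if r: "0 < r" "r \<le> \<eta>" and a: "abs_avg c (2 * \<eta>) (\<lambda>x. F x - a) \<le> ennreal e" for c a r
  proof (rule abs_avg_le_sup[OF r(1)], rule norm_ball_avg_minus_le[OF F \<eta>])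
    fix x assume x: "x \<in> ball c r"
    have "ball x \<eta> \<subseteq> ball c (2 * \<eta>)"
    proof
      fix z assume "z \<in> ball x \<eta>"
      then show "z \<in> ball c (2 * \<eta>)" using x r dist_triangle[of c z x] by simp
    qed
    then have "abs_avg x \<eta> (\<lambda>y. F y - a) \<le> ennreal ((2 * \<eta> / \<eta>) ^ DIM('a)) * abs_avg c (2 * \<eta>) (\<lambda>y. F y - a)"
      using \<eta> by (intro abs_avg_mono_ball) auto
    also have "\<dots> \<le> ennreal (2 ^ DIM('a)) * ennreal e" using \<eta> a by (intro mult_mono) auto
    finally show "abs_avg x \<eta> (\<lambda>y. F y - a) \<le> ennreal (2 ^ DIM('a) * e)" using e by (simp add: ennreal_mult)
  qed (use e in auto)
  have loc: "abs_avg y \<eta> (\<lambda>x. F x - ?T x) \<le> ennreal (2 * 2 ^ DIM('a) * e)" for y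
  proof -
    obtain a where a: "abs_avg y (2 * \<eta>) (\<lambda>x. F x - a) \<le> ennreal e" using osc[of "2 * \<eta>" y] \<eta> by (auto elim: osc_leE)
    have "abs_avg y \<eta> (\<lambda>x. F x - a) \<le> ennreal ((2 * \<eta> / \<eta>) ^ DIM('a)) * abs_avg y (2 * \<eta>) (\<lambda>x. F x - a)"
      using \<eta> by (intro abs_avg_mono_ball) auto
    also have "\<dots> \<le> ennreal (2 ^ DIM('a)) * ennreal e" using \<eta> a by (intro mult_mono) auto
    finally have 1: "abs_avg y \<eta> (\<lambda>x. F x - a) \<le> ennreal (2 ^ DIM('a) * e)" using e by (simp add: ennreal_mult)
    have "abs_avg y \<eta> (\<lambda>x. F x - ?T x) \<le> abs_avg y \<eta> (\<lambda>x. F x - a) + abs_avg y \<eta> (\<lambda>x. ?T x - a)"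
      using F T by (intro abs_avg_add_le) auto
    also have "\<dots> \<le> ennreal (2 ^ DIM('a) * e) + ennreal (2 ^ DIM('a) * e)"
      using \<eta> by (intro add_mono 1 near a) auto
    also have "\<dots> = ennreal (2 * 2 ^ DIM('a) * e)" using e by (simp flip: ennreal_plus)
    finally show ?thesis .
  qed
  have large: "abs_avg c r (\<lambda>x. F x - ?T x) \<le> ennreal (?C * e)" if r: "\<eta> \<le> r" for c r
  proof -
    have "abs_avg c r (\<lambda>x. F x - ?T x) \<le> ennreal (10 ^ DIM('a) * (2 * 2 ^ DIM('a) * e))"
      using F T e by (intro abs_avg_le_of_small_balls[OF _ \<eta> r loc]) auto
    also have "10 ^ DIM('a) * (2 * 2 ^ DIM('a) * e) = (2 * 2 ^ DIM('a) * 10 ^ DIM('a)) * e" by simp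
    finally show ?thesis unfolding C(2) .
  qed
  show ?thesis
    unfolding bmo_le_def
  proof (intro allI impI conjI)
    fix c :: 'a and r :: real assume r: "0 < r"
    show "osc_le c r (\<lambda>x. F x - ?T x) (?C * e)"
    proof (cases "\<eta> \<le> r")
      case True
      then show ?thesis by (intro osc_le_of_abs_avg large)
    next
      case False
      obtain a where a: "abs_avg c (2 * \<eta>) (\<lambda>x. F x - a) \<le> ennreal e" using osc[of "2 * \<eta>" c] \<eta> by (auto elim: osc_leE)
      obtain b where b: "abs_avg c r (\<lambda>x. F x - b) \<le> ennreal e" using osc[of r c] r False by (auto elim: osc_leE)
      have "abs_avg c r (\<lambda>x. F x - ?T x - (b - a)) \<le> abs_avg c r (\<lambda>x. F x - b) + abs_avg c r (\<lambda>x. ?T x - a)"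
        using F T by (intro abs_avg_add_le) auto
      also have "\<dots> \<le> ennreal e + ennreal (2 ^ DIM('a) * e)"
        using False r by (intro add_mono b near a) auto
      also have "\<dots> = ennreal ((1 + 2 ^ DIM('a)) * e)" using e by (simp add: distrib_right)
      also have "\<dots> \<le> ennreal (?C * e)" using C e by (intro ennreal_leI mult_right_mono) auto
      finally show ?thesis unfolding osc_le_def by blast
    qed
    assume cr: "critical_radius V c \<le> ennreal r"
    show "abs_avg c r (\<lambda>x. F x - ?T x) \<le> ennreal (?C * e)"
    proof (cases "\<eta> \<le> r")
      case True
      then show ?thesis by (intro large)
    next
      case False
      have "critical_radius V c \<le> ennreal (2 * \<eta>)"
        using cr by (rule order_trans) (use False r in \<open>auto intro: ennreal_leI\<close>)
      then have "abs_avg c (2 * \<eta>) F \<le> ennreal e" using \<eta> by (intro avg) auto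
      then have "abs_avg c (2 * \<eta>) (\<lambda>x. F x - 0) \<le> ennreal e" by simp
      from near[OF r _ this] have 1: "abs_avg c r ?T \<le> ennreal (2 ^ DIM('a) * e)" using False by simp
      have "abs_avg c r (\<lambda>x. F x - ?T x) \<le> abs_avg c r F + abs_avg c r ?T"
        using F T by (intro abs_avg_add_le) auto
      also have "\<dots> \<le> ennreal e + ennreal (2 ^ DIM('a) * e)"
        using False r cr by (intro add_mono avg 1) auto
      also have "\<dots> = ennreal ((1 + 2 ^ DIM('a)) * e)" using e by (simp add: distrib_right)
      also have "\<dots> \<le> ennreal (?C * e)" using C e by (intro ennreal_leI mult_right_mono) auto
      finally show ?thesis .
    qed
  qed
qed

section \<open>Growth of averages at infinity\<close>

lemma vanishingE:
  assumes "vanishing V F" "0 < e"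
  obtains R where "L \<le> R" "0 < R"
    "\<And>c r. 0 < r \<Longrightarrow> R < norm c \<or> R < r \<or> r < 1 / R \<Longrightarrow> osc_le c r F e"
    "\<And>c r. 0 < r \<Longrightarrow> R < norm c \<or> R < r \<or> r < 1 / R \<Longrightarrow> critical_radius V c \<le> ennreal r \<Longrightarrow> abs_avg c r F \<le> ennreal e"
proof -
  obtain R where R: "0 < R" "\<And>c r. 0 < r \<Longrightarrow> R < norm c \<or> R < r \<or> r < 1 / R \<Longrightarrow>
      osc_le c r F e \<and> (critical_radius V c \<le> ennreal r \<longrightarrow> abs_avg c r F \<le> ennreal e)"
    using assms unfolding vanishing_def by blast
  have "1 / max R L \<le> 1 / R" using R(1) by (intro divide_left_mono) auto
  then have "R < norm c \<or> R < r \<or> r < 1 / R" if "max R L < norm c \<or> max R L < r \<or> r < 1 / max R L" for r and c :: 'a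
    using that by auto
  then show thesis using R by (intro that[of "max R L"]) auto
qed

text \<open>Telescoping over \<open>k\<close> doublings of the radius, each costing
  \<open>(1 + 2^n) * N\<close>.\<close>

lemma abs_avg_dyadic_le:
  fixes F :: "'a::euclidean_space \<Rightarrow> 'b::{second_countable_topology,real_normed_vector}"
  assumes F: "F \<in> borel_measurable lebesgue" and s: "0 < s" and N: "0 \<le> N"
    and osc: "\<And>r. 0 < r \<Longrightarrow> osc_le x r F N"
  shows "abs_avg x s F \<le> abs_avg x (2 ^ k * s) F + ennreal (real k * ((1 + 2 ^ DIM('a)) * N))"
proof (induction k)
  case (Suc k)
  let ?t = "2 ^ k * s"
  have t: "0 < ?t" using s by simp
  have "abs_avg x ?t F \<le> abs_avg x (2 * ?t) F + ennreal ((1 + (2 * ?t / ?t) ^ DIM('a)) * N)"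
    using t N by (intro abs_avg_ball_compare(1)[OF F t _ _ osc]) auto
  also have "2 * ?t / ?t = 2" using s by simp
  finally have "abs_avg x s F \<le> abs_avg x (2 * ?t) F + ennreal ((1 + 2 ^ DIM('a)) * N) + ennreal (real k * ((1 + 2 ^ DIM('a)) * N))"
    using Suc by (meson add_right_mono order_trans)
  also have "\<dots> = abs_avg x (2 ^ Suc k * s) F + ennreal (real (Suc k) * ((1 + 2 ^ DIM('a)) * N))"
  proof -
    have "real (Suc k) * ((1 + 2 ^ DIM('a)) * N) = (1 + 2 ^ DIM('a)) * N + real k * ((1 + 2 ^ DIM('a)) * N)"
      by (simp add: algebra_simps)
    then have "ennreal (real (Suc k) * ((1 + 2 ^ DIM('a)) * N)) = ennreal ((1 + 2 ^ DIM('a)) * N) + ennreal (real k * ((1 + 2 ^ DIM('a)) * N))"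
      using N by (simp only: ennreal_plus mult_nonneg_nonneg add_nonneg_nonneg of_nat_0_le_iff zero_le_power zero_le_numeral zero_le_one)
    then show ?thesis by (simp add: add.assoc mult.assoc)
  qed
  finally show ?case .
qed simp

lemma abs_avg_eq_ball_avg:
  fixes F :: "'a::euclidean_space \<Rightarrow> real"
  assumes r: "0 < r" and F: "\<And>x. 0 \<le> F x" and int: "set_integrable lebesgue (ball c r) F"
  shows "abs_avg c r F = ennreal (ball_avg c r F)" "0 \<le> ball_avg c r F"
proof -
  have nn: "0 \<le> (LINT y:ball c r|lebesgue. F y)"
    unfolding set_lebesgue_integral_def by (intro Bochner_Integration.integral_nonneg) (simp add: F)
  then show "0 \<le> ball_avg c r F" unfolding ball_avg_def using r by (simp add: measure_nonneg)
  have "ennreal (LINT y:ball c r|lebesgue. F y) = (\<integral>\<^sup>+y. ennreal (indicat_real (ball c r) y *\<^sub>R F y) \<partial>lebesgue)"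
    unfolding set_lebesgue_integral_def using int F
    by (intro nn_integral_eq_integral[symmetric]) (auto simp: set_integrable_def)
  also have "\<dots> = (\<integral>\<^sup>+y\<in>ball c r. ennreal (norm (F y)) \<partial>lebesgue)"
    using F by (intro nn_integral_cong) (auto simp: indicator_def)
  finally have eq: "(\<integral>\<^sup>+y\<in>ball c r. ennreal (norm (F y)) \<partial>lebesgue) = ennreal (LINT y:ball c r|lebesgue. F y)" by simp
  have pos: "0 < unit_ball_vol (real DIM('a)) * r ^ DIM('a)" using r by simp
  show "abs_avg c r F = ennreal (ball_avg c r F)"
    unfolding abs_avg_def eq ball_avg_def emeasure_lebesgue_ball[OF r] measure_lebesgue_ball[OF r]
    using nn pos by (simp add: divide_ennreal divide_inverse mult.commute)
qed

text \<open>Dyadic doubling up to the critical radius bounds averages over balls of a fixed radius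
  by a small multiple of \<open>ln (norm x)\<close> at infinity.\<close>

lemma vanishing_ball_avg_le_ln:
  fixes F :: "'a::euclidean_space \<Rightarrow> real"
  assumes F: "F \<in> borel_measurable lebesgue" and van: "vanishing V F"
    and rho: "\<And>x. critical_radius V x \<le> ennreal (2 * norm x + 2 * S)" and S: "0 < S"
    and \<eta>: "0 < \<eta>" and e: "0 < e" and R: "0 < R"
  obtains Z where "0 < Z" "\<And>x. Z \<le> norm x \<Longrightarrow> abs_avg x \<eta> F \<le> ennreal (e * ln (norm x / R))"
proof -
  \<comment> \<open>With this \<open>N\<close> each doubling costs exactly
    \<open>e / 4\<close>.\<close>
  define N where "N = e / (4 * (1 + 2 ^ DIM('a)))"
  have p: "(0::real) < 1 + 2 ^ DIM('a)" by (intro add_pos_pos) auto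
  have N: "0 < N" using e p by (simp add: N_def)
  have Ne: "(1 + 2 ^ DIM('a)) * N = e / 4" 
  proof -
    have "p * (e / (4 * p)) = e / 4" if "0 < p" for p :: real using that by simp
    from this[OF p] show ?thesis by (simp only: N_def)
  qed
  obtain R1 where R1: "0 < R1"
    "\<And>c r. 0 < r \<Longrightarrow> R1 < norm c \<or> R1 < r \<or> r < 1 / R1 \<Longrightarrow> osc_le c r F N"
    "\<And>c r. 0 < r \<Longrightarrow> R1 < norm c \<or> R1 < r \<or> r < 1 / R1 \<Longrightarrow> critical_radius V c \<le> ennreal r \<Longrightarrow> abs_avg c r F \<le> ennreal N"
    using vanishingE[OF van N] by metis
  \<comment> \<open>Beyond \<open>Z\<close> the oscillations are controlled (\<open>R1\<close>),
    \<open>2 * norm x + 2 * S\<close> is at most \<open>4 * norm x\<close> (\<open>S\<close>), the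
    number of doublings is nonnegative (\<open>\<eta>\<close>), and
    \<open>4 * norm x / \<eta>\<close>, even multiplied by \<open>exp 1 \<le> 3\<close>, is at most
    \<open>(norm x / R)^2\<close>; hence the 12.\<close>
  define Z where "Z = max (max (R1 + 1) S) (max \<eta> (12 * R\<^sup>2 / \<eta>))"
  have Z: "R1 < Z" "S \<le> Z" "\<eta> \<le> Z" "12 * R\<^sup>2 / \<eta> \<le> Z" "0 < Z" using R1(1) by (auto simp: Z_def less_max_iff_disj)
  show thesis
  proof (rule that[OF Z(5)])
    fix x :: 'a assume x: "Z \<le> norm x"
    define X where "X = norm x"
    have X: "R1 < X" "S \<le> X" "\<eta> \<le> X" "12 * R\<^sup>2 / \<eta> \<le> X" "0 < X" using x Z by (auto simp: X_def)
    \<comment> \<open>Doubling \<open>\<eta>\<close> about \<open>L\<close> times reaches the radius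
      \<open>4 * X\<close>, which dominates the critical radius at \<open>x\<close>.\<close>
    define L where "L = log 2 (4 * X / \<eta>)"
    have L0: "0 \<le> L" using X \<eta> by (simp add: L_def)
    define k where "k = nat \<lceil>L\<rceil>"
    have k: "L \<le> real k" "real k \<le> L + 1" using L0 by (auto simp: k_def)
    have "4 * X / \<eta> = 2 powr L" using X \<eta> by (simp add: L_def)
    also have "\<dots> \<le> 2 powr real k" using k by (intro powr_mono) auto
    also have "\<dots> = 2 ^ k" by (simp add: powr_realpow)
    finally have k2: "4 * X \<le> 2 ^ k * \<eta>" using \<eta> by (simp add: field_simps)
    have "critical_radius V x \<le> ennreal (2 ^ k * \<eta>)"
      using k2 X by (intro order_trans[OF rho] ennreal_leI) (simp add: X_def)
    then have 1: "abs_avg x (2 ^ k * \<eta>) F \<le> ennreal N" using \<eta> X by (intro R1(3)) (auto simp: X_def)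
    have "abs_avg x \<eta> F \<le> abs_avg x (2 ^ k * \<eta>) F + ennreal (real k * ((1 + 2 ^ DIM('a)) * N))"
      using N X by (intro abs_avg_dyadic_le[OF F \<eta>] R1(2)) (auto simp: X_def)
    also have "\<dots> \<le> ennreal N + ennreal (real k * ((1 + 2 ^ DIM('a)) * N))" by (intro add_right_mono 1)
    also have "\<dots> = ennreal (N + real k * (e / 4))" using N e by (simp add: Ne)
    also have "\<dots> \<le> ennreal (e * ln (X / R))"
    proof (rule ennreal_leI)
      have "1 * N \<le> (1 + 2 ^ DIM('a)) * N" using N by (intro mult_right_mono) auto
      then have "N \<le> e / 4" by (simp add: Ne)
      moreover have "real k * (e / 4) \<le> (L + 1) * (e / 4)" using k e by (intro mult_right_mono) auto
      ultimately have "N + real k * (e / 4) \<le> (L + 2) * (e / 4)" by (simp add: algebra_simps)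
      also have "\<dots> \<le> (2 * ln (4 * X / \<eta>) + 2) * (e / 4)"
      proof (intro mult_right_mono add_right_mono)
        have "ln 2 * (2::real) \<ge> 1" using ln2_ge_two_thirds by simp
        moreover have "0 \<le> ln (4 * X / \<eta>)" using X \<eta> by (intro ln_ge_zero) (simp add: field_simps)
        ultimately have "ln (4 * X / \<eta>) * 1 \<le> ln (4 * X / \<eta>) * (ln 2 * 2)" by (intro mult_left_mono)
        then show "L \<le> 2 * ln (4 * X / \<eta>)" by (simp add: L_def log_def field_simps)
      qed (use e in auto)
      also have "\<dots> = (e / 2) * (ln (4 * X / \<eta>) + 1)" by (simp add: algebra_simps)
      also have "\<dots> \<le> (e / 2) * (2 * ln (X / R))"
      proof (intro mult_left_mono)
        have "ln (4 * X / \<eta>) + 1 = ln (4 * X / \<eta> * exp 1)" using X \<eta> by (subst ln_mult) auto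
        also have "\<dots> \<le> ln ((X / R)\<^sup>2)"
        proof (rule ln_mono)
          have "4 * X / \<eta> * exp 1 \<le> 4 * X / \<eta> * 3" using X \<eta> exp_le by (intro mult_left_mono) auto
          also have "\<dots> = 12 * R\<^sup>2 / \<eta> * (X / R\<^sup>2)" using R by simp
          also have "\<dots> \<le> X * (X / R\<^sup>2)" using X R by (intro mult_right_mono) auto
          finally show "4 * X / \<eta> * exp 1 \<le> (X / R)\<^sup>2" by (simp add: power2_eq_square)
        qed (use X \<eta> R in auto)
        also have "\<dots> = 2 * ln (X / R)" using X R by (simp add: ln_realpow)
        finally show "ln (4 * X / \<eta>) + 1 \<le> 2 * ln (X / R)" .
      qed (use e in auto)
      finally show "N + real k * (e / 4) \<le> e * ln (X / R)" by simp
    qed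
    finally show "abs_avg x \<eta> F \<le> ennreal (e * ln (norm x / R))" by (simp add: X_def)
  qed
qed

lemma abs_diff_min_le: "\<bar>min x y - min a b\<bar> \<le> \<bar>x - a\<bar> + \<bar>y - b\<bar>" for x y a b :: real
  by linarith

text \<open>Truncating \<open>H\<close> at the slowly growing function \<open>\<psi> = e ln (max 1 (\<bar>x\<bar> / 2R))\<close>
  keeps the oscillations under control, since \<open>\<psi>\<close> is almost constant on balls that are small
  compared with the distance to the origin.\<close>

lemma bmo_le_min_ln:
  fixes H :: "'a::euclidean_space \<Rightarrow> real"
  assumes H: "H \<in> borel_measurable lebesgue" "\<And>x. 0 \<le> H x" and e: "0 \<le> e" "0 \<le> k" and R: "0 < R"
    and rho: "\<And>x. critical_radius V x \<le> ennreal (2 * norm x + 2 * R)"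
    and osc: "\<And>c r. 0 < r \<Longrightarrow> R < norm c \<or> R < r \<Longrightarrow> osc_le c r H k"
    and avg: "\<And>c r. 0 < r \<Longrightarrow> R < norm c \<or> R < r \<Longrightarrow> critical_radius V c \<le> ennreal r \<Longrightarrow> abs_avg c r H \<le> ennreal k"
  shows "bmo_le V (\<lambda>x. min (H x) (e * ln (max 1 (norm x / (2 * R))))) (8 ^ DIM('a) * k + e)"
proof -
  define \<psi> where "\<psi> x = e * ln (max 1 (norm x / (2 * R)))" for x :: 'a
  let ?m = "\<lambda>x. min (H x) (\<psi> x)" and ?K = "8 ^ DIM('a) * k + e"
  have \<psi>0: "0 \<le> \<psi> x" for x unfolding \<psi>_def using e by (intro mult_nonneg_nonneg ln_ge_zero) auto
  have K: "k \<le> 8 ^ DIM('a) * k" "0 \<le> 8 ^ DIM('a) * k"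
    using e mult_right_mono[of 1 "8 ^ DIM('a) :: real" k] by auto
  have mH: "abs_avg c r ?m \<le> abs_avg c r H" for c r
    using \<psi>0 H(2) by (intro abs_avg_mono) auto
  show ?thesis
    unfolding \<psi>_def[symmetric] bmo_le_def
  proof (intro allI impI)
    fix c :: 'a and r :: real assume r: "0 < r"
    have bound: "osc_le c r ?m ?K \<and> (critical_radius V c \<le> ennreal r \<longrightarrow> abs_avg c r ?m \<le> ennreal ?K)"
      if "abs_avg c r ?m \<le> ennreal ?K"
      using that osc_le_of_abs_avg by blast
    show "osc_le c r ?m ?K \<and> (critical_radius V c \<le> ennreal r \<longrightarrow> abs_avg c r ?m \<le> ennreal ?K)"
    proof (cases "R < norm c \<or> R < r")
      \<comment> \<open>Points of such a ball have norm at most \<open>2 * R\<close>, where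
        \<open>\<psi>\<close> vanishes, so the minimum is 0 however large \<open>H\<close> may be
        there.\<close>
      case False
      have "abs_avg c r ?m \<le> ennreal 0"
      proof (rule abs_avg_le_sup[OF r])
        fix x assume "x \<in> ball c r"
        then have "norm x \<le> 2 * R" using False norm_triangle_sub[of x c] by (simp add: dist_norm norm_minus_commute)
        then have "\<psi> x = 0" using R by (simp add: \<psi>_def max_def)
        then show "norm (?m x) \<le> 0" using H(2) by simp
      qed
      also have "\<dots> \<le> ennreal ?K" using K e by (intro ennreal_leI) auto
      finally show ?thesis by (rule bound)
    next
      case far: True
      show ?thesis
      proof (cases "critical_radius V c \<le> ennreal r")
        case True
        have "abs_avg c r ?m \<le> ennreal k" using mH avg[OF r far True] by (rule order_trans)
        also have "\<dots> \<le> ennreal ?K" using K e by (intro ennreal_leI) auto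
        finally show ?thesis by (rule bound)
      next
        case small: False
        show ?thesis
        \<comment> \<open>A ball that is large relative to the distance of its centre from the
          origin becomes supercritical when dilated by 8, because
          \<open>2 * norm c + 2 * R \<le> 8 * r\<close>; there the mean itself is small.\<close>
        proof (cases "norm c / 2 < r")
          case True
          have "2 * norm c + 2 * R \<le> 8 * r" using far True r by auto
          then have "critical_radius V c \<le> ennreal (8 * r)" by (intro order_trans[OF rho] ennreal_leI)
          then have 8: "abs_avg c (8 * r) H \<le> ennreal k" using r far by (intro avg) auto
          have "abs_avg c r ?m \<le> abs_avg c r H" by (rule mH)
          also have "\<dots> \<le> ennreal ((8 * r / r) ^ DIM('a)) * abs_avg c (8 * r) H"
            using r by (intro abs_avg_mono_ball) auto
          also have "\<dots> \<le> ennreal (8 ^ DIM('a)) * ennreal k" using r 8 by (intro mult_mono) auto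
          also have "\<dots> = ennreal (8 ^ DIM('a) * k)" using e by (simp add: ennreal_mult)
          also have "\<dots> \<le> ennreal ?K" using e by (intro ennreal_leI) auto
          finally show ?thesis by (rule bound)
        next
          case False
          then have c0: "0 < norm c" using r by linarith
          obtain a where a: "abs_avg c r (\<lambda>x. H x - a) \<le> ennreal k" using osc[OF r far] by (rule osc_leE)
          \<comment> \<open>Norms in the ball are within a factor 2 of \<open>norm c\<close>, so the
            logarithms differ by at most \<open>ln 2 < 1\<close>.\<close>
          have \<psi>c: "\<bar>\<psi> x - \<psi> c\<bar> \<le> e" if "x \<in> ball c r" for x
          proof -
            have n: "norm c \<le> 2 * norm x" "norm x \<le> 2 * norm c"
              using that False norm_triangle_sub[of x c] norm_triangle_sub[of c x] by (auto simp: dist_norm norm_minus_commute)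
            define A B where "A = max 1 (norm x / (2 * R))" and "B = max 1 (norm c / (2 * R))"
            have AB: "A \<le> 2 * B" "B \<le> 2 * A" "1 \<le> A" "1 \<le> B" using n R by (auto simp: A_def B_def max_def field_simps)
            have "ln A \<le> ln 2 + ln B" "ln B \<le> ln 2 + ln A"
              using AB ln_mono[of A "2 * B"] ln_mono[of B "2 * A"] by (auto simp: ln_mult)
            then have "\<bar>ln A - ln B\<bar> \<le> 1" using ln_2_less_1 by linarith
            then have "e * \<bar>ln A - ln B\<bar> \<le> e * 1" using e by (intro mult_left_mono) auto
            then show ?thesis using e by (simp add: \<psi>_def A_def[symmetric] B_def[symmetric] abs_mult right_diff_distrib[symmetric])
          qed
          have "abs_avg c r (\<lambda>x. ?m x - min a (\<psi> c)) \<le> abs_avg c r (\<lambda>x. H x - a) + abs_avg c r (\<lambda>_. e)"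
          proof (rule abs_avg_add_le)
            fix x assume "x \<in> ball c r"
            then show "norm (?m x - min a (\<psi> c)) \<le> norm (H x - a) + norm e"
              using \<psi>c[of x] abs_diff_min_le[of "H x" "\<psi> x" a "\<psi> c"] e by simp
          qed (use H in auto)
          also have "\<dots> \<le> ennreal k + ennreal e" using a e r by (intro add_mono) (auto simp: abs_avg_const)
          also have "\<dots> \<le> ennreal ?K" using e K by (simp add: ennreal_leI flip: ennreal_plus)
          finally show ?thesis using small unfolding osc_le_def by blast
        qed
      qed
    qed
  qed
qed

text \<open>The approximant is the positive part of \<open>H - \<psi>\<close>, with \<open>H\<close>
  the averages of \<open>F\<close> at a fixed small radius. Its support is bounded because
  \<open>H\<close> eventually falls below \<open>\<psi>\<close>, and the error is
  \<open>F - H\<close> plus the minimum of \<open>H\<close> and \<open>\<psi>\<close>, both small in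
  norm.\<close>

lemma vanishing_approx_compact_support:
  fixes F :: "'a::euclidean_space \<Rightarrow> real"
  assumes F: "F \<in> borel_measurable lebesgue" "\<And>x. 0 \<le> F x" and int: "\<And>c r. set_integrable lebesgue (ball c r) F"
    and van: "vanishing V F"
    and rho: "\<And>x. critical_radius V x \<le> ennreal (2 * norm x + 2 * S)" and S: "0 < S" and e: "0 < e"
  obtains h Z where "continuous_on UNIV h" "\<And>x. Z \<le> norm x \<Longrightarrow> h x = 0" "\<And>x. 0 \<le> h x"
    "bmo_le V (\<lambda>x. F x - h x) e"
proof -
  define D where "D = (2 * 20 ^ DIM('a) :: real)"
  have D: "0 < D" by (simp add: D_def)
  \<comment> \<open>\<open>Q * e1\<close> collects the errors: \<open>D * e1\<close> from averaging,
    and \<open>8^n * (1 + D) * e1\<close> and \<open>e1\<close> from the truncation.\<close>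
  define Q where "Q = D + 8 ^ DIM('a) * (1 + D) + 1"
  have Q: "0 < Q" using D by (auto simp: Q_def intro!: add_pos_pos mult_pos_pos)
  define e1 where "e1 = e / Q"
  have e1: "0 < e1" using e Q by (simp add: e1_def)
  obtain R where R: "S \<le> R" "0 < R"
    and osc: "\<And>c r. 0 < r \<Longrightarrow> R < norm c \<or> R < r \<or> r < 1 / R \<Longrightarrow> osc_le c r F e1"
    and avg: "\<And>c r. 0 < r \<Longrightarrow> R < norm c \<or> R < r \<or> r < 1 / R \<Longrightarrow> critical_radius V c \<le> ennreal r \<Longrightarrow> abs_avg c r F \<le> ennreal e1"
    using vanishingE[OF van e1, of S] by metis
  \<comment> \<open>The averaging error involves scales up to \<open>2 * \<eta>\<close>, and this
    choice puts them below \<open>1 / R\<close>.\<close>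
  define \<eta> where "\<eta> = 1 / (4 * R)"
  have \<eta>: "0 < \<eta>" "2 * \<eta> < 1 / R" using R by (auto simp: \<eta>_def field_simps)
  define H where "H x = ball_avg x \<eta> F" for x
  have Hc: "continuous_on UNIV H" unfolding H_def[abs_def] by (rule continuous_on_ball_avg[OF int \<eta>(1)])
  have Hm: "H \<in> borel_measurable lebesgue" using borel_measurable_continuous_onI[OF Hc] by (intro measurable_completion) simp
  have H0: "0 \<le> H x" and HA: "abs_avg x \<eta> F = ennreal (H x)" for x
    unfolding H_def using abs_avg_eq_ball_avg[OF \<eta>(1) F(2) int] by auto
  have err: "bmo_le V (\<lambda>x. F x - H x) (D * e1)"
    unfolding H_def D_def
  proof (rule ball_avg_error[OF F(1) \<eta>(1)])
    show "(\<lambda>x. ball_avg x \<eta> F) \<in> borel_measurable lebesgue" using Hm by (simp add: H_def[abs_def])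
  qed (use e1 \<eta> in \<open>auto intro!: osc avg\<close>)
  define k where "k = (1 + D) * e1"
  have k: "0 \<le> k" using D e1 by (simp add: k_def)
  have kk: "ennreal e1 + ennreal (D * e1) = ennreal k" using D e1 by (simp add: k_def distrib_right)
  have Hosc: "osc_le c r H k" if r: "0 < r" "R < norm c \<or> R < r" for c and r :: real
  proof -
    obtain a b where a: "abs_avg c r (\<lambda>x. F x - a) \<le> ennreal e1" and b: "abs_avg c r (\<lambda>x. F x - H x - b) \<le> ennreal (D * e1)"
      using osc[of r c] bmo_leD(1)[OF err, of r c] r unfolding osc_le_def by blast
    have "abs_avg c r (\<lambda>x. H x - (a - b)) \<le> abs_avg c r (\<lambda>x. F x - a) + abs_avg c r (\<lambda>x. F x - H x - b)"
      using F Hm by (intro abs_avg_add_le) auto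
    also have "\<dots> \<le> ennreal k" unfolding kk[symmetric] by (intro add_mono a b)
    finally show ?thesis unfolding osc_le_def by blast
  qed
  have Havg: "abs_avg c r H \<le> ennreal k" if "0 < r" "R < norm c \<or> R < r" "critical_radius V c \<le> ennreal r" for c r
  proof -
    have "abs_avg c r H \<le> abs_avg c r F + abs_avg c r (\<lambda>x. F x - H x)"
    proof (rule abs_avg_add_le)
      show "norm (H x) \<le> norm (F x) + norm (F x - H x)" for x
        unfolding real_norm_def by linarith
    qed (use F Hm in auto)
    also have "\<dots> \<le> ennreal k" unfolding kk[symmetric]
      using that by (intro add_mono avg bmo_leD(2)[OF err]) auto
    finally show ?thesis .
  qed
  define \<psi> where "\<psi> x = e1 * ln (max 1 (norm x / (2 * R)))" for x :: 'a
  have \<psi>0: "0 \<le> \<psi> x" for x unfolding \<psi>_def using e1 by (intro mult_nonneg_nonneg ln_ge_zero) auto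
  have "critical_radius V x \<le> ennreal (2 * norm x + 2 * R)" for x
    using R by (intro order_trans[OF rho] ennreal_leI) auto
  then have m: "bmo_le V (\<lambda>x. min (H x) (\<psi> x)) (8 ^ DIM('a) * k + e1)"
    unfolding \<psi>_def using e1 k R by (intro bmo_le_min_ln[OF Hm H0 _ k R(2) _ Hosc Havg]) auto
  have \<psi>c: "continuous_on UNIV \<psi>" unfolding \<psi>_def[abs_def]
    using R by (intro continuous_intros) (auto simp: max_def)
  have \<psi>m: "\<psi> \<in> borel_measurable lebesgue" using borel_measurable_continuous_onI[OF \<psi>c] by (intro measurable_completion) simp
  obtain Z where Z: "0 < Z" "\<And>x. Z \<le> norm x \<Longrightarrow> abs_avg x \<eta> F \<le> ennreal (e1 * ln (norm x / (2 * R)))"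
    using vanishing_ball_avg_le_ln[OF F(1) van rho S \<eta>(1) e1, of "2 * R"] R by auto
  show thesis
  proof (rule that[of "\<lambda>x. H x - min (H x) (\<psi> x)" "max Z (2 * R)"])
    show "continuous_on UNIV (\<lambda>x. H x - min (H x) (\<psi> x))" by (intro continuous_intros Hc \<psi>c)
    show "0 \<le> H x - min (H x) (\<psi> x)" for x by simp
    show "H x - min (H x) (\<psi> x) = 0" if "max Z (2 * R) \<le> norm x" for x
    proof -
      have 1: "1 \<le> norm x / (2 * R)" using that R by simp
      then have eq: "\<psi> x = e1 * ln (norm x / (2 * R))" by (simp add: \<psi>_def max_def)
      have "ennreal (H x) \<le> ennreal (\<psi> x)" using Z(2)[of x] that by (simp add: HA eq)
      then have "H x \<le> \<psi> x" using \<psi>0 by (simp add: ennreal_le_iff)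
      then show ?thesis by simp
    qed
    have "bmo_le V (\<lambda>x. (F x - H x) + min (H x) (\<psi> x)) (D * e1 + (8 ^ DIM('a) * k + e1))"
      using F Hm \<psi>m D e1 k by (intro bmo_le_add err m) auto
    moreover have "D * e1 + (8 ^ DIM('a) * k + e1) = e"
    proof -
      have "D * e1 + (8 ^ DIM('a) * k + e1) = Q * e1" by (simp add: k_def Q_def algebra_simps)
      then show ?thesis using Q by (simp add: e1_def)
    qed
    ultimately show "bmo_le V (\<lambda>x. F x - (H x - min (H x) (\<psi> x))) e" by (simp add: algebra_simps)
  qed
qed

section \<open>Approximation by smooth functions with compact support\<close>

text \<open>The powers of \<open>1 / t\<close> are carried along so that the span of the family is
  closed under differentiation; \<open>m = 0\<close> is the usual flat function.\<close>

definition flat_exp :: "nat \<Rightarrow> real \<Rightarrow> real"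
  where "flat_exp m t = (if 0 < t then exp (- 1 / t) / t ^ m else 0)"

lemma flat_exp_tendsto_0: "(flat_exp m \<longlongrightarrow> 0) (at 0)"
proof -
  have "((\<lambda>x. inverse x ^ m / exp (inverse x)) \<longlongrightarrow> (0::real)) (at_right 0)"
    by (rule filterlim_compose[OF tendsto_power_div_exp_0 filterlim_inverse_at_top_right])
  then have "(flat_exp m \<longlongrightarrow> 0) (at_right 0)"
  proof (rule Lim_transform_eventually)
    show "eventually (\<lambda>x. inverse x ^ m / exp (inverse x) = flat_exp m x) (at_right 0)"
      by (auto simp: eventually_at_filter flat_exp_def exp_minus divide_inverse power_inverse)
  qed
  moreover have "(flat_exp m \<longlongrightarrow> 0) (at_left 0)"
    by (rule tendsto_eventually) (auto simp: eventually_at_filter flat_exp_def)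
  ultimately show ?thesis by (simp add: filterlim_at_split)
qed

lemma flat_exp_has_derivative:
  "(flat_exp m has_real_derivative flat_exp (m + 2) t - real m * flat_exp (m + 1) t) (at t)"
proof -
  consider "t < 0" | "t = 0" | "0 < t" by linarith
  then show ?thesis
  proof cases
    case 1
    have "((\<lambda>_. 0) has_real_derivative 0) (at t)" by simp
    then have "(flat_exp m has_real_derivative 0) (at t)"
      by (rule has_field_derivative_transform_within_open[where S = "{..<0}"]) (use 1 in \<open>auto simp: flat_exp_def\<close>)
    with 1 show ?thesis by (simp add: flat_exp_def)
  next
    case 2
    \<comment> \<open>At the origin the difference quotient of \<open>flat_exp m\<close> is
      \<open>flat_exp (Suc m)\<close>, whose limit is 0.\<close>
    have "((\<lambda>s. (flat_exp m s - flat_exp m 0) / (s - 0)) \<longlongrightarrow> 0) (at 0)"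
      using flat_exp_tendsto_0[of "Suc m"]
    proof (rule Lim_transform_eventually)
      show "eventually (\<lambda>s. flat_exp (Suc m) s = (flat_exp m s - flat_exp m 0) / (s - 0)) (at 0)"
        by (auto simp: eventually_at_filter flat_exp_def mult.commute)
    qed
    with 2 show ?thesis by (simp add: has_field_derivative_iff flat_exp_def)
  next
    case 3
    have "((\<lambda>s. exp (- 1 / s) * inverse s ^ m) has_real_derivative
        flat_exp (m + 2) t - real m * flat_exp (m + 1) t) (at t)"
    proof -
      have "((\<lambda>s. exp (- inverse s) * inverse s ^ m) has_real_derivative
        exp (- inverse t) * (inverse t ^ Suc (Suc 0)) * inverse t ^ m
          + exp (- inverse t) * (real m * inverse t ^ (m - Suc 0) * (- (inverse t ^ Suc (Suc 0))))) (at t)"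
        using 3 by (auto intro!: derivative_eq_intros)
      moreover have "exp (- inverse t) * (inverse t ^ Suc (Suc 0)) * inverse t ^ m
          + exp (- inverse t) * (real m * inverse t ^ (m - Suc 0) * (- (inverse t ^ Suc (Suc 0))))
          = flat_exp (m + 2) t - real m * flat_exp (m + 1) t"
        using 3 by (cases m) (simp_all add: flat_exp_def divide_inverse power_inverse)
      ultimately show ?thesis by (simp add: divide_inverse)
    qed
    then show ?thesis
      by (rule has_field_derivative_transform_within_open[where S = "{0<..}"])
        (use 3 in \<open>auto simp: flat_exp_def divide_inverse power_inverse\<close>)
  qed
qed

section \<open>Bump functions with polynomial factors\<close>

lemma real_polynomial_function_has_derivative:
  fixes p :: "'a::real_normed_vector \<Rightarrow> real"
  assumes "real_polynomial_function p"
  shows "\<exists>D. \<forall>x. (p has_derivative D x) (at x) \<and> (\<forall>v. real_polynomial_function (\<lambda>x. D x v))"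
  using assms
proof induction
  case (linear f)
  then show ?case
    by (intro exI[of _ "\<lambda>_. f"]) (auto intro: bounded_linear_imp_has_derivative real_polynomial_function.intros(2))
next
  case (const c)
  then show ?case
    by (intro exI[of _ "\<lambda>_ _. 0"]) (auto intro: real_polynomial_function.intros(2))
next
  case (add f g)
  then obtain D E where "\<And>x. (f has_derivative D x) (at x)" "\<And>v. real_polynomial_function (\<lambda>x. D x v)"
    "\<And>x. (g has_derivative E x) (at x)" "\<And>v. real_polynomial_function (\<lambda>x. E x v)" by blast
  then show ?case
    by (intro exI[of _ "\<lambda>x v. D x v + E x v"]) (auto intro: has_derivative_add real_polynomial_function.intros(3))
next
  case (mult f g)
  from mult.IH obtain D E where D: "\<And>x. (f has_derivative D x) (at x)" "\<And>v. real_polynomial_function (\<lambda>x. D x v)"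
    and E: "\<And>x. (g has_derivative E x) (at x)" "\<And>v. real_polynomial_function (\<lambda>x. E x v)" by blast
  note poly = real_polynomial_function.intros(3)[OF real_polynomial_function.intros(4)[OF mult.hyps(1) E(2)]
    real_polynomial_function.intros(4)[OF D(2) mult.hyps(2)]]
  show ?case
    by (intro exI[of _ "\<lambda>x v. f x * E x v + D x v * g x"] allI conjI has_derivative_mult D E poly)
qed

text \<open>The span of the functions \<open>p(x) t\<^sup>-\<^sup>m exp(-1/t)\<close>, where \<open>t = R\<^sup>2 - \<bar>x\<bar>\<^sup>2\<close> and \<open>p\<close> is a
  polynomial, is closed under directional derivatives.\<close>

inductive bump_span :: "real \<Rightarrow> ('a::euclidean_space \<Rightarrow> real) \<Rightarrow> bool" for R where
  base: "real_polynomial_function p \<Longrightarrow> bump_span R (\<lambda>x. p x * flat_exp m (R\<^sup>2 - x \<bullet> x))"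
| add: "bump_span R f \<Longrightarrow> bump_span R g \<Longrightarrow> bump_span R (\<lambda>x. f x + g x)"

lemma bump_span_has_derivative:
  assumes "bump_span R f"
  shows "\<exists>D. \<forall>x. (f has_derivative D x) (at x) \<and> (\<forall>v. bump_span R (\<lambda>x. D x v))"
  using assms
proof induction
  case (base p m)
  obtain D where D: "\<And>x. (p has_derivative D x) (at x)" "\<And>v. real_polynomial_function (\<lambda>x. D x v)"
    using real_polynomial_function_has_derivative[OF base] by blast
  define t where "t x = R\<^sup>2 - x \<bullet> x" for x :: 'a
  define E where "E x v = D x v * flat_exp m (t x) + ((- 2 * (x \<bullet> v) * p x) * flat_exp (m + 2) (t x)
      + (2 * real m * (x \<bullet> v) * p x) * flat_exp (m + 1) (t x))" for x v
  have "((\<lambda>x. p x * flat_exp m (t x)) has_derivative E x) (at x)" for x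
  proof -
    have t: "(t has_derivative (\<lambda>v. - 2 * (x \<bullet> v))) (at x)"
      unfolding t_def[abs_def] by (auto intro!: derivative_eq_intros simp: inner_commute)
    have "(flat_exp m has_derivative (\<lambda>s. s * (flat_exp (m + 2) (t x) - real m * flat_exp (m + 1) (t x)))) (at (t x))"
      using flat_exp_has_derivative[of m "t x"] unfolding has_field_derivative_def
      by (rule has_derivative_eq_rhs) (auto simp: fun_eq_iff)
    from diff_chain_at[OF t this]
    have "((\<lambda>x. flat_exp m (t x)) has_derivative (\<lambda>v. (- 2 * (x \<bullet> v)) * (flat_exp (m + 2) (t x) - real m * flat_exp (m + 1) (t x)))) (at x)"
      by (simp add: o_def)
    from has_derivative_mult[OF D(1) this] show ?thesis
      by (rule has_derivative_eq_rhs) (auto simp: E_def fun_eq_iff algebra_simps)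
  qed
  moreover have "bump_span R (\<lambda>x. E x v)" for v
  proof -
    have "real_polynomial_function (\<lambda>x. x \<bullet> v)"
      by (intro real_polynomial_function.intros(1) bounded_linear_inner_left)
    then have "real_polynomial_function (\<lambda>x. - 2 * (x \<bullet> v) * p x)" "real_polynomial_function (\<lambda>x. 2 * real m * (x \<bullet> v) * p x)"
      by (auto intro!: real_polynomial_function.intros(4) real_polynomial_function.intros(2) base)
    then show ?thesis unfolding E_def t_def
      by (intro bump_span.add bump_span.base D(2))
  qed
  ultimately show ?case unfolding t_def by blast
next
  case (add f g)
  then obtain D E where "\<And>x. (f has_derivative D x) (at x)" "\<And>v. bump_span R (\<lambda>x. D x v)"
    "\<And>x. (g has_derivative E x) (at x)" "\<And>v. bump_span R (\<lambda>x. E x v)" by blast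
  then show ?case
    by (intro exI[of _ "\<lambda>x v. D x v + E x v"]) (auto intro: has_derivative_add bump_span.add)
qed

lemma bump_span_C_k: "bump_span R f \<Longrightarrow> C_k k f"
proof (induction k arbitrary: f)
  case 0
  obtain D where "\<And>x. (f has_derivative D x) (at x)" using bump_span_has_derivative[OF 0] by blast
  then show ?case by (auto intro!: continuous_at_imp_continuous_on has_derivative_continuous)
next
  case (Suc k)
  obtain D where D: "\<And>x. (f has_derivative D x) (at x)" "\<And>v. bump_span R (\<lambda>x. D x v)"
    using bump_span_has_derivative[OF Suc.prems] by blast
  have "frechet_derivative f (at x) = D x" for x using frechet_derivative_at[OF D(1)] by simp
  moreover have "f differentiable_on UNIV" using D(1) by (auto simp: differentiable_on_def differentiable_def)
  ultimately show ?case using Suc.IH[OF D(2)] by simp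
qed

lemma C_k_of_real:
  fixes f :: "'a::euclidean_space \<Rightarrow> real"
  assumes "C_k k f"
  shows "C_k k (\<lambda>x. of_real (f x) :: 'b::real_normed_algebra_1)"
  using assms
proof (induction k arbitrary: f)
  case 0
  then show ?case by (auto intro: continuous_on_of_real)
next
  case (Suc k)
  have D: "(f has_derivative frechet_derivative f (at x)) (at x)" for x
    using Suc.prems by (auto simp: differentiable_on_def frechet_derivative_works)
  have D': "((\<lambda>x. of_real (f x) :: 'b) has_derivative (\<lambda>v. of_real (frechet_derivative f (at x) v))) (at x)" for x
    by (rule bounded_linear.has_derivative[OF bounded_linear_of_real D])
  have "frechet_derivative (\<lambda>x. of_real (f x) :: 'b) (at x) = (\<lambda>v. of_real (frechet_derivative f (at x) v))" for x
    using frechet_derivative_at[OF D'] by simp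
  moreover have "(\<lambda>x. of_real (f x) :: 'b) differentiable_on UNIV" using D' by (auto simp: differentiable_on_def differentiable_def)
  ultimately show ?case using Suc by simp
qed

text \<open>A polynomial takes the place of a convolution: \<open>h\<close> is divided by a bump
  \<open>\<phi>\<close>, the quotient is approximated on a ball by Stone-Weierstrass and multiplied
  back. The product is smooth, vanishes where \<open>\<phi>\<close> does, and
  \<open>\<phi> \<le> 1\<close> keeps the error at most \<open>e\<close>.\<close>

lemma smooth_approx_compact_support:
  fixes h :: "'a::euclidean_space \<Rightarrow> real"
  assumes h: "continuous_on UNIV h" and supp: "\<And>x. Z \<le> norm x \<Longrightarrow> h x = 0" and e: "0 < e"
  obtains k where "(\<lambda>x. of_real (k x) :: 'b::real_normed_algebra_1) \<in> Cc_infinity" "continuous_on UNIV k" "\<And>x. \<bar>h x - k x\<bar> \<le> e"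
proof -
  define Z' where "Z' = max Z 0"
  define R where "R = Z' + 1"
  have R: "0 < R" "Z' < R" "0 \<le> Z'" by (auto simp: R_def Z'_def)
  define \<phi> where "\<phi> x = flat_exp 0 (R\<^sup>2 - x \<bullet> x)" for x :: 'a
  define c0 where "c0 = flat_exp 0 (R\<^sup>2 - Z'\<^sup>2)"
  have sq: "Z'\<^sup>2 < R\<^sup>2" using R by (intro power_strict_mono) auto
  then have c0: "0 < c0" by (simp add: c0_def flat_exp_def)
  have "continuous_on UNIV (flat_exp 0)"
    using flat_exp_has_derivative by (intro continuous_at_imp_continuous_on ballI DERIV_isCont)
  then have \<phi>c: "continuous_on UNIV \<phi>" unfolding \<phi>_def[abs_def]
    by (rule continuous_on_compose2[of UNIV "flat_exp 0"]) (auto intro!: continuous_intros)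
  have \<phi>1: "0 \<le> \<phi> x" "\<phi> x \<le> 1" for x by (auto simp: \<phi>_def flat_exp_def)
  have \<phi>0: "\<phi> x = 0" if "R \<le> norm x" for x
  proof -
    have "R\<^sup>2 \<le> (norm x)\<^sup>2" using that R by (intro power_mono) auto
    then show ?thesis by (simp add: \<phi>_def flat_exp_def power2_norm_eq_inner)
  qed
  \<comment> \<open>The floor \<open>c0\<close> keeps the quotient continuous where
    \<open>\<phi>\<close> vanishes. It is the value of \<open>\<phi>\<close> on the sphere of radius
    \<open>Z'\<close>, hence inactive inside, and outside \<open>h\<close> is zero.\<close>
  define g where "g x = h x / max (\<phi> x) c0" for x
  have gc: "continuous_on UNIV g" unfolding g_def[abs_def]
    by (intro continuous_on_divide continuous_on_max h \<phi>c continuous_on_const) (use c0 in \<open>auto simp: max_def\<close>)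
  have g: "g x * \<phi> x = h x" for x
  proof (cases "Z \<le> norm x")
    case True
    then show ?thesis using supp by (simp add: g_def)
  next
    case False
    then have "norm x \<le> Z'" by (simp add: Z'_def)
    then have "(norm x)\<^sup>2 \<le> Z'\<^sup>2" by (intro power_mono) auto
    then have "R\<^sup>2 - Z'\<^sup>2 \<le> R\<^sup>2 - x \<bullet> x" by (simp add: power2_norm_eq_inner)
    then have "c0 \<le> \<phi> x" using sq by (simp add: c0_def \<phi>_def flat_exp_def frac_le)
    then show ?thesis using c0 by (simp add: g_def max_def)
  qed
  obtain p where p: "real_polynomial_function p" "\<And>x. x \<in> cball 0 R \<Longrightarrow> \<bar>g x - p x\<bar> < e"
    by (rule Stone_Weierstrass_real_polynomial_function[OF compact_cball continuous_on_subset[OF gc subset_UNIV] e, of "0::'a" R]) blast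
  define k where "k x = p x * \<phi> x" for x
  have span: "bump_span R k" unfolding k_def[abs_def] \<phi>_def by (rule bump_span.base[OF p(1)])
  show thesis
  proof (rule that)
    have "{x. (of_real (k x) :: 'b) \<noteq> 0} \<subseteq> cball 0 R"
    proof
      fix x assume "x \<in> {x. (of_real (k x) :: 'b) \<noteq> 0}"
      then show "x \<in> cball 0 R" using \<phi>0[of x] by (cases "R \<le> norm x") (auto simp: k_def)
    qed
    then have "compact (closure {x. (of_real (k x) :: 'b) \<noteq> 0})"
      by (meson bounded_cball bounded_subset compact_closure)
    then show "(\<lambda>x. of_real (k x) :: 'b) \<in> Cc_infinity"
      unfolding Cc_infinity_def using C_k_of_real[OF bump_span_C_k[OF span]] by auto
    show "continuous_on UNIV k" using bump_span_C_k[OF span, of 0] by simp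
    show "\<bar>h x - k x\<bar> \<le> e" for x
    proof (cases "R \<le> norm x")
      case True
      then show ?thesis using \<phi>0[OF True] g[of x] e by (simp add: k_def)
    next
      case False
      then have "\<bar>g x - p x\<bar> \<le> e" using p(2)[of x] by simp
      have "\<bar>h x - k x\<bar> = \<bar>g x - p x\<bar> * \<phi> x"
        using \<phi>1[of x] by (simp add: g[symmetric] k_def abs_mult flip: left_diff_distrib)
      also have "\<dots> \<le> e * 1" using \<phi>1[of x] \<open>\<bar>g x - p x\<bar> \<le> e\<close> e by (intro mult_mono) auto
      finally show ?thesis by simp
    qed
  qed
qed

section \<open>The maximal function on BMO and CMO\<close>

lemma locally_integrable_of_bmo_le:
  fixes f :: "'a::euclidean_space \<Rightarrow> 'b::{banach, second_countable_topology}"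
  assumes f: "f \<in> borel_measurable lebesgue" and bmo: "bmo_le V f N"
  shows "locally_integrable f"
  unfolding locally_integrable_def
proof (intro conjI allI impI f)
  fix K :: "'a set" assume K: "compact K"
  then obtain r where r: "0 < r" "K \<subseteq> ball 0 r" using compact_imp_bounded bounded_subset_ballD by blast
  have Ks: "K \<in> sets lebesgue" using K by (simp add: compact_imp_closed borel_closed)
  show "set_integrable lebesgue K f"
    unfolding set_integrable_def
  proof (rule integrableI_bounded)
    show "(\<lambda>x. indicat_real K x *\<^sub>R f x) \<in> borel_measurable lebesgue"
      using f Ks by (intro borel_measurable_scaleR borel_measurable_indicator) auto
    have "(\<integral>\<^sup>+x. ennreal (norm (indicat_real K x *\<^sub>R f x)) \<partial>lebesgue) \<le> (\<integral>\<^sup>+y\<in>ball 0 r. ennreal (norm (f y)) \<partial>lebesgue)"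
      using r by (intro nn_integral_mono) (auto simp: indicator_def)
    also have "\<dots> = abs_avg 0 r f * emeasure lebesgue (ball (0::'a) r)" by (rule nn_integral_ball_eq[OF r(1)])
    also have "\<dots> < \<infinity>"
      using osc_le_abs_avg_finite[OF f r(1) bmo_leD(1)[OF bmo r(1)], of 0] emeasure_lebesgue_ball_pos(4)[OF r(1), of "0::'a"]
      by (simp add: ennreal_mult_less_top del: emeasure_completion)
    finally show "(\<integral>\<^sup>+x. ennreal (norm (indicat_real K x *\<^sub>R f x)) \<partial>lebesgue) < \<infinity>" .
  qed
qed

lemma bmo_le_of_bounded:
  fixes h :: "'a::euclidean_space \<Rightarrow> 'b::real_normed_vector"
  assumes "\<And>x. norm (h x) \<le> e"
  shows "bmo_le V h e"
  unfolding bmo_le_def using abs_avg_le_sup[of _ _ h e] assms osc_le_of_abs_avg by blast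

lemma Cc_infinityD:
  assumes "g \<in> Cc_infinity"
  shows "continuous_on UNIV g" "\<exists>S. \<forall>x. S \<le> norm x \<longrightarrow> g x = 0"
proof -
  have "C_k 0 g" using assms unfolding Cc_infinity_def by blast
  then show "continuous_on UNIV g" by simp
  have "bounded {x. g x \<noteq> 0}"
    using assms closure_subset by (auto simp: Cc_infinity_def intro: bounded_subset compact_imp_bounded)
  then obtain B where "\<And>x. g x \<noteq> 0 \<Longrightarrow> norm x \<le> B" unfolding bounded_iff by blast
  then show "\<exists>S. \<forall>x. S \<le> norm x \<longrightarrow> g x = 0" by (intro exI[of _ "B + 1"]) force
qed

theorem theorem1p1:
  fixes V :: "'a::euclidean_space \<Rightarrow> real" and q :: real
  assumes "DIM('a) \<ge> 3"
    and "q \<ge> real DIM('a) / 2"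
    and "V \<in> reverse_Holder q"
    and "\<not> (AE x in lebesgue. V x = 0)"
  shows "(\<exists>C::real. C > 0 \<and>
      (\<forall>f :: 'a \<Rightarrow> 'b::{real_normed_field, euclidean_space}. f \<in> BMO_L V \<longrightarrow>
        (AE x in lebesgue. maximal_op f x < \<infinity>) \<and>
        maximal_fun f \<in> BMO_L V \<and>
        BMO_L_norm V (maximal_fun f) \<le> ennreal C * BMO_L_norm V f)) \<and>
    (\<forall>f :: 'a \<Rightarrow> 'b. f \<in> CMO_L V \<longrightarrow> maximal_fun f \<in> CMO_L V)"
proof -
  obtain S where S: "0 < S" and rho: "\<And>x. critical_radius V x \<le> ennreal (2 * norm x + 2 * S)"
    using critical_radius_le_linear[OF assms(3,1,2,4)] by blast
  have fin: "critical_radius V x < \<infinity>" for x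
    using rho[of x] by (rule le_less_trans) simp
  have loc: "\<exists>r>0. \<forall>x. norm x \<le> B \<longrightarrow> ennreal r \<le> critical_radius V x" for B
    using critical_radius_ge_locally[OF assms(3,1,2), of B] by blast
  \<comment> \<open>The 24 is the 8 of the maximal estimate times the 3 lost in returning to the
    norm.\<close>
  define C where "C = 24 * (60::real) ^ DIM('a)"
  have C: "0 < C" by (simp add: C_def)
  have meas: "maximal_fun f \<in> borel_measurable lebesgue" "real_maximal f \<in> borel_measurable lebesgue" for f :: "'a \<Rightarrow> 'b"
  proof -
    show *: "real_maximal f \<in> borel_measurable lebesgue"
      using real_maximal_measurable[of f] by (intro measurable_completion) simp
    show "maximal_fun f \<in> borel_measurable lebesgue"
      unfolding maximal_fun_def[abs_def] 
      by (intro measurable_compose[OF * borel_measurable_continuous_onI] linear_continuous_on bounded_linear_of_real)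
  qed
  have main: "(AE x in lebesgue. maximal_op f x < \<infinity>) \<and> bmo_le V (real_maximal f) (8 * 60 ^ DIM('a) * N) \<and>
      maximal_fun f \<in> BMO_L V \<and> BMO_L_norm V (maximal_fun f) \<le> ennreal (C * N)"
    if f: "f \<in> BMO_L V" and N: "0 < N" "BMO_L_norm V f \<le> ennreal N" for f :: "'a \<Rightarrow> 'b" and N
  proof -
    have fm: "f \<in> borel_measurable lebesgue" using f by (simp add: BMO_L_def locally_integrable_def)
    note bf = bmo_le_of_norm[OF N(2)]
    note bM = real_maximal_bmo_le[OF fm bf N(1) fin]
    have bM': "bmo_le V (maximal_fun f) (8 * 60 ^ DIM('a) * N)"
      unfolding maximal_fun_def[abs_def] by (rule bmo_le_of_real[OF bM])
    have "BMO_L_norm V (maximal_fun f) \<le> ennreal (3 * (8 * 60 ^ DIM('a) * N))"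
      using N by (intro norm_le_of_bmo_le[OF meas(1) bM']) auto
    also have "3 * (8 * 60 ^ DIM('a) * N) = C * N" by (simp add: C_def)
    finally have le: "BMO_L_norm V (maximal_fun f) \<le> ennreal (C * N)" .
    then have "maximal_fun f \<in> BMO_L V"
      using locally_integrable_of_bmo_le[OF meas(1) bM'] by (simp add: BMO_L_def le_less_trans)
    with le bM maximal_op_AE_finite[OF fm bf N(1) fin] show ?thesis by blast
  qed
  have part1: "(AE x in lebesgue. maximal_op f x < \<infinity>) \<and> maximal_fun f \<in> BMO_L V \<and>
        BMO_L_norm V (maximal_fun f) \<le> ennreal C * BMO_L_norm V f"
    if f: "f \<in> BMO_L V" for f :: "'a \<Rightarrow> 'b"
  proof -
    obtain x where x: "BMO_L_norm V f = ennreal x" "0 \<le> x"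
      using f by (cases "BMO_L_norm V f" rule: ennreal_cases) (auto simp: BMO_L_def)
    have "BMO_L_norm V f \<le> ennreal (x + 1)" using x by (simp add: ennreal_leI)
    from main[OF f _ this] x have 1: "AE x in lebesgue. maximal_op f x < \<infinity>" "maximal_fun f \<in> BMO_L V" by auto
    \<comment> \<open>The estimate requires a strictly positive bound, while the norm may be zero;
      it is applied with \<open>x + e / C\<close> for every positive \<open>e\<close>.\<close>
    have "BMO_L_norm V (maximal_fun f) \<le> ennreal (C * x)"
    proof (rule ennreal_le_epsilon)
      fix e :: real assume e: "0 < e"
      have "BMO_L_norm V f \<le> ennreal (x + e / C)" using x e C by (simp add: ennreal_leI)
      then have "BMO_L_norm V (maximal_fun f) \<le> ennreal (C * (x + e / C))"
        using main[OF f, of "x + e / C"] x e C by (simp add: add_nonneg_pos)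
      also have "C * (x + e / C) = C * x + e" using C by (simp add: field_simps)
      also have "ennreal (C * x + e) = ennreal (C * x) + ennreal e" using C x e by simp
      finally show "BMO_L_norm V (maximal_fun f) \<le> ennreal (C * x) + ennreal e" .
    qed
    also have "ennreal (C * x) = ennreal C * BMO_L_norm V f" using x C by (simp add: ennreal_mult)
    finally show ?thesis using 1 by blast
  qed
  have part2: "maximal_fun f \<in> CMO_L V" if f: "f \<in> CMO_L V" for f :: "'a \<Rightarrow> 'b"
  proof -
    have fB: "f \<in> BMO_L V" using f by (simp add: CMO_L_def)
    then have fm: "f \<in> borel_measurable lebesgue" by (simp add: BMO_L_def locally_integrable_def)
    obtain x where x: "BMO_L_norm V f = ennreal x" "0 \<le> x"
      using fB by (cases "BMO_L_norm V f" rule: ennreal_cases) (auto simp: BMO_L_def)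
    have N: "0 < x + 1" "BMO_L_norm V f \<le> ennreal (x + 1)" using x by (auto simp: ennreal_leI)
    have approx: "\<exists>g S. continuous_on UNIV g \<and> (\<forall>x. S \<le> norm x \<longrightarrow> g x = 0) \<and> bmo_le V (\<lambda>x. f x - g x) e"
      if e: "0 < e" for e
    proof -
      obtain g where g: "g \<in> Cc_infinity" "BMO_L_norm V (\<lambda>x. f x - g x) < ennreal e"
        using f e unfolding CMO_L_def by blast
      then show ?thesis using Cc_infinityD[OF g(1)] bmo_le_of_norm[OF less_imp_le[OF g(2)]] by blast
    qed
    have van: "vanishing V (real_maximal f)"
      by (rule real_maximal_vanishing[OF fm bmo_le_of_norm[OF N(2)] N(1) approx fin loc])
    have "bmo_le V (real_maximal f) (8 * 60 ^ DIM('a) * (x + 1))" using main[OF fB N] by blast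
    from locally_integrable_of_bmo_le[OF meas(2) this]
    have int: "set_integrable lebesgue (ball c r) (real_maximal f)" for c r
      unfolding locally_integrable_def by (metis ball_in_sets_lebesgue ball_subset_cball compact_cball set_integrable_subset)
    have "\<exists>g\<in>Cc_infinity. BMO_L_norm V (\<lambda>x. maximal_fun f x - g x) < ennreal \<epsilon>" if \<epsilon>: "0 < \<epsilon>" for \<epsilon>
    proof -
      \<comment> \<open>Two errors of size \<open>e\<close>, from compact support and from
        smoothing, times the factor 3 of the norm, give \<open>6 * e < \<epsilon>\<close>.\<close>
      define e where "e = \<epsilon> / 10"
      have e: "0 < e" "3 * (e + e) < \<epsilon>" using \<epsilon> by (auto simp: e_def)
      obtain h Z where h: "continuous_on UNIV h" "\<And>x. Z \<le> norm x \<Longrightarrow> h x = 0" "bmo_le V (\<lambda>x. real_maximal f x - h x) e"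
        by (rule vanishing_approx_compact_support[OF meas(2) _ int van rho S e(1)]) auto
      obtain k where k: "(\<lambda>x. of_real (k x) :: 'b) \<in> Cc_infinity" "continuous_on UNIV k" "\<And>x. \<bar>h x - k x\<bar> \<le> e"
        by (rule smooth_approx_compact_support[OF h(1,2) e(1)]) auto
      have hm: "h \<in> borel_measurable lebesgue" "k \<in> borel_measurable lebesgue"
        using borel_measurable_continuous_onI[OF h(1)] borel_measurable_continuous_onI[OF k(2)]
        by (auto intro!: measurable_completion)
      have "bmo_le V (\<lambda>x. (real_maximal f x - h x) + (h x - k x)) (e + e)"
        using k(3) hm meas(2)[of f] e by (intro bmo_le_add h(3) bmo_le_of_bounded) auto
      then have "bmo_le V (\<lambda>x. of_real (real_maximal f x - k x) :: 'b) (e + e)"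
        by (intro bmo_le_of_real) simp
      then have "bmo_le V (\<lambda>x. maximal_fun f x - of_real (k x)) (e + e)"
        by (simp add: maximal_fun_def)
      then have "BMO_L_norm V (\<lambda>x. maximal_fun f x - of_real (k x)) \<le> ennreal (3 * (e + e))"
        using meas(1)[of f] hm(2) e by (intro norm_le_of_bmo_le) auto
      also have "\<dots> < ennreal \<epsilon>" using e by (intro ennreal_lessI) auto
      finally show ?thesis by (intro bexI[OF _ k(1)])
    qed
    then show ?thesis using main[OF fB N] unfolding CMO_L_def by blast
  qed
  show ?thesis using C part1 part2 by blast
qed

end
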